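(* Let $R_0$ be a commutative Noetherian domain, let $S=R_0[U_1,\dots,U_s]$ be graded by $\deg U_i=d_i>0$ and elements of $R_0$ having degree $0$, let $I\subset S$ be a homogeneous ideal generated by homogeneous elements $f_1,\dots,f_r\in S$, and let $R=S/I$. Fix any $d\in\mathcal{D}$. Then each associated prime of the $R_0$-module $H^s_{R_+}(R)_{-d}$ contains the content $\mathrm{c}(I)$ of $I$. In particular, $H^s_{R_+}(R)_{-d}=0$ if and only if $\mathrm{c}(I)=R_0$.
   Context: Here $s\ge 1$, $U_1,\dots,U_s$ are indeterminates of positive integer degrees $d_1,\dots,d_s$, and $R_+$ is the ideal of $R$ generated by the images of $U_1,\dots,U_s$. $H^s_{R_+}(R)$ is the $s$-th local cohomology module of $R$ with respect to $R_+$, with its natural $\mathbb{Z}$-grading, and $H^s_{R_+}(R)_{-d}$ is its homogeneous component of degree $-d$, which is an $R_0$-module. $\mathcal{D}=\{\lambda_1d_1+\dots+\lambda_sd_s : \lambda_1,\dots,\lambda_s \text{ integers} \ge 1\}$; equivalently, $\mathcal{D}$ is the set of integers $d$ for which the degree $-d$ component of $H^s_{S_+}(S)$ is nonzero, where $S_+=\langle U_1,\dots,U_s\rangle$. For $f=\sum_{\lambda} a_\lambda U^\lambda\in S$ (with $a_\lambda\in R_0$), the content $\mathrm{c}(f)$ is the ideal of $R_0$ generated by all the coefficients $a_\lambda$. For an ideal $J\subset S$, the content $\mathrm{c}(J)$ is the ideal of $R_0$ generated by the contents of all elements of $J$. *)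

theory Defs
  imports
    "HOL-Algebra.Module"
    "HOL-Algebra.Ideal_Product"
    "HOL-Algebra.QuotRing"
    "HOL-Algebra.Ring_Divisibility"
    "HOL-Decision_Procs.Algebra_Aux"
    "HOL-Library.Cardinality"
    "HOL-Library.Poly_Mapping"
begin

text \<open>
  The base ring \<open>R\<^sub>0\<close> is a type \<open>'a\<close> of class \<open>idom\<close>, the indeterminates are indexed by a finite
  type \<open>'n\<close> with \<open>s = CARD('n)\<close> elements, and \<^const>\<open>cring_class_ops\<close> turns \<open>'a\<close> and the type of
  polynomials over it into rings in the sense of HOL-Algebra. The quotient \<open>R = S/I\<close> and all modules are HOL-Algebra
  structures.
\<close>

section \<open>The polynomial ring, its grading and contents\<close>

type_synonym ('n, 'a) mpoly = "('n \<Rightarrow>\<^sub>0 nat) \<Rightarrow>\<^sub>0 'a"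

definition indet :: "'n \<Rightarrow> ('n, 'a::comm_ring_1) mpoly" where
  "indet i = Poly_Mapping.single (Poly_Mapping.single i 1) 1"

definition const_poly :: "'a \<Rightarrow> ('n, 'a::comm_ring_1) mpoly" where
  "const_poly a = Poly_Mapping.single 0 a"

definition wdegree :: "('n::finite \<Rightarrow> nat) \<Rightarrow> ('n \<Rightarrow>\<^sub>0 nat) \<Rightarrow> nat" where
  "wdegree dg m = (\<Sum>i\<in>UNIV. Poly_Mapping.lookup m i * dg i)"

definition poly_component :: "('n::finite \<Rightarrow> nat) \<Rightarrow> int \<Rightarrow> ('n, 'a::comm_ring_1) mpoly set" where
  "poly_component dg k = {f. \<forall>m. Poly_Mapping.lookup f m \<noteq> 0 \<longrightarrow> int (wdegree dg m) = k}"

definition homogeneous_poly :: "('n::finite \<Rightarrow> nat) \<Rightarrow> ('n, 'a::comm_ring_1) mpoly \<Rightarrow> bool" where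
  "homogeneous_poly dg f \<longleftrightarrow> (\<exists>k. f \<in> poly_component dg k)"

definition content_poly :: "('n, 'a::comm_ring_1) mpoly \<Rightarrow> 'a set" where
  "content_poly f = Idl\<^bsub>cring_class_ops\<^esub> (range (Poly_Mapping.lookup f))"

definition content_ideal :: "('n, 'a::comm_ring_1) mpoly set \<Rightarrow> 'a set" where
  "content_ideal J = Idl\<^bsub>cring_class_ops\<^esub> (\<Union>f\<in>J. content_poly f)"

text \<open>The set \<open>\<D>\<close>.\<close>

definition top_degrees :: "('n::finite \<Rightarrow> nat) \<Rightarrow> int set" where
  "top_degrees dg = {\<Sum>i\<in>UNIV. l i * int (dg i) | l. \<forall>i. l i \<ge> 1}"


section \<open>The graded ring \<open>R = S/I\<close>\<close>

definition quot_ring :: "('n, 'a::comm_ring_1) mpoly set \<Rightarrow> ('n, 'a) mpoly set ring" where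
  "quot_ring I = cring_class_ops Quot I"

definition quot_proj :: "('n, 'a::comm_ring_1) mpoly set \<Rightarrow> ('n, 'a) mpoly \<Rightarrow> ('n, 'a) mpoly set" where
  "quot_proj I f = I +>\<^bsub>cring_class_ops\<^esub> f"

definition quot_component ::
    "('n::finite \<Rightarrow> nat) \<Rightarrow> ('n, 'a::comm_ring_1) mpoly set \<Rightarrow> int \<Rightarrow> ('n, 'a) mpoly set set" where
  "quot_component dg I k = quot_proj I ` poly_component dg k"

definition irrelevant_ideal ::
    "('n::finite, 'a::comm_ring_1) mpoly set \<Rightarrow> ('n, 'a) mpoly set set" where
  "irrelevant_ideal I = Idl\<^bsub>quot_ring I\<^esub> (range (\<lambda>i. quot_proj I (indet i)))"


section \<open>Graded modules\<close>

text \<open>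
  A \<open>\<int>\<close>-graded module over a graded ring consists of a module \<open>M\<close> and the family \<open>\<M>\<close> of its
  homogeneous components; the family \<open>\<A>\<close> is the grading of the ring \<open>A\<close>.
\<close>

definition graded_module ::
    "'r ring \<Rightarrow> (int \<Rightarrow> 'r set) \<Rightarrow> ('r, 'e) module \<Rightarrow> (int \<Rightarrow> 'e set) \<Rightarrow> bool" where
  "graded_module A \<A> M \<M> \<longleftrightarrow>
     module A M \<and>
     (\<forall>n. additive_subgroup (\<M> n) M) \<and>
     (\<forall>k n. \<forall>a\<in>\<A> k. \<forall>x\<in>\<M> n. a \<odot>\<^bsub>M\<^esub> x \<in> \<M> (k + n)) \<and>
     (\<forall>x\<in>carrier M. \<exists>!c. (\<forall>n. c n \<in> \<M> n) \<and> finite {n. c n \<noteq> \<zero>\<^bsub>M\<^esub>} \<and>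
        x = (\<Oplus>\<^bsub>M\<^esub>n\<in>{n. c n \<noteq> \<zero>\<^bsub>M\<^esub>}. c n))"

definition graded_hom ::
    "'r ring \<Rightarrow> ('r, 'e) module \<Rightarrow> (int \<Rightarrow> 'e set) \<Rightarrow> ('r, 'f) module \<Rightarrow> (int \<Rightarrow> 'f set)
      \<Rightarrow> ('e \<Rightarrow> 'f) set" where
  "graded_hom A M \<M> N \<N> =
     {h. h \<in> carrier M \<rightarrow> carrier N \<and>
         (\<forall>x\<in>carrier M. \<forall>y\<in>carrier M. h (x \<oplus>\<^bsub>M\<^esub> y) = h x \<oplus>\<^bsub>N\<^esub> h y) \<and>
         (\<forall>a\<in>carrier A. \<forall>x\<in>carrier M. h (a \<odot>\<^bsub>M\<^esub> x) = a \<odot>\<^bsub>N\<^esub> h x) \<and>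
         (\<forall>n. h ` \<M> n \<subseteq> \<N> n)}"

text \<open>
  Injective objects of the category of graded \<open>A\<close>-modules. HOL cannot quantify over types inside a
  formula, so the test modules \<open>M\<close>, \<open>N\<close> range over the graded modules whose elements lie in the
  type \<open>'e\<close> of the elements of \<open>E\<close>. If \<open>'e\<close> is large enough to contain a copy of \<open>A\<close>, these
  include copies of all shifts of \<open>A\<close> and of their homogeneous submodules, and by the graded form
  of Baer's criterion \<open>E\<close> is then injective in the unrestricted sense. An injective resolution of
  \<open>A\<close> itself always satisfies this condition, because its augmentation embeds \<open>A\<close> into \<open>E 0\<close>.
\<close>

definition graded_injective ::
    "'r ring \<Rightarrow> (int \<Rightarrow> 'r set) \<Rightarrow> ('r, 'e) module \<Rightarrow> (int \<Rightarrow> 'e set) \<Rightarrow> bool" where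
  "graded_injective A \<A> E \<E> \<longleftrightarrow>
     graded_module A \<A> E \<E> \<and>
     (\<forall>(M :: ('r, 'e) module) \<M> (N :: ('r, 'e) module) \<N> j f.
        graded_module A \<A> M \<M> \<longrightarrow> graded_module A \<A> N \<N> \<longrightarrow>
        j \<in> graded_hom A M \<M> N \<N> \<longrightarrow> inj_on j (carrier M) \<longrightarrow>
        f \<in> graded_hom A M \<M> E \<E> \<longrightarrow>
        (\<exists>g \<in> graded_hom A N \<N> E \<E>. \<forall>x\<in>carrier M. g (j x) = f x))"

text \<open>
  An injective resolution \<open>0 \<rightarrow> M \<rightarrow> E 0 \<rightarrow> E 1 \<rightarrow> \<dots>\<close> of \<open>M\<close> in the category of graded modules, with
  augmentation \<open>\<epsilon>\<close> and differentials \<open>\<delta> i : E i \<rightarrow> E (i + 1)\<close>.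
\<close>

definition graded_injective_resolution ::
    "'r ring \<Rightarrow> (int \<Rightarrow> 'r set) \<Rightarrow> ('r, 'f) module \<Rightarrow> (int \<Rightarrow> 'f set) \<Rightarrow>
     (nat \<Rightarrow> ('r, 'e) module) \<Rightarrow> (nat \<Rightarrow> int \<Rightarrow> 'e set) \<Rightarrow> ('f \<Rightarrow> 'e) \<Rightarrow> (nat \<Rightarrow> 'e \<Rightarrow> 'e) \<Rightarrow> bool" where
  "graded_injective_resolution A \<A> M \<M> E \<E> \<epsilon> \<delta> \<longleftrightarrow>
     graded_module A \<A> M \<M> \<and>
     (\<forall>i. graded_injective A \<A> (E i) (\<E> i)) \<and>
     \<epsilon> \<in> graded_hom A M \<M> (E 0) (\<E> 0) \<and>
     (\<forall>i. \<delta> i \<in> graded_hom A (E i) (\<E> i) (E (Suc i)) (\<E> (Suc i))) \<and>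
     inj_on \<epsilon> (carrier M) \<and>
     \<epsilon> ` carrier M = {x \<in> carrier (E 0). \<delta> 0 x = \<zero>\<^bsub>E (Suc 0)\<^esub>} \<and>
     (\<forall>i. \<delta> i ` carrier (E i) = {x \<in> carrier (E (Suc i)). \<delta> (Suc i) x = \<zero>\<^bsub>E (Suc (Suc i))\<^esub>})"

definition regular_module :: "'r ring \<Rightarrow> ('r, 'r) module" where
  "regular_module A =
     \<lparr>carrier = carrier A, monoid.mult = monoid.mult A, one = \<one>\<^bsub>A\<^esub>, ring.zero = \<zero>\<^bsub>A\<^esub>, add = add A,
      smult = monoid.mult A\<rparr>"


section \<open>Local cohomology\<close>

text \<open>The \<open>\<aa>\<close>-torsion submodule \<open>\<Gamma>\<^sub>\<aa>(M)\<close>; powers of \<open>\<aa>\<close> are taken in the monoid of ideals of \<open>A\<close>.\<close>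

definition torsion_submodule :: "'r ring \<Rightarrow> 'r set \<Rightarrow> ('r, 'e) module \<Rightarrow> ('r, 'e) module" where
  "torsion_submodule A \<aa> M =
     M\<lparr>carrier := {x \<in> carrier M. \<exists>n::nat. \<forall>a \<in> \<aa> [^]\<^bsub>ideals_set A\<^esub> n. a \<odot>\<^bsub>M\<^esub> x = \<zero>\<^bsub>M\<^esub>}\<rparr>"

text \<open>
  Quotient modules, analogous to \<^const>\<open>FactRing\<close>. The fields \<open>mult\<close> and \<open>one\<close> of a module
  structure carry no meaning.
\<close>

definition quotient_module :: "('r, 'e) module \<Rightarrow> 'e set \<Rightarrow> ('r, 'e set) module" where
  "quotient_module M N =
     \<lparr>carrier = a_rcosets\<^bsub>M\<^esub> N, monoid.mult = undefined, one = undefined, ring.zero = N, add = set_add M,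
      smult = (\<lambda>a Y. \<Union>y\<in>Y. N +>\<^bsub>M\<^esub> (a \<odot>\<^bsub>M\<^esub> y))\<rparr>"

definition cocycles :: "(nat \<Rightarrow> ('r, 'e) module) \<Rightarrow> (nat \<Rightarrow> 'e \<Rightarrow> 'e) \<Rightarrow> nat \<Rightarrow> 'e set" where
  "cocycles C \<delta> i = {x \<in> carrier (C i). \<delta> i x = \<zero>\<^bsub>C (Suc i)\<^esub>}"

definition coboundaries :: "(nat \<Rightarrow> ('r, 'e) module) \<Rightarrow> (nat \<Rightarrow> 'e \<Rightarrow> 'e) \<Rightarrow> nat \<Rightarrow> 'e set" where
  "coboundaries C \<delta> i = (case i of 0 \<Rightarrow> {\<zero>\<^bsub>C 0\<^esub>} | Suc j \<Rightarrow> \<delta> j ` carrier (C j))"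

definition cohomology ::
    "(nat \<Rightarrow> ('r, 'e) module) \<Rightarrow> (nat \<Rightarrow> 'e \<Rightarrow> 'e) \<Rightarrow> nat \<Rightarrow> ('r, 'e set) module" where
  "cohomology C \<delta> i = quotient_module ((C i)\<lparr>carrier := cocycles C \<delta> i\<rparr>) (coboundaries C \<delta> i)"

definition cohomology_component ::
    "(nat \<Rightarrow> ('r, 'e) module) \<Rightarrow> (nat \<Rightarrow> int \<Rightarrow> 'e set) \<Rightarrow> (nat \<Rightarrow> 'e \<Rightarrow> 'e) \<Rightarrow> nat \<Rightarrow> int \<Rightarrow> 'e set set"
    where
  "cohomology_component C \<C> \<delta> i n =
     (\<lambda>x. coboundaries C \<delta> i +>\<^bsub>C i\<^esub> x) ` (cocycles C \<delta> i \<inter> \<C> i n)"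

text \<open>
  For an injective resolution \<open>(E, \<delta>)\<close> of \<open>M\<close>, the module \<open>H\<^sup>i\<^sub>\<aa>(M)\<close> is the value at \<open>M\<close> of the
  \<open>i\<close>-th right derived functor of \<open>\<Gamma>\<^sub>\<aa>\<close>, i.e. the \<open>i\<close>-th cohomology of the complex \<open>\<Gamma>\<^sub>\<aa>(E)\<close>.
  When \<open>E\<close> is a resolution by injective graded modules, the components of \<open>E\<close> induce the grading
  of \<open>H\<^sup>i\<^sub>\<aa>(M)\<close>.
\<close>

definition local_cohomology ::
    "'r ring \<Rightarrow> 'r set \<Rightarrow> (nat \<Rightarrow> ('r, 'e) module) \<Rightarrow> (nat \<Rightarrow> 'e \<Rightarrow> 'e) \<Rightarrow> nat \<Rightarrow> ('r, 'e set) module"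
    where
  "local_cohomology A \<aa> E \<delta> i = cohomology (\<lambda>j. torsion_submodule A \<aa> (E j)) \<delta> i"

definition local_cohomology_component ::
    "'r ring \<Rightarrow> 'r set \<Rightarrow> (nat \<Rightarrow> ('r, 'e) module) \<Rightarrow> (nat \<Rightarrow> int \<Rightarrow> 'e set) \<Rightarrow> (nat \<Rightarrow> 'e \<Rightarrow> 'e)
      \<Rightarrow> nat \<Rightarrow> int \<Rightarrow> 'e set set" where
  "local_cohomology_component A \<aa> E \<E> \<delta> i n =
     cohomology_component (\<lambda>j. torsion_submodule A \<aa> (E j)) \<E> \<delta> i n"

text \<open>
  The component \<open>H\<^sup>i\<^bsub>R\<^sub>+\<^esub>(R)\<^sub>n\<close> for \<open>R = S/I\<close> as a module over \<open>R\<^sub>0\<close>, which acts through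
  \<open>R\<^sub>0 \<rightarrow> S \<rightarrow> R\<close>; \<open>(E, \<E>, \<delta>)\<close> is a graded injective resolution of \<open>R\<close>.
\<close>

definition lc_component_module ::
    "('n::finite, 'a::comm_ring_1) mpoly set \<Rightarrow> (nat \<Rightarrow> (('n, 'a) mpoly set, 'e) module)
      \<Rightarrow> (nat \<Rightarrow> int \<Rightarrow> 'e set) \<Rightarrow> (nat \<Rightarrow> 'e \<Rightarrow> 'e) \<Rightarrow> nat \<Rightarrow> int \<Rightarrow> ('a, 'e set) module" where
  "lc_component_module I E \<E> \<delta> i n =
     (let H = local_cohomology (quot_ring I) (irrelevant_ideal I) E \<delta> i in
      \<lparr>carrier = local_cohomology_component (quot_ring I) (irrelevant_ideal I) E \<E> \<delta> i n,
       monoid.mult = undefined, one = undefined, ring.zero = \<zero>\<^bsub>H\<^esub>, add = add H,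
       smult = (\<lambda>r x. quot_proj I (const_poly r) \<odot>\<^bsub>H\<^esub> x)\<rparr>)"


section \<open>Associated primes\<close>

definition associated_primes :: "'r ring \<Rightarrow> ('r, 'e) module \<Rightarrow> 'r set set" where
  "associated_primes A M =
     {P. primeideal P A \<and> (\<exists>x\<in>carrier M. P = {a \<in> carrier A. a \<odot>\<^bsub>M\<^esub> x = \<zero>\<^bsub>M\<^esub>})}"

end

theory Submission
  imports Defs
begin

text \<open>
  Let \<open>u\<^sub>i\<close> be the image of \<open>U\<^sub>i\<close> in \<open>R\<close>. Over the Noetherian ring \<open>R\<close> the torsion functors of an
  injective graded module \<open>E\<close> satisfy: \<open>\<Gamma>\<^bsub>(u\<^sub>1,\<dots>,u\<^sub>k)\<^esub>(E)\<close> is divisible by \<open>u\<^bsub>k+1\<^esub>\<close> up to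
  \<open>u\<^bsub>k+1\<^esub>\<close>-torsion. Adding one indeterminate at a time and using long exact sequences, the \<open>k\<close>-th
  cohomology of \<open>\<Gamma>\<^bsub>(u\<^sub>1,\<dots>,u\<^sub>k)\<^esub>(E\<^sup>\<bullet>)\<close> vanishes in higher degrees and its top part consists of
  fractions \<open>r / u\<^sub>1\<^bsup>t\<^sub>1\<^esup> \<cdots> u\<^sub>k\<^bsup>t\<^sub>k\<^esup>\<close>, that is, it is the direct limit of the
  modules \<open>R / (u\<^sub>1\<^sup>p, \<dots>, u\<^sub>k\<^sup>p)\<close>. So \<open>H\<^sup>s\<^bsub>R\<^sub>+\<^esub>(R)\<^bsub>-d\<^esub>\<close> is the cokernel of multiplication by \<open>I\<close> on inverse
  monomials \<open>U\<^bsup>-\<lambda>\<^esup>\<close> with \<open>\<lambda>\<^sub>i \<ge> 1\<close>. A triangularity argument for a monomial order, applied to the terms of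
  \<open>f \<in> I\<close> one after the other, shows that every coefficient of \<open>f\<close> acts nilpotently on it. Conversely,
  modulo \<open>c(I)\<close> all these relations become zero, and there is an inverse monomial of degree \<open>-d\<close>.
\<close>

section \<open>Hilbert's basis theorem\<close>

text \<open>Injectivity may be tested only on modules whose elements lie in \<open>'e\<close>. Every
  test here extends a map from a homogeneous ideal of R, and localizations never occur as modules: a
  fraction is a relation between a numerator and a cocycle, and division by U_i is an equation that
  holds after multiplication by a power of U_i. Hilbert's basis theorem has one purpose, to stop a
  chain of colon ideals (b : u^k); this is what makes the map that divides by u^t well defined.

  The denominator depends on the cocycle, and so does every exponent derived from it. What is proved
  is that for each cocycle x and each a in c(I) some power of a carries x to a coboundary; the power
  may change with x. This elementwise form is enough. A prime that is the annihilator of the class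
  of x contains a once it contains a power of a, and for c(I) = R_0 the element 1 = 1^N already
  kills every class.\<close>

definition subring_of_class :: "'b::comm_ring_1 set \<Rightarrow> bool" where
  "subring_of_class B \<longleftrightarrow>
     1 \<in> B \<and> (\<forall>x\<in>B. - x \<in> B) \<and> (\<forall>x\<in>B. \<forall>y\<in>B. x + y \<in> B \<and> x * y \<in> B)"

definition ideal_of :: "'b::comm_ring_1 set \<Rightarrow> 'b set \<Rightarrow> bool" where
  "ideal_of B J \<longleftrightarrow>
     J \<subseteq> B \<and> 0 \<in> J \<and> (\<forall>x\<in>J. \<forall>y\<in>J. x + y \<in> J) \<and> (\<forall>b\<in>B. \<forall>x\<in>J. b * x \<in> J)"

text \<open>Rings are subsets of one fixed type. Adjoining an indeterminate enlarges the subset and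
  leaves the type alone, so the basis theorem can be iterated.\<close>

definition acc_ideals :: "'b::comm_ring_1 set \<Rightarrow> bool" where
  "acc_ideals B \<longleftrightarrow>
     (\<forall>J. (\<forall>k. ideal_of B (J k) \<and> J k \<subseteq> J (Suc k)) \<longrightarrow> (\<exists>N::nat. \<forall>k\<ge>N. J k = J N))"

lemma ideal_ofD:
  assumes "ideal_of B J"
  shows "J \<subseteq> B" "0 \<in> J" "x \<in> J \<Longrightarrow> y \<in> J \<Longrightarrow> x + y \<in> J" "b \<in> B \<Longrightarrow> x \<in> J \<Longrightarrow> b * x \<in> J"
  using assms by (auto simp: ideal_of_def)

lemma acc_idealsD:
  assumes "acc_ideals B" "\<And>k. ideal_of B (J k)" "\<And>k. J k \<subseteq> J (Suc k)"
  shows "\<exists>N::nat. \<forall>k\<ge>N. J k = J N"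
  using assms unfolding acc_ideals_def by blast

lemma subring_of_classD:
  assumes "subring_of_class B"
  shows "1 \<in> B" "0 \<in> B" "x \<in> B \<Longrightarrow> - x \<in> B" "x \<in> B \<Longrightarrow> y \<in> B \<Longrightarrow> x + y \<in> B"
    "x \<in> B \<Longrightarrow> y \<in> B \<Longrightarrow> x - y \<in> B" "x \<in> B \<Longrightarrow> y \<in> B \<Longrightarrow> x * y \<in> B"
proof -
  show one: "1 \<in> B" and neg: "x \<in> B \<Longrightarrow> - x \<in> B" and add: "x \<in> B \<Longrightarrow> y \<in> B \<Longrightarrow> x + y \<in> B"
    and "x \<in> B \<Longrightarrow> y \<in> B \<Longrightarrow> x * y \<in> B" for x y
    using assms by (auto simp: subring_of_class_def)
  show "x \<in> B \<Longrightarrow> y \<in> B \<Longrightarrow> x - y \<in> B" for x y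
    using neg[of y] add[of x "- y"] by simp
  show "0 \<in> B"
    using one neg[of 1] add[of 1 "-1"] by simp
qed

lemma subring_of_class_sum:
  assumes "subring_of_class B" "\<And>i. i \<in> F \<Longrightarrow> g i \<in> B"
  shows "sum g F \<in> B"
  using assms(2) by (induction F rule: infinite_finite_induct)
    (auto intro: subring_of_classD[OF assms(1)])

text \<open>\<open>u\<close> may satisfy relations over \<open>B\<close>, so an element has no
  well-defined degree; \<open>b\<close> counts as soon as one expression of an element of
  \<open>J\<close> starts with \<open>b * u ^ n\<close>.\<close>

definition leading_coeffs :: "'b::comm_ring_1 set \<Rightarrow> 'b \<Rightarrow> nat \<Rightarrow> 'b set \<Rightarrow> 'b set" where
  "leading_coeffs B u n J =
     {b \<in> B. \<exists>c. (\<forall>i. c i \<in> B) \<and> b * u ^ n + (\<Sum>i<n. c i * u ^ i) \<in> J}"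

definition adjoin :: "'b::comm_ring_1 set \<Rightarrow> 'b \<Rightarrow> 'b set" where
  "adjoin B u = {\<Sum>i<n. c i * u ^ i | n c. \<forall>i. c i \<in> B}"

lemma leading_coeffs_mono: "J \<subseteq> J' \<Longrightarrow> leading_coeffs B u n J \<subseteq> leading_coeffs B u n J'"
  by (auto simp: leading_coeffs_def)

lemma base_in_adjoin:
  assumes "subring_of_class B" "b \<in> B"
  shows "b \<in> adjoin B u"
proof -
  have "b = (\<Sum>i<1. b * u ^ i)" by simp
  then show ?thesis
    unfolding adjoin_def mem_Collect_eq
    by (rule_tac x=1 in exI, rule_tac x="\<lambda>_. b" in exI) (use assms in auto)
qed

lemma generator_in_adjoin:
  assumes "subring_of_class B"
  shows "u \<in> adjoin B u"
proof -
  have "u = (\<Sum>i<2. (if i = (1::nat) then 1 else 0) * u ^ i)"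
    by (simp add: numeral_2_eq_2)
  then show ?thesis
    unfolding adjoin_def mem_Collect_eq
    by (rule_tac x=2 in exI, rule_tac x="\<lambda>i. if i = (1::nat) then 1 else 0" in exI)
      (use subring_of_classD[OF assms] in auto)
qed

lemma ideal_leading_coeffs:
  assumes B: "subring_of_class B" and J: "ideal_of (adjoin B u) J"
  shows "ideal_of B (leading_coeffs B u n J)"
  unfolding ideal_of_def
proof (intro conjI ballI)
  note Bs = subring_of_classD[OF B]
  show "leading_coeffs B u n J \<subseteq> B" by (auto simp: leading_coeffs_def)
  show "0 \<in> leading_coeffs B u n J"
    using ideal_ofD[OF J] Bs by (auto simp: leading_coeffs_def intro!: exI[of _ "\<lambda>_. 0"])
  fix x assume "x \<in> leading_coeffs B u n J"
  then obtain c where c: "x \<in> B" "\<forall>i. c i \<in> B" "x * u ^ n + (\<Sum>i<n. c i * u ^ i) \<in> J"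
    by (auto simp: leading_coeffs_def)
  {
    fix y assume "y \<in> leading_coeffs B u n J"
    then obtain d where d: "y \<in> B" "\<forall>i. d i \<in> B" "y * u ^ n + (\<Sum>i<n. d i * u ^ i) \<in> J"
      by (auto simp: leading_coeffs_def)
    have "(x + y) * u ^ n + (\<Sum>i<n. (c i + d i) * u ^ i) =
        (x * u ^ n + (\<Sum>i<n. c i * u ^ i)) + (y * u ^ n + (\<Sum>i<n. d i * u ^ i))"
      by (simp add: algebra_simps sum.distrib)
    then have "(x + y) * u ^ n + (\<Sum>i<n. (c i + d i) * u ^ i) \<in> J"
      using ideal_ofD(3)[OF J c(3) d(3)] by simp
    then show "x + y \<in> leading_coeffs B u n J"
      using c d Bs unfolding leading_coeffs_def by (auto intro!: exI[of _ "\<lambda>i. c i + d i"])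
  next
    fix b assume b: "b \<in> B"
    have "b * x * u ^ n + (\<Sum>i<n. b * c i * u ^ i) = b * (x * u ^ n + (\<Sum>i<n. c i * u ^ i))"
      by (simp add: algebra_simps sum_distrib_left)
    then have "b * x * u ^ n + (\<Sum>i<n. b * c i * u ^ i) \<in> J"
      using ideal_ofD(4)[OF J base_in_adjoin[OF B b] c(3)] by simp
    then show "b * x \<in> leading_coeffs B u n J"
      using c b Bs unfolding leading_coeffs_def by (auto intro!: exI[of _ "\<lambda>i. b * c i"])
  }
qed

lemma leading_coeffs_Suc:
  assumes B: "subring_of_class B" and J: "ideal_of (adjoin B u) J"
  shows "leading_coeffs B u n J \<subseteq> leading_coeffs B u (Suc n) J"
proof
  fix x assume "x \<in> leading_coeffs B u n J"
  then obtain c where c: "x \<in> B" "\<forall>i. c i \<in> B" "x * u ^ n + (\<Sum>i<n. c i * u ^ i) \<in> J"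
    by (auto simp: leading_coeffs_def)
  let ?c = "\<lambda>i. if i = 0 then 0 else c (i - 1)"
  have "x * u ^ Suc n + (\<Sum>i<Suc n. ?c i * u ^ i) = u * (x * u ^ n + (\<Sum>i<n. c i * u ^ i))"
    unfolding sum.lessThan_Suc_shift by (simp add: algebra_simps sum_distrib_left)
  then have "x * u ^ Suc n + (\<Sum>i<Suc n. ?c i * u ^ i) \<in> J"
    using ideal_ofD(4)[OF J generator_in_adjoin[OF B] c(3)] by simp
  then show "x \<in> leading_coeffs B u (Suc n) J"
    using c subring_of_classD[OF B] unfolding leading_coeffs_def by (auto intro!: exI[of _ ?c])
qed

text \<open>Subtracting from an element of \<open>J'\<close> an element of \<open>J\<close> with the
  same top coefficient leaves an element of \<open>J'\<close> with a shorter expression; the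
  induction is on that length.\<close>

lemma ideal_le_of_leading_coeffs_le:
  assumes B: "subring_of_class B" and J: "ideal_of (adjoin B u) J" "ideal_of (adjoin B u) J'"
    and sub: "J \<subseteq> J'" and le: "\<And>n. leading_coeffs B u n J' \<subseteq> leading_coeffs B u n J"
  shows "J' \<subseteq> J"
proof -
  note Bs = subring_of_classD[OF B]
  have "(\<Sum>i<n. c i * u ^ i) \<in> J" if "\<forall>i. c i \<in> B" "(\<Sum>i<n. c i * u ^ i) \<in> J'" for n c
    using that
  proof (induction n arbitrary: c)
    case 0
    then show ?case using ideal_ofD[OF J(1)] by simp
  next
    case (Suc n)
    have "c n \<in> leading_coeffs B u n J'"
      using Suc.prems by (auto simp: leading_coeffs_def add.commute)
    then obtain d where d: "\<forall>i. d i \<in> B" "c n * u ^ n + (\<Sum>i<n. d i * u ^ i) \<in> J"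
      using subsetD[OF le, of "c n" n] by (auto simp: leading_coeffs_def)
    have "(\<Sum>i<n. (c i - d i) * u ^ i) =
        (\<Sum>i<Suc n. c i * u ^ i) + (- 1) * (c n * u ^ n + (\<Sum>i<n. d i * u ^ i))"
      by (simp add: algebra_simps sum_subtractf)
    moreover have "(- 1) * (c n * u ^ n + (\<Sum>i<n. d i * u ^ i)) \<in> J'"
      using d sub ideal_ofD(4)[OF J(2) base_in_adjoin[OF B, of "- 1"]] Bs by blast
    ultimately have "(\<Sum>i<n. (c i - d i) * u ^ i) \<in> J'"
      using ideal_ofD(3)[OF J(2)] Suc.prems by metis
    then have "(\<Sum>i<n. (c i - d i) * u ^ i) \<in> J"
      using Suc.IH[of "\<lambda>i. c i - d i"] Suc.prems d Bs by auto
    then have "(c n * u ^ n + (\<Sum>i<n. d i * u ^ i)) + (\<Sum>i<n. (c i - d i) * u ^ i) \<in> J"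
      using d ideal_ofD(3)[OF J(1)] by blast
    then show ?case
      by (simp add: algebra_simps sum_subtractf)
  qed
  moreover have "\<exists>n c. x = (\<Sum>i<n. c i * u ^ i) \<and> (\<forall>i. c i \<in> B)" if "x \<in> J'" for x
    using subsetD[OF ideal_ofD(1)[OF J(2)] that] unfolding adjoin_def by blast
  ultimately show ?thesis by blast
qed

text \<open>The ideals \<open>leading_coeffs B u n (J k)\<close> increase in \<open>n\<close> and in
  \<open>k\<close>. The diagonal becomes constant at some \<open>M\<close>, and each of the finitely
  many rows n < M becomes constant by itself, so one index serves all rows.\<close>

theorem acc_ideals_adjoin:
  assumes B: "subring_of_class B" and acc: "acc_ideals B"
  shows "acc_ideals (adjoin B u)"
  unfolding acc_ideals_def
proof (intro allI impI)
  fix J :: "nat \<Rightarrow> 'a set"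
  assume chain: "\<forall>k. ideal_of (adjoin B u) (J k) \<and> J k \<subseteq> J (Suc k)"
  let ?L = "leading_coeffs B u"
  have J_mono: "J k \<subseteq> J l" if "k \<le> l" for k l
    using lift_Suc_mono_le[of J] chain that by blast
  have id: "ideal_of B (?L n (J k))" for n k
    using ideal_leading_coeffs[OF B] chain by blast
  have L_mono: "?L n (J k) \<subseteq> ?L m (J l)" if "n \<le> m" "k \<le> l" for n m k l
  proof -
    have "?L n (J k) \<subseteq> ?L m (J k)"
      using lift_Suc_mono_le[of "\<lambda>n. ?L n (J k)"] leading_coeffs_Suc[OF B] chain that by blast
    then show ?thesis
      using leading_coeffs_mono[OF J_mono[OF that(2)]] by blast
  qed
  have "\<exists>N. \<forall>k\<ge>N. ?L k (J k) = ?L N (J N)"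
    by (intro acc_idealsD[OF acc] id L_mono) auto
  then obtain M where M: "\<And>k. k \<ge> M \<Longrightarrow> ?L k (J k) = ?L M (J M)" by blast
  have "\<forall>n. \<exists>N. \<forall>k\<ge>N. ?L n (J k) = ?L n (J N)"
    by (intro allI acc_idealsD[OF acc] id L_mono) auto
  then obtain K where K: "\<And>n k. k \<ge> K n \<Longrightarrow> ?L n (J k) = ?L n (J (K n))" by metis
  define N where "N = Max (insert M (K ` {..<M}))"
  have NM: "N \<ge> M" and NK: "\<And>n. n < M \<Longrightarrow> N \<ge> K n"
    unfolding N_def by (auto intro: Max_ge)
  have "J k \<subseteq> J N" if k: "k \<ge> N" for k
  proof (rule ideal_le_of_leading_coeffs_le[OF B, where u = u])
    show "J N \<subseteq> J k" using J_mono k by blast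
    fix n
    show "?L n (J k) \<subseteq> ?L n (J N)"
    proof (cases "n < M")
      case True
      then show ?thesis using K[of n k] K[of n N] NK[of n] k by auto
    next
      case False
      \<comment> \<open>In rows from \<open>M\<close> on, the entry at \<open>k\<close> is contained
        in the limit of the diagonal, and the entry at \<open>N\<close> contains that limit.\<close>
      have "?L n (J k) \<subseteq> ?L (max n k) (J (max n k))" by (intro L_mono) auto
      also have "\<dots> = ?L M (J M)" using M[of "max n k"] k NM by auto
      also have "\<dots> \<subseteq> ?L n (J N)" using False NM by (intro L_mono) auto
      finally show ?thesis .
    qed
  qed (use chain in auto)
  then show "\<exists>N. \<forall>k\<ge>N. J k = J N"
    using J_mono by blast
qed

section \<open>Polynomials in a subset of the indeterminates\<close>

definition polys_in :: "'n set \<Rightarrow> ('n, 'a::comm_ring_1) mpoly set" where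
  "polys_in T = {f. \<forall>m \<in> Poly_Mapping.keys f. \<forall>i. i \<notin> T \<longrightarrow> Poly_Mapping.lookup m i = 0}"

lemma subring_polys_in: "subring_of_class (polys_in T)"
proof -
  have "f * g \<in> polys_in T" if "f \<in> polys_in T" "g \<in> polys_in T" for f g :: "('a, 'b) mpoly"
  proof -
    have "Poly_Mapping.lookup m i = 0" if m: "m \<in> Poly_Mapping.keys (f * g)" and "i \<notin> T" for m i
    proof -
      obtain p q where "m = p + q" "p \<in> Poly_Mapping.keys f" "q \<in> Poly_Mapping.keys g"
        using m keys_mult[of f g] by auto
      then show ?thesis
        using \<open>f \<in> polys_in T\<close> \<open>g \<in> polys_in T\<close> \<open>i \<notin> T\<close> by (auto simp: polys_in_def lookup_add)
    qed
    then show ?thesis by (auto simp: polys_in_def)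
  qed
  moreover have "f + g \<in> polys_in T" if "f \<in> polys_in T" "g \<in> polys_in T" for f g :: "('a, 'b) mpoly"
    using that subsetD[OF Poly_Mapping.keys_add[of f g]] unfolding polys_in_def by blast
  moreover have "1 \<in> polys_in T" "f \<in> polys_in T \<Longrightarrow> - f \<in> polys_in T" for f :: "('a, 'b) mpoly"
    by (simp_all add: polys_in_def in_keys_iff)
  ultimately show ?thesis
    unfolding subring_of_class_def by blast
qed

lemma indet_power: "indet i ^ k = Poly_Mapping.single (Poly_Mapping.single i k) 1"
  by (induction k) (simp_all add: indet_def mult_single flip: single_add)

lemma poly_mapping_sum_monomials:
  fixes f :: "'b \<Rightarrow>\<^sub>0 'c::comm_monoid_add"
  shows "f = (\<Sum>m\<in>Poly_Mapping.keys f. Poly_Mapping.single m (Poly_Mapping.lookup f m))"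
proof (rule poly_mapping_eqI)
  fix k
  have "(\<Sum>m\<in>Poly_Mapping.keys f. Poly_Mapping.lookup (Poly_Mapping.single m (Poly_Mapping.lookup f m)) k)
      = (\<Sum>m\<in>Poly_Mapping.keys f. if m = k then Poly_Mapping.lookup f k else 0)"
    by (intro sum.cong) (auto simp: lookup_single when_def)
  then show "Poly_Mapping.lookup f k = Poly_Mapping.lookup
      (\<Sum>m\<in>Poly_Mapping.keys f. Poly_Mapping.single m (Poly_Mapping.lookup f m)) k"
    by (simp add: lookup_sum in_keys_iff)
qed

text \<open>Sort the terms of \<open>f\<close> by their exponent of U_i. This turns adjunction of
  one element into an induction over the set of indeterminates.\<close>

lemma polys_in_insert: "(polys_in (insert i T) :: ('n, 'a::comm_ring_1) mpoly set) = adjoin (polys_in T) (indet i)"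
proof (intro equalityI subsetI)
  fix f :: "('n, 'a) mpoly" assume "f \<in> adjoin (polys_in T) (indet i)"
  then obtain n c where f: "f = (\<Sum>j<n. c j * indet i ^ j)" and c: "\<And>j. c j \<in> polys_in T"
    by (auto simp: adjoin_def)
  have c': "c j \<in> polys_in (insert i T)" for j using c[of j] by (auto simp: polys_in_def)
  have "indet i ^ j \<in> polys_in (insert i T)" for j
    by (auto simp: indet_power polys_in_def lookup_single when_def)
  then show "f \<in> polys_in (insert i T)"
    unfolding f using c' by (intro subring_of_class_sum subring_of_classD subring_polys_in) auto
next
  fix f :: "('n, 'a) mpoly" assume f: "f \<in> polys_in (insert i T)"
  let ?K = "Poly_Mapping.keys f" and ?e = "\<lambda>m :: 'n \<Rightarrow>\<^sub>0 nat. Poly_Mapping.lookup m i"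
  define n where "n = Suc (Max (insert 0 (?e ` ?K)))"
  have n: "?e m < n" if "m \<in> ?K" for m
    unfolding n_def using that by (auto simp: less_Suc_eq_le intro!: Max_ge)
  define c where "c j = (\<Sum>m\<in>{m\<in>?K. ?e m = j}.
      Poly_Mapping.single (m - Poly_Mapping.single i j) (Poly_Mapping.lookup f m))" for j
  have split: "m - Poly_Mapping.single i (?e m) + Poly_Mapping.single i (?e m) = m" for m
    by (rule poly_mapping_eqI) (auto simp: lookup_add lookup_minus lookup_single when_def)
  have "f = (\<Sum>m\<in>?K. Poly_Mapping.single m (Poly_Mapping.lookup f m))"
    by (rule poly_mapping_sum_monomials)
  also have "\<dots> = (\<Sum>j<n. \<Sum>m\<in>{m\<in>?K. ?e m = j}. Poly_Mapping.single m (Poly_Mapping.lookup f m))"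
    using n by (intro sum.group[symmetric]) auto
  also have "\<dots> = (\<Sum>j<n. c j * indet i ^ j)"
    unfolding c_def sum_distrib_right
    by (intro sum.cong refl) (auto simp: indet_power mult_single split)
  finally have "f = (\<Sum>j<n. c j * indet i ^ j)" .
  moreover have "c j \<in> polys_in T" for j
    unfolding c_def
  proof (rule subring_of_class_sum[OF subring_polys_in], clarify)
    fix m assume "m \<in> ?K"
    then show "Poly_Mapping.single (m - Poly_Mapping.single i (?e m)) (Poly_Mapping.lookup f m) \<in> polys_in T"
      using f by (auto simp: polys_in_def lookup_minus lookup_single when_def split: if_splits)
  qed
  ultimately show "f \<in> adjoin (polys_in T) (indet i)"
    unfolding adjoin_def by blast
qed

lemma ideal_of_UNIV_iff: "ideal_of UNIV J \<longleftrightarrow> ideal J (cring_class_ops :: 'a::comm_ring_1 ring)"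
proof
  assume J: "ideal_of UNIV J"
  have neg: "- x \<in> J" if "x \<in> J" for x
    using ideal_ofD(4)[OF J, of "- 1" x] that by simp
  have r: "ring (cring_class_ops :: 'a ring)"
    using cring_class by (rule cring.axioms)
  then interpret ring "cring_class_ops :: 'a ring" .
  show "ideal J (cring_class_ops :: 'a ring)"
  proof (rule idealI[OF r])
    show "subgroup J (add_monoid (cring_class_ops :: 'a ring))"
    proof (rule subgroup.intro)
      show "inv\<^bsub>add_monoid cring_class_ops\<^esub> x \<in> J" if "x \<in> J" for x
        using neg[OF that] by (metis a_inv_def uminus_class)
    qed (use J in \<open>auto simp: ideal_of_def carrier_class class_simps\<close>)
  qed (use ideal_ofD(4)[OF J UNIV_I] in \<open>simp_all add: times_class mult.commute\<close>)
next
  assume J: "ideal J (cring_class_ops :: 'a ring)"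
  interpret ideal J "cring_class_ops :: 'a ring" by fact
  show "ideal_of UNIV J"
    using zero_closed a_closed I_l_closed
    by (auto simp: ideal_of_def carrier_class class_simps)
qed

lemma acc_ideals_noetherian:
  assumes "noetherian_ring (cring_class_ops :: 'a::comm_ring_1 ring)"
  shows "acc_ideals (UNIV :: 'a set)"
  unfolding acc_ideals_def
proof (intro allI impI)
  fix J :: "nat \<Rightarrow> 'a set"
  assume J: "\<forall>k. ideal_of UNIV (J k) \<and> J k \<subseteq> J (Suc k)"
  have mono: "J k \<subseteq> J l" if "k \<le> l" for k l
    using lift_Suc_mono_le[of J] J that by blast
  have "subset.chain {I. ideal I cring_class_ops} (Set.range J)"
    unfolding pred_on.chain_def
  proof (intro conjI ballI)
    show "Set.range J \<subseteq> {I. ideal I cring_class_ops}"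
      using J by (auto simp: ideal_of_UNIV_iff)
    fix X Y assume "X \<in> Set.range J" "Y \<in> Set.range J"
    then obtain k l where "X = J k" "Y = J l" by blast
    then have "X \<subseteq> Y \<or> Y \<subseteq> X"
      using mono[of k l] mono[of l k] by (cases "k \<le> l") auto
    then show "(\<subset>)\<^sup>=\<^sup>= X Y \<or> (\<subset>)\<^sup>=\<^sup>= Y X"
      by auto
  qed
  then have "\<Union>(Set.range J) \<in> Set.range J"
    using noetherian_ring.ideal_chain_is_trivial[OF assms] by blast
  then obtain N where "\<Union>(Set.range J) = J N" by auto
  then show "\<exists>N. \<forall>k\<ge>N. J k = J N"
    using mono by (intro exI[of _ N]) blast
qed

lemma acc_ideals_constants:
  assumes "acc_ideals (UNIV :: 'a::comm_ring_1 set)"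
  shows "acc_ideals (polys_in {} :: ('n, 'a) mpoly set)"
  unfolding acc_ideals_def
proof (intro allI impI)
  have const: "f \<in> polys_in {} \<longleftrightarrow> f = const_poly (Poly_Mapping.lookup f 0)" for f :: "('n, 'a) mpoly"
  proof
    assume f: "f \<in> polys_in {}"
    show "f = const_poly (Poly_Mapping.lookup f 0)"
    proof (rule poly_mapping_eqI)
      fix m
      show "Poly_Mapping.lookup f m = Poly_Mapping.lookup (const_poly (Poly_Mapping.lookup f 0)) m"
      proof (cases "m \<in> Poly_Mapping.keys f")
        case True
        then have "m = 0" using f by (intro poly_mapping_eqI) (auto simp: polys_in_def)
        then show ?thesis by (simp add: const_poly_def)
      next
        case False
        then show ?thesis
          by (cases "m = 0") (auto simp: const_poly_def lookup_single when_def in_keys_iff)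
      qed
    qed
  next
    assume "f = const_poly (Poly_Mapping.lookup f 0)"
    then have "Poly_Mapping.keys f = Poly_Mapping.keys (const_poly (Poly_Mapping.lookup f 0) :: ('n, 'a) mpoly)"
      by (rule arg_cong)
    then have "Poly_Mapping.keys f \<subseteq> {0}"
      by (simp add: const_poly_def)
    then show "f \<in> polys_in {}" by (auto simp: polys_in_def)
  qed
  fix J :: "nat \<Rightarrow> ('n, 'a) mpoly set"
  assume J: "\<forall>k. ideal_of (polys_in {}) (J k) \<and> J k \<subseteq> J (Suc k)"
  define J' where "J' k = {a. const_poly a \<in> J k}" for k
  have c0: "const_poly 0 = (0 :: ('n, 'a) mpoly)"
    and cadd: "\<And>a b. const_poly (a + b) = (const_poly a + const_poly b :: ('n, 'a) mpoly)"
    and cmult: "\<And>a b. const_poly (a * b) = (const_poly a * const_poly b :: ('n, 'a) mpoly)"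
    by (simp_all add: const_poly_def single_add mult_single)
  have cin: "const_poly a \<in> (polys_in {} :: ('n, 'a) mpoly set)" for a
    by (subst const) (simp add: const_poly_def)
  have "ideal_of UNIV (J' k) \<and> J' k \<subseteq> J' (Suc k)" for k
    using J cin unfolding J'_def ideal_of_def by (auto simp: c0 cadd cmult)
  then obtain N where N: "\<And>k. k \<ge> N \<Longrightarrow> J' k = J' N"
    using assms unfolding acc_ideals_def by blast
  have "J k = const_poly ` J' k" for k
  proof -
    have "J k \<subseteq> polys_in {}" using J by (auto simp: ideal_of_def)
    then have "f \<in> const_poly ` J' k" if "f \<in> J k" for f
      using that const[of f] unfolding J'_def by (metis (mono_tags) image_eqI mem_Collect_eq subsetD)
    then show ?thesis
      unfolding J'_def by blast
  qed
  then show "\<exists>N. \<forall>k\<ge>N. J k = J N"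
    using N by metis
qed

theorem acc_ideals_mpoly:
  assumes "noetherian_ring (cring_class_ops :: 'a::comm_ring_1 ring)"
  shows "acc_ideals (UNIV :: ('n::finite, 'a) mpoly set)"
proof -
  have "acc_ideals (polys_in T :: ('n, 'a) mpoly set)" if "finite T" for T
    using that
  proof induction
    case empty
    then show ?case by (intro acc_ideals_constants acc_ideals_noetherian assms)
  next
    case (insert i T)
    then show ?case unfolding polys_in_insert by (intro acc_ideals_adjoin subring_polys_in)
  qed
  from this[of UNIV] show ?thesis by (simp add: polys_in_def)
qed

section \<open>Homogeneous components of polynomials\<close>

lemma wdegree_add: "wdegree dg (m + m') = wdegree dg m + wdegree dg m'"
  by (simp add: wdegree_def lookup_add algebra_simps sum.distrib)

text \<open>The index is an integer so that it can be shifted by the degree of a factor; at a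
  negative index the component is 0.\<close>

definition hom_comp :: "('n::finite \<Rightarrow> nat) \<Rightarrow> int \<Rightarrow> ('n, 'a::comm_ring_1) mpoly \<Rightarrow> ('n, 'a) mpoly" where
  "hom_comp dg k f = (\<Sum>m\<in>{m \<in> Poly_Mapping.keys f. int (wdegree dg m) = k}.
     Poly_Mapping.single m (Poly_Mapping.lookup f m))"

lemma lookup_hom_comp:
  "Poly_Mapping.lookup (hom_comp dg k f) m =
     (if int (wdegree dg m) = k then Poly_Mapping.lookup f m else 0)"
proof -
  have "Poly_Mapping.lookup (hom_comp dg k f) m =
      (\<Sum>m'\<in>{m' \<in> Poly_Mapping.keys f. int (wdegree dg m') = k}.
        if m' = m then Poly_Mapping.lookup f m else 0)"
    unfolding hom_comp_def lookup_sum by (intro sum.cong) (auto simp: lookup_single when_def)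
  then show ?thesis by (auto simp: in_keys_iff)
qed

lemma hom_comp_add: "hom_comp dg k (f + g) = hom_comp dg k f + hom_comp dg k g"
  by (rule poly_mapping_eqI) (simp add: lookup_hom_comp lookup_add)

lemma hom_comp_0 [simp]: "hom_comp dg k 0 = 0"
  by (rule poly_mapping_eqI) (simp add: lookup_hom_comp)

lemma hom_comp_sum: "hom_comp dg k (sum g F) = (\<Sum>x\<in>F. hom_comp dg k (g x))"
  by (induction F rule: infinite_finite_induct) (simp_all add: hom_comp_add)

lemma hom_comp_in: "hom_comp dg k f \<in> poly_component dg k"
  by (auto simp: poly_component_def lookup_hom_comp)

lemma hom_comp_component:
  assumes "f \<in> poly_component dg l"
  shows "hom_comp dg k f = (if k = l then f else 0)"
  by (rule poly_mapping_eqI) (use assms in \<open>auto simp: poly_component_def lookup_hom_comp\<close>)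

lemma poly_component_0 [simp]: "0 \<in> poly_component dg k"
  by (simp add: poly_component_def)

lemma poly_component_add:
  "f \<in> poly_component dg k \<Longrightarrow> g \<in> poly_component dg k \<Longrightarrow> f + g \<in> poly_component dg k"
  by (simp add: poly_component_def lookup_add) (metis add.right_neutral)

lemma poly_component_uminus: "f \<in> poly_component dg k \<Longrightarrow> - f \<in> poly_component dg k"
  by (simp add: poly_component_def)

lemma poly_component_diff:
  "f \<in> poly_component dg k \<Longrightarrow> g \<in> poly_component dg k \<Longrightarrow> f - g \<in> poly_component dg k"
  using poly_component_add[of f dg k "- g"] poly_component_uminus[of g dg k] by simp

lemma poly_component_mult:
  assumes f: "f \<in> poly_component dg k" and g: "g \<in> poly_component dg l"
  shows "f * g \<in> poly_component dg (k + l)"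
  unfolding poly_component_def
proof (intro CollectI allI impI)
  fix m assume "Poly_Mapping.lookup (f * g) m \<noteq> 0"
  then have "m \<in> Poly_Mapping.keys (f * g)" by (simp add: in_keys_iff)
  then obtain p q where "m = p + q" "p \<in> Poly_Mapping.keys f" "q \<in> Poly_Mapping.keys g"
    using keys_mult[of f g] by auto
  then show "int (wdegree dg m) = k + l"
    using f g by (simp add: poly_component_def in_keys_iff wdegree_add)
qed

lemma monomial_component:
  "Poly_Mapping.single m a \<in> poly_component dg (int (wdegree dg m))"
  by (auto simp: poly_component_def lookup_single when_def)

lemma const_poly_component: "const_poly a \<in> poly_component dg 0"
  using monomial_component[of 0 a dg] by (simp add: const_poly_def wdegree_def)

lemma indet_component: "indet i \<in> poly_component dg (int (dg i))"
proof -
  have "wdegree dg (Poly_Mapping.single i (Suc 0)) = (\<Sum>j\<in>UNIV. if j = i then dg i else 0)"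
    unfolding wdegree_def by (intro sum.cong) (auto simp: lookup_single when_def)
  then show ?thesis
    using monomial_component[of "Poly_Mapping.single i (Suc 0)" 1 dg] by (simp add: indet_def)
qed

lemma one_component: "1 \<in> poly_component dg 0"
  using const_poly_component[of 1 dg] by (simp add: const_poly_def)

lemma power_component: "f \<in> poly_component dg k \<Longrightarrow> f ^ n \<in> poly_component dg (int n * k)"
  by (induction n) (auto simp: one_component algebra_simps dest: poly_component_mult)

lemma indet_power_component: "indet i ^ n \<in> poly_component dg (int n * int (dg i))"
  by (rule power_component[OF indet_component])

definition hom_degrees :: "('n::finite \<Rightarrow> nat) \<Rightarrow> ('n, 'a::comm_ring_1) mpoly \<Rightarrow> int set" where
  "hom_degrees dg f = (\<lambda>m. int (wdegree dg m)) ` Poly_Mapping.keys f"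

lemma finite_hom_degrees [simp]: "finite (hom_degrees dg f)"
  by (simp add: hom_degrees_def)

lemma sum_hom_comp:
  assumes "finite K" "hom_degrees dg f \<subseteq> K"
  shows "f = (\<Sum>k\<in>K. hom_comp dg k f)"
proof (rule poly_mapping_eqI)
  fix m
  have "int (wdegree dg m) \<notin> K \<Longrightarrow> Poly_Mapping.lookup f m = 0"
    using assms(2) unfolding hom_degrees_def by (metis image_subset_iff in_keys_iff)
  then show "Poly_Mapping.lookup f m = Poly_Mapping.lookup (\<Sum>k\<in>K. hom_comp dg k f) m"
    using assms(1) by (auto simp: lookup_sum lookup_hom_comp)
qed

lemma hom_comp_mult:
  assumes u: "u \<in> poly_component dg d"
  shows "hom_comp dg k (f * u) = hom_comp dg (k - d) f * u"
proof -
  let ?K = "insert (k - d) (hom_degrees dg f)"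
  have "f * u = (\<Sum>l\<in>?K. hom_comp dg l f * u)"
    by (subst sum_hom_comp[of ?K dg f]) (auto simp: sum_distrib_right)
  then have "hom_comp dg k (f * u) = (\<Sum>l\<in>?K. hom_comp dg k (hom_comp dg l f * u))"
    by (simp add: hom_comp_sum del: sum.insert)
  also have "\<dots> = (\<Sum>l\<in>?K. if l = k - d then hom_comp dg l f * u else 0)"
  proof (rule sum.cong[OF refl])
    fix l
    show "hom_comp dg k (hom_comp dg l f * u) = (if l = k - d then hom_comp dg l f * u else 0)"
      using hom_comp_component[OF poly_component_mult[OF hom_comp_in[of dg l f] u], of k] by auto
  qed
  also have "\<dots> = hom_comp dg (k - d) f * u"
    by (subst sum.delta) auto
  finally show ?thesis .
qed

section \<open>Ideals generated by powers of the indeterminates\<close>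

lemma ideal_uminus: "ideal_of UNIV J \<Longrightarrow> x \<in> J \<Longrightarrow> - x \<in> J"
  using ideal_ofD(4)[of UNIV J "- 1" x] by simp

lemma ideal_diff: "ideal_of UNIV J \<Longrightarrow> x \<in> J \<Longrightarrow> y \<in> J \<Longrightarrow> x - y \<in> J"
  using ideal_ofD(3)[of UNIV J x "- y"] ideal_uminus[of J y] by simp

lemma ideal_sum: "ideal_of UNIV J \<Longrightarrow> (\<And>i. i \<in> F \<Longrightarrow> g i \<in> J) \<Longrightarrow> sum g F \<in> J"
  by (induction F rule: infinite_finite_induct) (auto intro: ideal_ofD)

text \<open>Keeping \<open>I\<close> inside allows statements about R to be checked on
  representatives in S.\<close>

definition power_ideal ::
    "'n set \<Rightarrow> ('n \<Rightarrow> nat) \<Rightarrow> ('n, 'a::comm_ring_1) mpoly set \<Rightarrow> ('n, 'a) mpoly set" where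
  "power_ideal T e I = {(\<Sum>i\<in>T. c i * indet i ^ e i) + q | c q. q \<in> I}"

lemma power_idealI: "q \<in> I \<Longrightarrow> f = (\<Sum>i\<in>T. c i * indet i ^ e i) + q \<Longrightarrow> f \<in> power_ideal T e I"
  by (auto simp: power_ideal_def)

lemma ideal_power_ideal:
  assumes I: "ideal_of UNIV I"
  shows "ideal_of UNIV (power_ideal T e I)"
  unfolding ideal_of_def
proof (intro conjI ballI)
  show "0 \<in> power_ideal T e I"
    by (rule power_idealI[of 0 I _ "\<lambda>_. 0"]) (use ideal_ofD[OF I] in auto)
next
  fix f g assume "f \<in> power_ideal T e I" "g \<in> power_ideal T e I"
  then obtain c q c' q' where "q \<in> I" "f = (\<Sum>i\<in>T. c i * indet i ^ e i) + q"
    "q' \<in> I" "g = (\<Sum>i\<in>T. c' i * indet i ^ e i) + q'"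
    by (auto simp: power_ideal_def)
  then show "f + g \<in> power_ideal T e I"
    by (intro power_idealI[of "q + q'" I _ "\<lambda>i. c i + c' i"] ideal_ofD(3)[OF I])
      (simp_all add: distrib_right sum.distrib)
next
  fix b f assume "f \<in> power_ideal T e I"
  then obtain c q where "q \<in> I" "f = (\<Sum>i\<in>T. c i * indet i ^ e i) + q"
    by (auto simp: power_ideal_def)
  then show "b * f \<in> power_ideal T e I"
    by (intro power_idealI[of "b * q" I _ "\<lambda>i. b * c i"] ideal_ofD(4)[OF I])
      (simp_all add: distrib_left sum_distrib_left mult.assoc)
qed simp

lemma power_ideal_base: "q \<in> I \<Longrightarrow> q \<in> power_ideal T e I"
  by (rule power_idealI[of q I _ "\<lambda>_. 0"]) auto

lemma power_ideal_insert:
  assumes "finite T" "i \<notin> T"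
  shows "f \<in> power_ideal (insert i T) e I \<longleftrightarrow> (\<exists>s. f - s * indet i ^ e i \<in> power_ideal T e I)"
proof
  assume "f \<in> power_ideal (insert i T) e I"
  then obtain c q where "q \<in> I" "f = (\<Sum>i\<in>insert i T. c i * indet i ^ e i) + q"
    by (auto simp: power_ideal_def)
  then have "f - c i * indet i ^ e i \<in> power_ideal T e I"
    using assms by (intro power_idealI) auto
  then show "\<exists>s. f - s * indet i ^ e i \<in> power_ideal T e I" ..
next
  assume "\<exists>s. f - s * indet i ^ e i \<in> power_ideal T e I"
  then obtain s c q where q: "q \<in> I" "f - s * indet i ^ e i = (\<Sum>i\<in>T. c i * indet i ^ e i) + q"
    by (auto simp: power_ideal_def)
  have "(\<Sum>j\<in>T. (c(i := s)) j * indet j ^ e j) = (\<Sum>j\<in>T. c j * indet j ^ e j)"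
    using assms by (intro sum.cong) auto
  then show "f \<in> power_ideal (insert i T) e I"
    using assms q by (intro power_idealI[of q I _ "c(i := s)"]) (auto simp: algebra_simps)
qed

lemma indet_power_in_power_ideal:
  assumes I: "ideal_of UNIV I" and "finite T" "i \<in> T" "e i \<le> k"
  shows "g * indet i ^ k \<in> power_ideal T e I"
proof -
  have "g * indet i ^ k = (\<Sum>j\<in>T. (if j = i then g * indet i ^ (k - e i) else 0) * indet j ^ e j) + 0"
    using assms by (simp add: if_distrib[of "\<lambda>x. x * _"] cong: if_cong flip: power_add mult.assoc)
      (simp add: mult.assoc flip: power_add)
  then show ?thesis
    using ideal_ofD(2)[OF I] by (intro power_idealI) auto
qed

text \<open>These are the transition maps of the direct system of the quotients by powers: the
  factor U_i^p of the product raises the i-th generator, and the other factors go into its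
  coefficient.\<close>

lemma power_ideal_times_prod:
  fixes I :: "('n, 'a::comm_ring_1) mpoly set"
  assumes I: "ideal_of UNIV I" and T: "finite T" and f: "f \<in> power_ideal T e I"
  shows "(\<Prod>i\<in>T. indet i) ^ p * f \<in> power_ideal T (\<lambda>i. e i + p) I"
proof -
  obtain c q where q: "q \<in> I" "f = (\<Sum>i\<in>T. c i * indet i ^ e i) + q"
    using f by (auto simp: power_ideal_def)
  note id = ideal_power_ideal[OF I, of T "\<lambda>i. e i + p"]
  have "(\<Prod>i\<in>T. indet i) ^ p * (c i * indet i ^ e i) \<in> power_ideal T (\<lambda>i. e i + p) I"
    if "i \<in> T" for i
  proof -
    have eq: "(\<Prod>i\<in>T. indet i) ^ p = (\<Prod>i\<in>T - {i}. indet i) ^ p * (indet i ^ p :: ('n, 'a) mpoly)"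
      using T that by (subst prod.remove[of _ i]) (auto simp: algebra_simps power_mult_distrib)
    have "(\<Prod>i\<in>T. indet i) ^ p * (c i * indet i ^ e i)
        = ((\<Prod>i\<in>T - {i}. indet i) ^ p * c i) * indet i ^ (e i + p)"
      unfolding eq by (simp add: power_add ac_simps)
    then show ?thesis
      using indet_power_in_power_ideal[OF I T that, of "\<lambda>i. e i + p" "e i + p"] by simp
  qed
  then show ?thesis
    unfolding q(2) distrib_left sum_distrib_left
    by (rule ideal_ofD(3)[OF id ideal_sum[OF id] ideal_ofD(4)[OF id UNIV_I power_ideal_base[OF q(1)]]])
qed

lemma power_ideal_hom_comp:
  assumes I: "\<And>k f. f \<in> I \<Longrightarrow> hom_comp dg k f \<in> I" and f: "f \<in> power_ideal T e I"
  shows "hom_comp dg k f \<in> power_ideal T e I"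
proof -
  obtain c q where q: "q \<in> I" "f = (\<Sum>i\<in>T. c i * indet i ^ e i) + q"
    using f by (auto simp: power_ideal_def)
  have "hom_comp dg k f = (\<Sum>i\<in>T. hom_comp dg (k - int (e i) * int (dg i)) (c i) * indet i ^ e i)
      + hom_comp dg k q"
    unfolding q(2) hom_comp_add hom_comp_sum
    by (simp add: hom_comp_mult[OF indet_power_component])
  then show ?thesis
    by (intro power_idealI) (rule I[OF q(1)])
qed

text \<open>The colon ideals by the powers of \<open>u\<close> form an ascending chain. This is the
  only use of the chain condition after the basis theorem.\<close>

lemma power_ideal_stable:
  fixes I :: "('n, 'a::comm_ring_1) mpoly set"
  assumes acc: "acc_ideals (UNIV :: ('n, 'a) mpoly set)" and I: "ideal_of UNIV I"
  obtains a where "\<And>t r. u ^ (a + t) * r \<in> power_ideal T e I \<Longrightarrow> u ^ a * r \<in> power_ideal T e I"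
proof -
  let ?P = "power_ideal T e I"
  note id = ideal_power_ideal[OF I, of T e]
  define J where "J k = {r. u ^ k * r \<in> ?P}" for k
  have "ideal_of UNIV (J k)" for k
    using ideal_ofD[OF id] unfolding J_def ideal_of_def
    by (auto simp: distrib_left mult.left_commute[of "u ^ k"])
  moreover have "J k \<subseteq> J (Suc k)" for k
    using ideal_ofD(4)[OF id, of u] by (auto simp: J_def mult.assoc)
  ultimately obtain a where "\<And>k. k \<ge> a \<Longrightarrow> J k = J a"
    using acc_idealsD[OF acc, of J] by metis
  then have "J (a + t) = J a" for t by (metis le_add1)
  then show ?thesis
    by (intro that[of a]) (metis J_def mem_Collect_eq)
qed

section \<open>Nilpotency of the coefficients\<close>

text \<open>The subgroup QV + W. \<open>V\<close> will be a homogeneous component and not an ideal,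
  so stability under multiplication is asked of each multiplier separately.\<close>

definition lin_combs :: "'b::comm_ring_1 set \<Rightarrow> 'b set \<Rightarrow> 'b set \<Rightarrow> 'b set" where
  "lin_combs Q V W = {(\<Sum>q\<in>Q. q * v q) + w | v w. (\<forall>q\<in>Q. v q \<in> V) \<and> w \<in> W}"

lemma lin_combsI:
  "w \<in> W \<Longrightarrow> (\<And>q. q \<in> Q \<Longrightarrow> v q \<in> V) \<Longrightarrow> g = (\<Sum>q\<in>Q. q * v q) + w \<Longrightarrow> g \<in> lin_combs Q V W"
  by (auto simp: lin_combs_def)

lemma lin_combsE:
  assumes "g \<in> lin_combs Q V W"
  obtains v w where "w \<in> W" "\<And>q. q \<in> Q \<Longrightarrow> v q \<in> V" "g = (\<Sum>q\<in>Q. q * v q) + w"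
  using assms unfolding lin_combs_def by blast

lemma lin_combs_add:
  assumes W: "ideal_of UNIV W" and V: "\<And>x y. x \<in> V \<Longrightarrow> y \<in> V \<Longrightarrow> x + y \<in> V"
    and "g \<in> lin_combs Q V W" "h \<in> lin_combs Q V W"
  shows "g + h \<in> lin_combs Q V W"
proof -
  obtain v w v' w' where *: "w \<in> W" "\<And>q. q \<in> Q \<Longrightarrow> v q \<in> V" "g = (\<Sum>q\<in>Q. q * v q) + w"
     "w' \<in> W" "\<And>q. q \<in> Q \<Longrightarrow> v' q \<in> V" "h = (\<Sum>q\<in>Q. q * v' q) + w'"
    using assms(3,4) by (elim lin_combsE) blast
  show ?thesis
    by (rule lin_combsI[of "w + w'" _ _ "\<lambda>q. v q + v' q"])
      (use * V ideal_ofD(3)[OF W] in \<open>simp_all add: distrib_left sum.distrib\<close>)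
qed

lemma lin_combs_mult:
  assumes W: "ideal_of UNIV W" and c: "\<And>x. x \<in> V \<Longrightarrow> c * x \<in> V" and "g \<in> lin_combs Q V W"
  shows "c * g \<in> lin_combs Q V W"
proof -
  obtain v w where *: "w \<in> W" "\<And>q. q \<in> Q \<Longrightarrow> v q \<in> V" "g = (\<Sum>q\<in>Q. q * v q) + w"
    using assms(3) by (elim lin_combsE) blast
  show ?thesis
    by (rule lin_combsI[of "c * w" _ _ "\<lambda>q. c * v q"])
      (use * c ideal_ofD(4)[OF W] in \<open>simp_all add: distrib_left sum_distrib_left mult.left_commute\<close>)
qed

lemma lin_combs_base:
  assumes "0 \<in> V" "w \<in> W"
  shows "w \<in> lin_combs Q V W"
  by (rule lin_combsI[of w _ _ "\<lambda>_. 0"]) (use assms in auto)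

lemma lin_combs_gen:
  assumes "finite Q" "q \<in> Q" "0 \<in> V" "ideal_of UNIV W" "v \<in> V"
  shows "q * v \<in> lin_combs Q V W"
  by (rule lin_combsI[of 0 _ _ "\<lambda>p. if p = q then v else 0"])
    (use assms ideal_ofD(2) in \<open>auto simp: if_distrib[of "\<lambda>x. _ * x"] cong: if_cong\<close>)

lemma lin_combs_sum:
  assumes W: "ideal_of UNIV W" and V: "0 \<in> V" "\<And>x y. x \<in> V \<Longrightarrow> y \<in> V \<Longrightarrow> x + y \<in> V"
    and "\<And>x. x \<in> F \<Longrightarrow> g x \<in> lin_combs Q V W"
  shows "sum g F \<in> lin_combs Q V W"
  using assms(4)
proof (induction F rule: infinite_finite_induct)
  case (insert x F)
  then show ?case using lin_combs_add[OF W V(2)] by simp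
qed (auto intro: lin_combs_base V ideal_ofD(2)[OF W])

definition acts_nilpotently :: "'b::comm_ring_1 set \<Rightarrow> 'b set \<Rightarrow> 'b \<Rightarrow> bool" where
  "acts_nilpotently V W a \<longleftrightarrow> (\<exists>N. \<forall>g\<in>V. a ^ N * g \<in> W)"

text \<open>If \<open>a\<^sup>N V \<subseteq> q V + V'\<close>, then iterating gives \<open>a\<^bsup>Nj\<^esup> V \<subseteq> q\<^sup>j V + V'\<close>, and \<open>q\<^sup>j V\<close> vanishes
  modulo \<open>W\<close> for large \<open>j\<close>; so the generators \<open>q\<close> can be removed one by one.\<close>

lemma acts_nilpotently_mod:
  assumes W: "ideal_of UNIV W" and V: "0 \<in> V" "\<And>x y. x \<in> V \<Longrightarrow> y \<in> V \<Longrightarrow> x + y \<in> V"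
    and "finite Q" and Q: "\<And>q. q \<in> Q \<Longrightarrow> acts_nilpotently V W q \<and> (\<forall>x\<in>V. q * x \<in> V)"
    and a: "\<And>x. x \<in> V \<Longrightarrow> a * x \<in> V"
    and N: "\<And>g. g \<in> V \<Longrightarrow> a ^ N * g \<in> lin_combs Q V W"
  shows "acts_nilpotently V W a"
  using \<open>finite Q\<close> Q N
proof (induction Q arbitrary: N)
  case empty
  then show ?case by (auto simp: acts_nilpotently_def lin_combs_def)
next
  case (insert q Q)
  have a_pow: "a ^ k * x \<in> V" if "x \<in> V" for k x
    using that by (induction k) (auto simp: mult.assoc a)
  have q_pow: "q ^ k * x \<in> V" if "x \<in> V" for k x
    using that insert.prems(1)[of q] by (induction k) (auto simp: mult.assoc)
  have step: "\<exists>v\<in>V. a ^ N * g - q * v \<in> lin_combs Q V W" if g: "g \<in> V" for g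
  proof -
    obtain v w where "w \<in> W" "\<And>p. p \<in> insert q Q \<Longrightarrow> v p \<in> V"
        "a ^ N * g = (\<Sum>p\<in>insert q Q. p * v p) + w"
      using insert.prems(2)[OF g] by (elim lin_combsE) blast
    then show ?thesis
      using insert.hyps by (intro bexI[of _ "v q"] lin_combsI[of w _ _ v]) auto
  qed
  have iter: "\<exists>v\<in>V. a ^ (N * j) * g - q ^ j * v \<in> lin_combs Q V W" if g: "g \<in> V" for g j
  proof (induction j)
    case 0
    show ?case using g V ideal_ofD(2)[OF W] by (auto intro!: bexI[of _ g] lin_combs_base)
  next
    case (Suc j)
    then obtain v where v: "v \<in> V" "a ^ (N * j) * g - q ^ j * v \<in> lin_combs Q V W" by blast
    obtain v' where v': "v' \<in> V" "a ^ N * v - q * v' \<in> lin_combs Q V W" using step[OF v(1)] by blast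
    have "a ^ (N * Suc j) * g - q ^ Suc j * v' =
        a ^ N * (a ^ (N * j) * g - q ^ j * v) + q ^ j * (a ^ N * v - q * v')"
      by (simp add: power_add algebra_simps)
    also have "\<dots> \<in> lin_combs Q V W"
      using lin_combs_add[OF W V(2) lin_combs_mult[OF W a_pow v(2)] lin_combs_mult[OF W q_pow v'(2)]]
      by simp
    finally show ?case using v' by blast
  qed
  obtain M where M: "\<And>g. g \<in> V \<Longrightarrow> q ^ M * g \<in> W"
    using insert.prems(1)[of q] unfolding acts_nilpotently_def by auto
  have "a ^ (N * M) * g \<in> lin_combs Q V W" if g: "g \<in> V" for g
  proof -
    obtain v where v: "v \<in> V" "a ^ (N * M) * g - q ^ M * v \<in> lin_combs Q V W" using iter[OF g] by blast
    show ?thesis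
      using lin_combs_add[OF W V(2) v(2) lin_combs_base[OF V(1) M[OF v(1)]]] by simp
  qed
  then show ?case
    using insert by (intro insert.IH) auto
qed

section \<open>A monomial order and the nilpotency of a coefficient\<close>

text \<open>Supplies the monomial order: \<open>nat \<Rightarrow>\<^sub>0 nat\<close> is linearly
  ordered compatibly with addition, whereas the index type carries no order and first has to be
  numbered.\<close>

lemma additive_order_embedding:
  obtains enc :: "('n::finite \<Rightarrow>\<^sub>0 nat) \<Rightarrow> (nat \<Rightarrow>\<^sub>0 nat)"
  where "inj enc" "\<And>m m'. enc (m + m') = enc m + enc m'"
proof -
  obtain idx :: "'n \<Rightarrow> nat" where idx: "inj idx"
    using finite_imp_inj_to_nat_seg[of "UNIV :: 'n set"] by auto
  define enc :: "('n \<Rightarrow>\<^sub>0 nat) \<Rightarrow> (nat \<Rightarrow>\<^sub>0 nat)" where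
    "enc m = (\<Sum>i\<in>UNIV. Poly_Mapping.single (idx i) (Poly_Mapping.lookup m i))" for m
  have "Poly_Mapping.lookup (enc m) (idx j) = Poly_Mapping.lookup m j" for m j
  proof -
    have "Poly_Mapping.lookup (enc m) (idx j) = (\<Sum>i\<in>UNIV. if i = j then Poly_Mapping.lookup m j else 0)"
      unfolding enc_def lookup_sum
      by (intro sum.cong) (auto simp: lookup_single when_def dest: injD[OF idx])
    then show ?thesis by simp
  qed
  then have "inj enc" by (metis injI poly_mapping_eqI)
  moreover have "enc (m + m') = enc m + enc m'" for m m'
    by (simp add: enc_def lookup_add single_add sum.distrib)
  ultimately show ?thesis by (rule that)
qed

lemma finite_bounded_monomials: "finite {m :: 'n::finite \<Rightarrow>\<^sub>0 nat. \<forall>i. Poly_Mapping.lookup m i < T}"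
proof (rule finite_imageD)
  have "Poly_Mapping.lookup ` {m :: 'n \<Rightarrow>\<^sub>0 nat. \<forall>i. Poly_Mapping.lookup m i < T}
      \<subseteq> PiE UNIV (\<lambda>_. {..<T})"
    by auto
  then show "finite (Poly_Mapping.lookup ` {m :: 'n \<Rightarrow>\<^sub>0 nat. \<forall>i. Poly_Mapping.lookup m i < T})"
    by (rule finite_subset) (simp add: finite_PiE)
qed (auto simp: inj_on_def intro: poly_mapping_eqI)

lemma const_poly_mult_component:
  "g \<in> poly_component dg k \<Longrightarrow> const_poly a * g \<in> poly_component dg k"
  using poly_component_mult[OF const_poly_component[of a dg]] by fastforce

lemma const_poly_power: "const_poly a ^ k = const_poly (a ^ k)"
  by (induction k) (simp_all add: const_poly_def mult_single)

lemma monomial_in_power_ideal: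
  assumes W: "ideal_of UNIV W" "\<And>i. indet i ^ T \<in> W" and i: "Poly_Mapping.lookup m i \<ge> T"
  shows "Poly_Mapping.single m c \<in> W"
proof -
  have "m = (m - Poly_Mapping.single i T) + Poly_Mapping.single i T"
    using i by (intro poly_mapping_eqI) (auto simp: lookup_add lookup_minus lookup_single when_def)
  then have "Poly_Mapping.single m c = Poly_Mapping.single (m - Poly_Mapping.single i T) c * indet i ^ T"
    by (simp add: indet_power mult_single)
  then show ?thesis using ideal_ofD(4)[OF W(1) UNIV_I W(2)] by simp
qed

text \<open>The degree \<open>D\<close> part of \<open>S/(U\<^sub>1\<^sup>T, \<dots>, U\<^sub>s\<^sup>T)\<close> has as basis the monomials \<open>U\<^bsup>T-1-\<lambda>\<^esup>\<close> with \<open>\<lambda>\<close> of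
  degree \<open>\<Sum>(T - 1) d\<^sub>i - D\<close>. When the exponents of all \<open>\<lambda>\<close> of this degree plus \<open>k\<close> are smaller
  than \<open>T\<close>, each basis element is, up to a coefficient, a given term of a multiple of \<open>f\<close>; so
  that coefficient is nilpotent modulo the preceding coefficients.\<close>

lemma coefficient_acts_nilpotently:
  fixes f :: "('n::finite, 'a::comm_ring_1) mpoly"
  assumes pos: "\<And>i. dg i > 0" and f: "f \<in> poly_component dg k"
    and W: "ideal_of UNIV W" "\<And>i. indet i ^ T \<in> W" "f \<in> W"
    and T: "(\<Sum>i\<in>UNIV. (int T - 1) * int (dg i)) - D + k < int T"
  shows "acts_nilpotently (poly_component dg D) W (const_poly (Poly_Mapping.lookup f \<nu>))"
proof -
  let ?V = "poly_component dg D :: ('n, 'a) mpoly set"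
  let ?c = "\<lambda>m. const_poly (Poly_Mapping.lookup f m) :: ('n, 'a) mpoly"
  let ?nil = "acts_nilpotently ?V W"
  obtain enc :: "('n \<Rightarrow>\<^sub>0 nat) \<Rightarrow> (nat \<Rightarrow>\<^sub>0 nat)" where
    enc: "inj enc" "\<And>m m'. enc (m + m') = enc m + enc m'"
    by (rule additive_order_embedding) blast
  define bad where "bad = {m \<in> Poly_Mapping.keys f. \<not> ?nil (?c m)}"
  have "bad = {}"
  proof (rule ccontr)
    assume "bad \<noteq> {}"
    have "finite bad" by (simp add: bad_def)
    \<comment> \<open>All coefficients before the least bad exponent act nilpotently, so by
      \<open>acts_nilpotently_mod\<close> it is enough to treat this one modulo them.\<close>
    define \<mu> where "\<mu> = arg_min_on enc bad"
    have \<mu>: "\<mu> \<in> bad" "\<And>m. m \<in> bad \<Longrightarrow> enc \<mu> \<le> enc m"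
      using arg_min_if_finite[OF \<open>finite bad\<close> \<open>bad \<noteq> {}\<close>, of enc] unfolding \<mu>_def
      by (auto simp: not_less[symmetric])
    define Q where "Q = ?c ` {m \<in> Poly_Mapping.keys f. enc m < enc \<mu>}"
    have "finite Q" by (simp add: Q_def)
    have Q: "?nil q \<and> (\<forall>x\<in>?V. q * x \<in> ?V)" if "q \<in> Q" for q
      using that \<mu>(2) by (fastforce simp: Q_def bad_def const_poly_mult_component not_less[symmetric])
    let ?X = "lin_combs Q ?V W"
    let ?a = "?c \<mu>"
    note X_add = lin_combs_add[OF W(1) poly_component_add]
    have X_mult: "const_poly b * g \<in> ?X" if "g \<in> ?X" for b g
      using lin_combs_mult[OF W(1) const_poly_mult_component that] .
    have X_pow: "?a ^ M * g \<in> ?X" if "?a ^ N * g \<in> ?X" "N \<le> M" for N M g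
    proof -
      have "?a ^ M * g = const_poly (Poly_Mapping.lookup f \<mu> ^ (M - N)) * (?a ^ N * g)"
        using \<open>N \<le> M\<close> by (simp add: const_poly_power[symmetric] mult.assoc[symmetric] power_add[symmetric])
      then show ?thesis using X_mult[OF that(1)] by simp
    qed
    \<comment> \<open>The basis monomials that no power of \<open>?a\<close> moves into
      \<open>?X\<close>. Monomials with an exponent of at least \<open>T\<close> lie in
      \<open>W\<close>; leaving them out makes \<open>B\<close> finite, so that a largest element
      can be chosen.\<close>
    define B where "B = {m :: 'n \<Rightarrow>\<^sub>0 nat. (\<forall>i. Poly_Mapping.lookup m i < T) \<and> int (wdegree dg m) = D
      \<and> (\<nexists>N. ?a ^ N * Poly_Mapping.single m 1 \<in> ?X)}"
    have good: "\<exists>N. ?a ^ N * Poly_Mapping.single m 1 \<in> ?X" if "int (wdegree dg m) = D" "m \<notin> B" for m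
    proof (cases "\<forall>i. Poly_Mapping.lookup m i < T")
      case True
      then show ?thesis using that by (auto simp: B_def)
    next
      case False
      then have "Poly_Mapping.single m 1 \<in> W"
        using monomial_in_power_ideal[OF W(1,2)] by (auto simp: not_less)
      then have "?a ^ 0 * Poly_Mapping.single m 1 \<in> ?X" by (simp add: lin_combs_base)
      then show ?thesis by blast
    qed
    have "B = {}"
    proof (rule ccontr)
      assume "B \<noteq> {}"
      have "finite B"
        by (rule finite_subset[OF _ finite_bounded_monomials[of T]]) (auto simp: B_def)
      then have "finite (enc ` B)" "enc ` B \<noteq> {}" using \<open>B \<noteq> {}\<close> by auto
      then obtain \<kappa> where \<kappa>: "\<kappa> \<in> B" "enc \<kappa> = Max (enc ` B)"
        using Max_in by (metis (no_types, lifting) imageE)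
      have \<kappa>_max: "m \<notin> B" if "enc \<kappa> < enc m" for m
        using \<open>finite (enc ` B)\<close> that unfolding \<kappa>(2) by (metis Max_ge imageI leD)
      have \<mu>_key: "\<mu> \<in> Poly_Mapping.keys f" using \<mu>(1) by (simp add: bad_def)
      then have deg_\<mu>: "int (wdegree dg \<mu>) = k"
        using f by (simp add: poly_component_def in_keys_iff)
      have le: "Poly_Mapping.lookup \<mu> i \<le> Poly_Mapping.lookup \<kappa> i" for i
      proof (rule ccontr)
        assume lt: "\<not> ?thesis"
        \<comment> \<open>The exponent T - 1 - \<kappa> + \<mu> has nonnegative entries and weighted
          degree below \<open>T\<close> by the choice of \<open>T\<close>, but an entry with \<mu> >
          \<kappa> would be at least \<open>T\<close>.\<close>
        let ?x = "\<lambda>j. int T - 1 - int (Poly_Mapping.lookup \<kappa> j) + int (Poly_Mapping.lookup \<mu> j)"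
        have nonneg: "0 \<le> ?x j * int (dg j)" for j
        proof -
          have "Poly_Mapping.lookup \<kappa> j < T" using \<kappa>(1) by (simp add: B_def)
          then show ?thesis by (intro mult_nonneg_nonneg) auto
        qed
        have "int T \<le> ?x i" using lt by simp
        also have "\<dots> \<le> ?x i * int (dg i)"
          using pos[of i] lt mult_left_mono[of 1 "int (dg i)" "?x i"] by simp
        also have "\<dots> \<le> (\<Sum>j\<in>UNIV. ?x j * int (dg j))"
          by (rule member_le_sum) (use nonneg in auto)
        also have "\<dots> = (\<Sum>j\<in>UNIV. (int T - 1) * int (dg j)) - D + k"
        proof -
          have "int (wdegree dg \<kappa>) = D" using \<kappa>(1) by (simp add: B_def)
          then show ?thesis
            unfolding deg_\<mu>[symmetric]
            by (simp add: wdegree_def left_diff_distrib distrib_right sum.distrib sum_subtractf flip: \<open>_ = D\<close>)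
        qed
        finally show False using T by simp
      qed
      have split: "\<kappa> - \<mu> + \<mu> = \<kappa>"
        using le by (intro poly_mapping_eqI) (simp add: lookup_add lookup_minus)
      have deg: "int (wdegree dg (\<kappa> - \<mu> + m)) = D" if "m \<in> Poly_Mapping.keys f" for m
      proof -
        have "int (wdegree dg m) = int (wdegree dg \<mu>)"
          using that f deg_\<mu> by (simp add: poly_component_def in_keys_iff)
        then have "int (wdegree dg (\<kappa> - \<mu> + m)) = int (wdegree dg (\<kappa> - \<mu> + \<mu>))"
          by (simp add: wdegree_add)
        then show ?thesis using \<kappa>(1) by (simp add: split B_def)
      qed
      \<comment> \<open>\<open>f\<close> is multiplied so that its term at \<mu> lands on \<kappa>.
        Terms before \<mu> have coefficients in \<open>Q\<close>; terms after \<mu> land beyond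
        \<kappa>, hence outside \<open>B\<close>, where some power of \<open>?a\<close>
        suffices.\<close>
      let ?t = "\<lambda>m. ?c m * Poly_Mapping.single (\<kappa> - \<mu> + m) 1"
      have "Poly_Mapping.single (\<kappa> - \<mu>) 1 * f = (\<Sum>m\<in>Poly_Mapping.keys f. ?t m)"
        by (subst (1) poly_mapping_sum_monomials[of f])
          (simp add: sum_distrib_left mult_single const_poly_def)
      also have "\<dots> = ?t \<mu> + (\<Sum>m\<in>Poly_Mapping.keys f - {\<mu>}. ?t m)"
        using \<mu>_key by (simp add: sum.remove)
      finally have "?a * Poly_Mapping.single \<kappa> 1 = Poly_Mapping.single (\<kappa> - \<mu>) 1 * f
          + const_poly (- 1) * (\<Sum>m\<in>Poly_Mapping.keys f - {\<mu>}. ?t m)"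
        by (simp add: split const_poly_def single_uminus)
      moreover have "\<exists>N. \<forall>m\<in>Poly_Mapping.keys f - {\<mu>}. ?a ^ N * ?t m \<in> ?X"
      proof -
        have "\<exists>N. ?a ^ N * ?t m \<in> ?X" if m: "m \<in> Poly_Mapping.keys f - {\<mu>}" for m
        proof (cases "enc m < enc \<mu>")
          case True
          then have "?t m \<in> ?X"
            using m deg[of m] monomial_component[of "\<kappa> - \<mu> + m" 1 dg]
            by (intro lin_combs_gen \<open>finite Q\<close> W(1)) (auto simp: Q_def)
          then show ?thesis by (intro exI[of _ 0]) simp
        next
          case False
          then have "enc \<mu> < enc m"
            using m enc(1) by (metis DiffD2 injD linorder_less_linear singletonI)
          then have "enc (\<kappa> - \<mu> + \<mu>) < enc (\<kappa> - \<mu> + m)"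
            by (simp only: enc(2) add_strict_left_mono)
          then have "\<kappa> - \<mu> + m \<notin> B" using \<kappa>_max by (simp add: split)
          then obtain N where "?a ^ N * Poly_Mapping.single (\<kappa> - \<mu> + m) 1 \<in> ?X"
            using good deg[of m] m by blast
          then have "?c m * (?a ^ N * Poly_Mapping.single (\<kappa> - \<mu> + m) 1) \<in> ?X" by (rule X_mult)
          then show ?thesis by (intro exI[of _ N]) (simp add: mult.left_commute)
        qed
        then obtain N where N: "\<And>m. m \<in> Poly_Mapping.keys f - {\<mu>} \<Longrightarrow> ?a ^ N m * ?t m \<in> ?X" by metis
        have "?a ^ Max (insert 0 (N ` (Poly_Mapping.keys f - {\<mu>}))) * ?t m \<in> ?X"
          if "m \<in> Poly_Mapping.keys f - {\<mu>}" for m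
          by (rule X_pow[OF N[OF that]]) (use that in \<open>auto intro!: Max_ge\<close>)
        then show ?thesis by blast
      qed
      then obtain N where "\<And>m. m \<in> Poly_Mapping.keys f - {\<mu>} \<Longrightarrow> ?a ^ N * ?t m \<in> ?X" by blast
      then have "(\<Sum>m\<in>Poly_Mapping.keys f - {\<mu>}. ?a ^ N * ?t m) \<in> ?X"
        by (intro lin_combs_sum W(1) poly_component_add) auto
      then have "const_poly (- 1) * (?a ^ N * (\<Sum>m\<in>Poly_Mapping.keys f - {\<mu>}. ?t m)) \<in> ?X"
        unfolding sum_distrib_left[symmetric] by (rule X_mult)
      moreover have "?a ^ N * (Poly_Mapping.single (\<kappa> - \<mu>) 1 * f) \<in> ?X"
        by (intro lin_combs_base ideal_ofD(4)[OF W(1)] W(3)) auto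
      ultimately have "?a ^ N * (?a * Poly_Mapping.single \<kappa> 1) \<in> ?X"
        using X_add by (simp add: distrib_left mult.left_commute)
      then have "?a ^ Suc N * Poly_Mapping.single \<kappa> 1 \<in> ?X" by (simp add: ac_simps)
      then show False using \<kappa>(1) unfolding B_def by blast
    qed
    then have "\<exists>N. ?a ^ N * Poly_Mapping.single m 1 \<in> ?X" if "int (wdegree dg m) = D" for m
      using good[OF that] by simp
    then obtain N where N: "\<And>m. int (wdegree dg m) = D \<Longrightarrow> ?a ^ N m * Poly_Mapping.single m 1 \<in> ?X" by metis
    \<comment> \<open>Only the finitely many monomials with all exponents below \<open>T\<close>
      need a common bound; the others are in \<open>W\<close>.\<close>
    define M where "M = Max (insert 0 (N ` {m. \<forall>i. Poly_Mapping.lookup m i < T}))"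
    have M: "?a ^ M * Poly_Mapping.single m 1 \<in> ?X" if "int (wdegree dg m) = D" for m
    proof (cases "\<forall>i. Poly_Mapping.lookup m i < T")
      case True
      then have "N m \<le> M"
        unfolding M_def using finite_bounded_monomials[of T] by (intro Max_ge) auto
      then show ?thesis using X_pow[OF N[OF that]] by blast
    next
      case False
      then have "Poly_Mapping.single m 1 \<in> W"
        using monomial_in_power_ideal[OF W(1,2)] by (auto simp: not_less)
      then show ?thesis by (intro lin_combs_base ideal_ofD(4)[OF W(1)]) auto
    qed
    have "?a ^ M * g \<in> ?X" if g: "g \<in> ?V" for g
    proof -
      have "?a ^ M * g = (\<Sum>m\<in>Poly_Mapping.keys g. const_poly (Poly_Mapping.lookup g m) * (?a ^ M * Poly_Mapping.single m 1))"
        by (subst (1) poly_mapping_sum_monomials[of g])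
          (simp add: sum_distrib_left mult_single const_poly_def const_poly_power[unfolded const_poly_def] mult.commute)
      also have "\<dots> \<in> ?X"
        using g by (intro lin_combs_sum W(1) poly_component_add X_mult M)
          (auto simp: poly_component_def in_keys_iff)
      finally show ?thesis .
    qed
    then have "?nil ?a"
      using acts_nilpotently_mod[OF W(1) poly_component_0 poly_component_add \<open>finite Q\<close> Q const_poly_mult_component]
      by blast
    then show False using \<mu>(1) by (simp add: bad_def)
  qed
  then have "?nil (?c \<nu>)" if "\<nu> \<in> Poly_Mapping.keys f"
    using that by (auto simp: bad_def)
  \<comment> \<open>A zero coefficient needs the exponent 1, since 0 ^ 0 = 1.\<close>
  moreover have "?nil (?c \<nu>)" if "\<nu> \<notin> Poly_Mapping.keys f"
    using that ideal_ofD(2)[OF W(1)] unfolding acts_nilpotently_def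
    by (intro exI[of _ 1]) (simp add: in_keys_iff const_poly_def)
  ultimately show ?thesis by blast
qed

section \<open>Graded modules over the quotient ring\<close>

lemma ideal_class_interp:
  assumes "ideal_of UNIV I"
  shows "ideal I (cring_class_ops :: 'a::comm_ring_1 ring)"
  using assms by (simp add: ideal_of_UNIV_iff)

lemma cring_quot_ring:
  assumes "ideal_of UNIV I"
  shows "cring (quot_ring I)"
  unfolding quot_ring_def
  by (rule ideal.quotient_is_cring[OF ideal_class_interp[OF assms] cring_class])

lemma quot_proj_ring_hom:
  assumes "ideal_of UNIV I"
  shows "quot_proj I \<in> ring_hom cring_class_ops (quot_ring I)"
  using ideal.rcos_ring_hom[OF ideal_class_interp[OF assms]]
  by (simp add: quot_ring_def quot_proj_def[abs_def])

lemma quot_proj_simps: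
  assumes "ideal_of UNIV I"
  shows "quot_proj I f \<in> carrier (quot_ring I)"
    "quot_proj I (f + g) = quot_proj I f \<oplus>\<^bsub>quot_ring I\<^esub> quot_proj I g"
    "quot_proj I (f * g) = quot_proj I f \<otimes>\<^bsub>quot_ring I\<^esub> quot_proj I g"
    "quot_proj I 1 = \<one>\<^bsub>quot_ring I\<^esub>"
  using ring_hom_closed[OF quot_proj_ring_hom[OF assms], of f]
    ring_hom_add[OF quot_proj_ring_hom[OF assms], of f g]
    ring_hom_mult[OF quot_proj_ring_hom[OF assms], of f g]
    ring_hom_one[OF quot_proj_ring_hom[OF assms]]
  by (simp_all add: carrier_class class_simps)

lemma quot_ring_carrier: "carrier (quot_ring I) = Set.range (quot_proj I)"
  by (auto simp: quot_ring_def FactRing_def A_RCOSETS_def' quot_proj_def carrier_class)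

lemma quot_proj_eq_iff:
  assumes "ideal_of UNIV I"
  shows "quot_proj I f = quot_proj I g \<longleftrightarrow> f - g \<in> I"
  unfolding quot_proj_def
  using ring.quotient_eq_iff_same_a_r_cos[OF cring.axioms(1)[OF cring_class] ideal_class_interp[OF assms], of f g]
  by (simp add: carrier_class minus_class)

lemma quot_proj_zero_iff:
  assumes "ideal_of UNIV I"
  shows "quot_proj I f = \<zero>\<^bsub>quot_ring I\<^esub> \<longleftrightarrow> f \<in> I"
proof -
  interpret cring "quot_ring I" by (rule cring_quot_ring[OF assms])
  have "quot_proj I 0 = quot_proj I 0 \<oplus>\<^bsub>quot_ring I\<^esub> quot_proj I 0"
    using quot_proj_simps(2)[OF assms, of 0 0] by simp
  then have "quot_proj I 0 = \<zero>\<^bsub>quot_ring I\<^esub>"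
    using quot_proj_simps(1)[OF assms, of 0] by (metis add.l_cancel_one)
  then show ?thesis using quot_proj_eq_iff[OF assms, of f 0] by simp
qed

lemma (in abelian_group) diff_eq_zero_iff:
  assumes "x \<in> carrier G" "y \<in> carrier G"
  shows "x \<ominus> y = \<zero> \<longleftrightarrow> x = y"
  using assms minus_equality[of x "\<ominus> y"] by (auto simp: a_minus_def r_neg)

text \<open>Scalars are polynomials of S, so that computations with them take place in the type
  class and not with cosets.\<close>

definition act :: "('n, 'a::comm_ring_1) mpoly set \<Rightarrow> (('n, 'a) mpoly set, 'e) module \<Rightarrow>
    ('n, 'a) mpoly \<Rightarrow> 'e \<Rightarrow> 'e" where
  "act I M f x = quot_proj I f \<odot>\<^bsub>M\<^esub> x"

locale quot_module =
  fixes I :: "('n::finite, 'a::comm_ring_1) mpoly set" and M :: "(('n, 'a) mpoly set, 'e) module" (structure)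
  assumes I: "ideal_of UNIV I" and module: "module (quot_ring I) M"
begin

sublocale abelian_group M
  using module by (rule module.axioms)

lemma act_closed [simp, intro]: "x \<in> carrier M \<Longrightarrow> act I M f x \<in> carrier M"
  unfolding act_def using module quot_proj_simps(1)[OF I] by (simp add: module.smult_closed)

lemma act_add_left: "x \<in> carrier M \<Longrightarrow> act I M (f + g) x = act I M f x \<oplus> act I M g x"
  unfolding act_def using module quot_proj_simps[OF I] by (simp add: module.smult_l_distr)

lemma act_add: "x \<in> carrier M \<Longrightarrow> y \<in> carrier M \<Longrightarrow> act I M f (x \<oplus> y) = act I M f x \<oplus> act I M f y"
  unfolding act_def using module quot_proj_simps[OF I] by (simp add: module.smult_r_distr)

lemma act_mult: "x \<in> carrier M \<Longrightarrow> act I M (f * g) x = act I M f (act I M g x)"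
  unfolding act_def using module quot_proj_simps[OF I] by (simp add: module.smult_assoc1)

lemma act_commute: "x \<in> carrier M \<Longrightarrow> act I M f (act I M g x) = act I M g (act I M f x)"
  by (simp add: mult.commute flip: act_mult)

lemma act_one [simp]: "x \<in> carrier M \<Longrightarrow> act I M 1 x = x"
  unfolding act_def using module quot_proj_simps(4)[OF I] by (simp add: module.smult_one)

lemma act_zero [simp]: "act I M f \<zero> = \<zero>"
  unfolding act_def using module.smult_r_null[OF module] quot_proj_simps(1)[OF I] by simp

lemma act_ideal: "f \<in> I \<Longrightarrow> x \<in> carrier M \<Longrightarrow> act I M f x = \<zero>"
  unfolding act_def using module.smult_l_null[OF module] quot_proj_zero_iff[OF I, of f] by simp

lemma act_0 [simp]: "x \<in> carrier M \<Longrightarrow> act I M 0 x = \<zero>"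
  using ideal_ofD(2)[OF I] by (rule act_ideal)

lemma act_uminus_right: "x \<in> carrier M \<Longrightarrow> act I M f (\<ominus> x) = \<ominus> act I M f x"
  unfolding act_def using module quot_proj_simps[OF I] by (simp add: module.smult_r_minus)

lemma act_uminus: "x \<in> carrier M \<Longrightarrow> act I M (- f) x = \<ominus> act I M f x"
  using act_add_left[of x "- f" f] minus_equality[of "act I M (- f) x" "act I M f x"] by simp

lemma act_diff: "x \<in> carrier M \<Longrightarrow> y \<in> carrier M \<Longrightarrow> act I M f (x \<ominus> y) = act I M f x \<ominus> act I M f y"
  by (simp add: a_minus_def act_add act_uminus_right)

lemma act_diff_left: "x \<in> carrier M \<Longrightarrow> act I M (f - g) x = act I M f x \<ominus> act I M g x"
  using act_add_left[of x f "- g"] by (simp add: a_minus_def act_uminus)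

lemma act_power_zero_mono:
  assumes "x \<in> carrier M" "act I M (u ^ k) x = \<zero>" "k \<le> l"
  shows "act I M (u ^ l) x = \<zero>"
  using assms act_mult[of x "u ^ (l - k)" "u ^ k"] by (simp flip: power_add)

lemma ideal_annihilator:
  assumes "x \<in> carrier M"
  shows "ideal_of UNIV {f. act I M f x = \<zero>}"
  using assms by (auto simp: ideal_of_def act_add_left act_mult)

lemma finsum_additive:
  assumes "abelian_group N" and h: "h \<in> carrier M \<rightarrow> carrier N"
    and add: "\<And>x y. x \<in> carrier M \<Longrightarrow> y \<in> carrier M \<Longrightarrow> h (x \<oplus> y) = h x \<oplus>\<^bsub>N\<^esub> h y"
    and F: "finite F" "c \<in> F \<rightarrow> carrier M"
  shows "h (finsum M c F) = finsum N (\<lambda>n. h (c n)) F"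
proof -
  interpret N: abelian_group N by fact
  have "h \<zero> = h \<zero> \<oplus>\<^bsub>N\<^esub> h \<zero>" using add[of \<zero> \<zero>] by simp
  then have h0: "h \<zero> = \<zero>\<^bsub>N\<^esub>" using h by (metis N.add.l_cancel_one PiE zero_closed)
  show ?thesis
    using F
  proof (induction F rule: finite_induct)
    case empty
    then show ?case using h0 by simp
  next
    case (insert n F)
    then have "c \<in> F \<rightarrow> carrier M" "c n \<in> carrier M" "(\<lambda>n. h (c n)) \<in> F \<rightarrow> carrier N" "h (c n) \<in> carrier N"
      using h by auto
    then show ?case using insert add by (simp add: finsum_insert N.finsum_insert)
  qed
qed

text \<open>Uniqueness of decompositions reduces to zero sums: subtract two decompositions of an
  element over the union of their supports.\<close>

lemma graded_moduleI:
  assumes sub: "\<And>n. additive_subgroup (\<M> n) M"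
    and act: "\<And>f k x n. f \<in> poly_component dg k \<Longrightarrow> x \<in> \<M> n \<Longrightarrow> act I M f x \<in> \<M> (k + n)"
    and ex: "\<And>x. x \<in> carrier M \<Longrightarrow> \<exists>F c. finite F \<and> (\<forall>n\<in>F. c n \<in> \<M> n) \<and> x = finsum M c F"
    and uniq: "\<And>F c n. finite F \<Longrightarrow> (\<And>n. n \<in> F \<Longrightarrow> c n \<in> \<M> n) \<Longrightarrow> finsum M c F = \<zero> \<Longrightarrow> n \<in> F \<Longrightarrow> c n = \<zero>"
  shows "graded_module (quot_ring I) (quot_component dg I) M \<M>"
  unfolding graded_module_def
proof (intro conjI ballI allI)
  have \<M>: "x \<in> \<M> n \<Longrightarrow> x \<in> carrier M" "\<zero> \<in> \<M> n" for x n
    using additive_subgroup.a_subset[OF sub] additive_subgroup.zero_closed[OF sub] by auto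
  have \<M>_minus: "x \<ominus> y \<in> \<M> n" if "x \<in> \<M> n" "y \<in> \<M> n" for x y n
    using that additive_subgroup.a_closed[OF sub] additive_subgroup.a_inv_closed[OF sub]
    by (simp add: a_minus_def)
  show "module (quot_ring I) M" by (rule module)
  show "additive_subgroup (\<M> n) M" for n by (rule sub)
  show "a \<odot> x \<in> \<M> (k + n)" if "a \<in> quot_component dg I k" "x \<in> \<M> n" for a x k n
    using that act[of _ k x n] by (auto simp: quot_component_def act_def)
  fix x assume x: "x \<in> carrier M"
  let ?P = "\<lambda>c. (\<forall>n. c n \<in> \<M> n) \<and> finite {n. c n \<noteq> \<zero>} \<and> x = (\<Oplus>n\<in>{n. c n \<noteq> \<zero>}. c n)"
  have supp: "finsum M c {n. c n \<noteq> \<zero>} = finsum M c F" if "finite F" "{n. c n \<noteq> \<zero>} \<subseteq> F" "\<And>n. c n \<in> \<M> n" for c F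
    using that \<M>(1) by (intro add.finprod_mono_neutral_cong_left) auto
  show "\<exists>!c. ?P c"
  proof (rule ex_ex1I)
    obtain F c where F: "finite F" "\<And>n. n \<in> F \<Longrightarrow> c n \<in> \<M> n" "x = finsum M c F" using ex[OF x] by blast
    let ?c = "\<lambda>n. if n \<in> F then c n else \<zero>"
    have "x = finsum M ?c F"
      unfolding F(3) using \<M>(1)[OF F(2)] by (intro finsum_cong' refl) auto
    also have "\<dots> = finsum M ?c {n. ?c n \<noteq> \<zero>}"
      using F(1,2) \<M>(2) by (intro supp[symmetric]) auto
    finally show "\<exists>c. ?P c"
      using F(1,2) \<M>(2) by (intro exI[of _ ?c]) auto
  next
    fix c c' assume c: "?P c" and c': "?P c'"
    let ?F = "{n. c n \<noteq> \<zero>} \<union> {n. c' n \<noteq> \<zero>}"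
    have car: "c n \<in> carrier M" "c' n \<in> carrier M" for n using c c' \<M>(1) by auto
    have "finsum M (\<lambda>n. c n \<ominus> c' n) ?F \<oplus> finsum M c' ?F = finsum M (\<lambda>n. c n \<ominus> c' n \<oplus> c' n) ?F"
      using car by (intro finsum_addf[symmetric]) auto
    also have "\<dots> = finsum M c ?F"
      using car by (intro finsum_cong') (auto simp: a_minus_def a_assoc l_neg)
    also have "\<dots> = finsum M c' ?F"
      using c c' supp[of ?F c] supp[of ?F c'] by auto
    finally have "finsum M (\<lambda>n. c n \<ominus> c' n) ?F = \<zero>"
      using car by (subst (asm) add.r_cancel_one) (auto intro!: finsum_closed)
    then have "c n \<ominus> c' n = \<zero>" if "n \<in> ?F" for n
      using uniq[of ?F "\<lambda>n. c n \<ominus> c' n" n] that c c' \<M>_minus by auto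
    then have "c n = c' n" for n
      using car by (cases "n \<in> ?F") (auto simp: diff_eq_zero_iff)
    then show "c = c'" by blast
  qed
qed

end

locale graded_quot_module = quot_module I M
  for I :: "('n::finite, 'a::comm_ring_1) mpoly set" and M :: "(('n, 'a) mpoly set, 'e) module" (structure) +
  fixes dg :: "'n \<Rightarrow> nat" and \<M> :: "int \<Rightarrow> 'e set"
  assumes graded: "graded_module (quot_ring I) (quot_component dg I) M \<M>"
begin

lemma comp_subgroup: "additive_subgroup (\<M> n) M"
  using graded by (auto simp: graded_module_def)

lemma comp_carrier [simp, intro]: "x \<in> \<M> n \<Longrightarrow> x \<in> carrier M"
  using additive_subgroup.a_subset[OF comp_subgroup] by blast

lemma comp_zero [simp]: "\<zero> \<in> \<M> n"
  by (rule additive_subgroup.zero_closed[OF comp_subgroup])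

lemma comp_add: "x \<in> \<M> n \<Longrightarrow> y \<in> \<M> n \<Longrightarrow> x \<oplus> y \<in> \<M> n"
  by (rule additive_subgroup.a_closed[OF comp_subgroup])

lemma comp_minus: "x \<in> \<M> n \<Longrightarrow> y \<in> \<M> n \<Longrightarrow> x \<ominus> y \<in> \<M> n"
  using additive_subgroup.a_inv_closed[OF comp_subgroup, of y n] by (simp add: a_minus_def comp_add)

lemma comp_act: "f \<in> poly_component dg k \<Longrightarrow> x \<in> \<M> n \<Longrightarrow> act I M f x \<in> \<M> (k + n)"
  using graded unfolding graded_module_def act_def quot_component_def by blast

definition cmp :: "'e \<Rightarrow> int \<Rightarrow> 'e" where
  "cmp x = (THE c. (\<forall>n. c n \<in> \<M> n) \<and> finite {n. c n \<noteq> \<zero>} \<and> x = (\<Oplus>n\<in>{n. c n \<noteq> \<zero>}. c n))"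

lemma cmp:
  assumes "x \<in> carrier M"
  shows "cmp x n \<in> \<M> n" "finite {n. cmp x n \<noteq> \<zero>}" "x = (\<Oplus>n\<in>{n. cmp x n \<noteq> \<zero>}. cmp x n)"
proof -
  have "\<exists>!c. (\<forall>n. c n \<in> \<M> n) \<and> finite {n. c n \<noteq> \<zero>} \<and> x = (\<Oplus>n\<in>{n. c n \<noteq> \<zero>}. c n)"
    using graded assms unfolding graded_module_def by blast
  from theI'[OF this]
  show "cmp x n \<in> \<M> n" "finite {n. cmp x n \<noteq> \<zero>}" "x = (\<Oplus>n\<in>{n. cmp x n \<noteq> \<zero>}. cmp x n)"
    unfolding cmp_def by blast+
qed

lemma cmp_sum:
  assumes F: "finite F" and c: "\<And>n. n \<in> F \<Longrightarrow> c n \<in> \<M> n"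
  shows "cmp (finsum M c F) n = (if n \<in> F then c n else \<zero>)"
proof -
  let ?c = "\<lambda>n. if n \<in> F then c n else \<zero>" and ?x = "finsum M c F"
  have x: "?x \<in> carrier M" by (intro finsum_closed) (use comp_carrier[OF c] in auto)
  have "?x = finsum M ?c F"
    by (intro finsum_cong' refl) (use comp_carrier[OF c] in auto)
  also have "\<dots> = finsum M ?c {n. ?c n \<noteq> \<zero>}"
    using F comp_carrier[OF c] by (intro add.finprod_mono_neutral_cong_right) (auto split: if_splits)
  finally have "(\<forall>n. ?c n \<in> \<M> n) \<and> finite {n. ?c n \<noteq> \<zero>} \<and> ?x = (\<Oplus>n\<in>{n. ?c n \<noteq> \<zero>}. ?c n)"
    using F c by auto
  moreover have "\<exists>!c. (\<forall>n. c n \<in> \<M> n) \<and> finite {n. c n \<noteq> \<zero>} \<and> ?x = (\<Oplus>n\<in>{n. c n \<noteq> \<zero>}. c n)"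
    using graded x unfolding graded_module_def by blast
  ultimately have "cmp ?x = ?c"
    unfolding cmp_def by (rule the1_equality[rotated])
  then show ?thesis by simp
qed

lemma cmp_homogeneous:
  assumes "x \<in> \<M> n"
  shows "cmp x k = (if k = n then x else \<zero>)"
proof -
  have x: "x \<in> carrier M" using assms by (rule comp_carrier)
  let ?c = "\<lambda>k. if k = n then x else \<zero>"
  have "finsum M ?c {n} = ?c n \<oplus> finsum M ?c {}"
    using x by (intro finsum_insert) auto
  also have "\<dots> = x"
    by (simp only: finsum_empty r_zero[OF x] simp_thms if_True)
  finally have "finsum M ?c {n} = x" .
  moreover have "cmp (finsum M ?c {n}) k = (if k \<in> {n} then ?c k else \<zero>)"
    using assms by (intro cmp_sum[of "{n}" ?c k]) simp_all
  ultimately show ?thesis by (simp split: if_splits)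
qed

lemma cmp_additive:
  assumes N: "graded_quot_module I N dg \<N>" and h: "h \<in> carrier M \<rightarrow> carrier N"
    and add: "\<And>x y. x \<in> carrier M \<Longrightarrow> y \<in> carrier M \<Longrightarrow> h (x \<oplus> y) = h x \<oplus>\<^bsub>N\<^esub> h y"
    and deg: "\<And>x n. x \<in> \<M> n \<Longrightarrow> h x \<in> \<N> (n + d)" and x: "x \<in> carrier M"
  shows "graded_quot_module.cmp N \<N> (h x) (n + d) = h (cmp x n)"
proof -
  interpret N: graded_quot_module I N dg \<N> by fact
  \<comment> \<open>Inserting \<open>n\<close> covers a vanishing component without a case
    distinction.\<close>
  let ?F = "insert n {n. cmp x n \<noteq> \<zero>}"
  have "finite ?F" using cmp(2)[OF x] by simp
  moreover have "finsum M (cmp x) {n. cmp x n \<noteq> \<zero>} = finsum M (cmp x) ?F"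
    by (rule add.finprod_mono_neutral_cong_left[OF \<open>finite ?F\<close>]) (use cmp(1)[OF x] in auto)
  ultimately have F: "finite ?F" "x = finsum M (cmp x) ?F"
    using cmp(3)[OF x] by simp_all
  have "h x = finsum N (\<lambda>n. h (cmp x n)) ?F"
    by (subst F(2), rule finsum_additive[OF N.abelian_group_axioms h add]) (use F(1) cmp[OF x] in auto)
  also have "\<dots> = finsum N (\<lambda>m. h (cmp x (m - d))) ((\<lambda>n. n + d) ` ?F)"
    using h cmp(1)[OF x] by (subst N.finsum_reindex) (auto simp: inj_on_def)
  finally have "N.cmp (h x) (n + d) = N.cmp (finsum N (\<lambda>m. h (cmp x (m - d))) ((\<lambda>n. n + d) ` ?F)) (n + d)"
    by simp
  also have "\<dots> = (if n + d \<in> (\<lambda>n. n + d) ` ?F then h (cmp x (n + d - d)) else \<zero>\<^bsub>N\<^esub>)"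
  proof (rule N.cmp_sum)
    show "h (cmp x (m - d)) \<in> \<N> m" for m
      using deg[OF cmp(1)[OF x], of "m - d"] by simp
  qed (use F(1) in simp)
  finally show ?thesis by simp
qed

lemma cmp_act:
  assumes u: "u \<in> poly_component dg d" and x: "x \<in> carrier M"
  shows "cmp (act I M u x) (n + d) = act I M u (cmp x n)"
  by (rule cmp_additive[OF graded_quot_module_axioms])
    (use x comp_act[OF u] in \<open>auto simp: act_add add.commute\<close>)

lemma finsum_restrict:
  assumes "submodule H (quot_ring I) M" "finite F" "c \<in> F \<rightarrow> H"
  shows "finsum (M\<lparr>carrier := H\<rparr>) c F = finsum M c F"
proof -
  have H: "H \<subseteq> carrier M"
    using module.submoduleE(1)[OF module assms(1)] .
  interpret H: abelian_group "M\<lparr>carrier := H\<rparr>"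
    using submodule.submodule_is_module[OF assms(1) module] by (rule module.axioms)
  show ?thesis
    using assms(2,3)
  proof (induction F rule: finite_induct)
    case (insert n F)
    then have "c \<in> F \<rightarrow> H" "c n \<in> H" "c \<in> F \<rightarrow> carrier M" "c n \<in> carrier M" using H by auto
    then show ?case using insert H.finsum_insert[of F n c] by (simp add: finsum_insert)
  qed simp
qed

text \<open>Homogeneous submodules with a shifted grading serve as test modules for graded injectivity.\<close>

lemma graded_submodule_shift:
  assumes H: "submodule H (quot_ring I) M" and hom: "\<And>x n. x \<in> H \<Longrightarrow> cmp x n \<in> H"
  shows "graded_module (quot_ring I) (quot_component dg I) (M\<lparr>carrier := H\<rparr>) (\<lambda>n. \<M> (n - s) \<inter> H)"
proof -
  have mod: "module (quot_ring I) (M\<lparr>carrier := H\<rparr>)"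
    by (rule submodule.submodule_is_module[OF H module])
  interpret H: quot_module I "M\<lparr>carrier := H\<rparr>"
    by (rule quot_module.intro[OF I mod])
  have Hc: "H \<subseteq> carrier M" and H_add: "\<And>x y. x \<in> H \<Longrightarrow> y \<in> H \<Longrightarrow> x \<oplus> y \<in> H"
    and H_inv: "\<And>x. x \<in> H \<Longrightarrow> \<ominus> x \<in> H"
    using module.submoduleE[OF module H] by auto
  have H0: "\<zero> \<in> H" using H.zero_closed by simp
  have act_eq: "act I (M\<lparr>carrier := H\<rparr>) = act I M" by (simp add: act_def fun_eq_iff)
  show ?thesis
  proof (rule H.graded_moduleI)
    fix n
    have "subgroup (\<M> (n - s) \<inter> H) (add_monoid (M\<lparr>carrier := H\<rparr>))"
    proof (rule group.subgroupI)
      show "group (add_monoid (M\<lparr>carrier := H\<rparr>))" using H.a_comm_group by (rule comm_group.axioms)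
      show "\<M> (n - s) \<inter> H \<noteq> {}" using H0 comp_zero by blast
      show "inv\<^bsub>add_monoid (M\<lparr>carrier := H\<rparr>)\<^esub> x \<in> \<M> (n - s) \<inter> H" if x: "x \<in> \<M> (n - s) \<inter> H" for x
      proof -
        have "\<ominus> x \<in> \<M> (n - s)" using comp_minus[of \<zero> "n - s" x] x by (simp add: a_minus_def)
        moreover have "\<ominus>\<^bsub>M\<lparr>carrier := H\<rparr>\<^esub> x = \<ominus> x"
        proof (rule H.minus_equality)
          show "\<ominus> x \<oplus>\<^bsub>M\<lparr>carrier := H\<rparr>\<^esub> x = \<zero>\<^bsub>M\<lparr>carrier := H\<rparr>\<^esub>" using x comp_carrier[of x "n - s"] by (auto simp: l_neg)
        qed (use x H_inv in auto)
        ultimately show ?thesis using x H_inv unfolding a_inv_def by auto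
      qed
    qed (use comp_add H_add in auto)
    then show "additive_subgroup (\<M> (n - s) \<inter> H) (M\<lparr>carrier := H\<rparr>)" by (rule additive_subgroup.intro)
  next
    fix f :: "('n, 'a) mpoly" and k x n
    assume f: "f \<in> poly_component dg k" and x: "x \<in> \<M> (n - s) \<inter> H"
    then show "act I (M\<lparr>carrier := H\<rparr>) f x \<in> \<M> (k + n - s) \<inter> H"
      using comp_act[OF f, of x "n - s"] H.act_closed[of x f] by (simp add: act_eq algebra_simps)
  next
    fix x assume "x \<in> carrier (M\<lparr>carrier := H\<rparr>)"
    then have x: "x \<in> H" "x \<in> carrier M" using Hc by auto
    let ?F = "{n. cmp x n \<noteq> \<zero>}"
    have "x = finsum M (cmp x) ?F" by (rule cmp(3)[OF x(2)])
    also have "\<dots> = finsum M (\<lambda>n. cmp x (n - s)) ((\<lambda>n. n + s) ` ?F)"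
      using cmp(1)[OF x(2)] by (subst finsum_reindex) (auto simp: inj_on_def)
    also have "\<dots> = finsum (M\<lparr>carrier := H\<rparr>) (\<lambda>n. cmp x (n - s)) ((\<lambda>n. n + s) ` ?F)"
      using cmp(2)[OF x(2)] hom[OF x(1)] by (intro finsum_restrict[OF H, symmetric]) auto
    finally show "\<exists>F c. finite F \<and> (\<forall>n\<in>F. c n \<in> \<M> (n - s) \<inter> H) \<and> x = finsum (M\<lparr>carrier := H\<rparr>) c F"
      using cmp(1,2)[OF x(2)] hom[OF x(1)] by (intro exI conjI) auto
  next
    fix F c n
    assume F: "finite F" and c: "\<And>n. n \<in> F \<Longrightarrow> c n \<in> \<M> (n - s) \<inter> H"
      and z: "finsum (M\<lparr>carrier := H\<rparr>) c F = \<zero>\<^bsub>M\<lparr>carrier := H\<rparr>\<^esub>" and n: "n \<in> F"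
    have eq: "(\<lambda>n. n + s) ` (\<lambda>n. n - s) ` F = F" by (force simp: image_image)
    have "\<zero> = finsum M c F"
      using z finsum_restrict[OF H F, of c] c by auto
    also have "\<dots> = finsum M (\<lambda>n. c (n + s)) ((\<lambda>n. n - s) ` F)"
      using c by (subst eq[symmetric], subst finsum_reindex) (auto simp: inj_on_def eq)
    finally have "cmp (finsum M (\<lambda>n. c (n + s)) ((\<lambda>n. n - s) ` F)) (n - s) = \<zero>"
      using cmp_homogeneous[OF comp_zero] by simp
    moreover have "cmp (finsum M (\<lambda>n. c (n + s)) ((\<lambda>n. n - s) ` F)) (n - s)
        = (if n - s \<in> (\<lambda>n. n - s) ` F then c (n - s + s) else \<zero>)"
      using F c by (intro cmp_sum) fastforce+
    ultimately show "c n = \<zero>\<^bsub>M\<lparr>carrier := H\<rparr>\<^esub>" using n by auto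
  qed
qed

end

section \<open>Graded injective resolutions of the quotient ring\<close>

lemma graded_injectiveD:
  fixes F M N :: "('r, 'e) module"
  assumes "graded_injective A \<A> F \<F>" "graded_module A \<A> M \<M>" "graded_module A \<A> N \<N>"
    "h \<in> graded_hom A M \<M> N \<N>" "inj_on h (carrier M)" "f \<in> graded_hom A M \<M> F \<F>"
  shows "\<exists>g\<in>graded_hom A N \<N> F \<F>. \<forall>x\<in>carrier M. g (h x) = f x"
  using assms(1)[unfolded graded_injective_def, THEN conjunct2, rule_format, OF assms(2-6)] .

locale graded_resolution =
  fixes dg :: "'n::finite \<Rightarrow> nat" and I :: "('n, 'a::comm_ring_1) mpoly set"
    and E :: "nat \<Rightarrow> (('n, 'a) mpoly set, 'e) module" and \<E> :: "nat \<Rightarrow> int \<Rightarrow> 'e set"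
    and \<epsilon> :: "('n, 'a) mpoly set \<Rightarrow> 'e" and \<delta> :: "nat \<Rightarrow> 'e \<Rightarrow> 'e"
  assumes acc: "acc_ideals (UNIV :: ('n, 'a) mpoly set)"
    and ideal: "ideal_of UNIV I"
    and hom_ideal: "\<And>k f. f \<in> I \<Longrightarrow> hom_comp dg k f \<in> I"
    and res: "graded_injective_resolution (quot_ring I) (quot_component dg I)
          (regular_module (quot_ring I)) (quot_component dg I) E \<E> \<epsilon> \<delta>"
begin

lemma injective: "graded_injective (quot_ring I) (quot_component dg I) (E j) (\<E> j)"
  using res by (simp add: graded_injective_resolution_def)

lemma E_graded: "graded_module (quot_ring I) (quot_component dg I) (E j) (\<E> j)"
  using injective by (simp add: graded_injective_def)

sublocale E: graded_quot_module I "E j" dg "\<E> j" for j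
proof -
  show "graded_quot_module I (E j) dg (\<E> j)"
    using E_graded[of j] ideal
    by (intro graded_quot_module.intro quot_module.intro graded_quot_module_axioms.intro)
      (auto simp: graded_module_def)
qed

abbreviation act' :: "nat \<Rightarrow> ('n, 'a) mpoly \<Rightarrow> 'e \<Rightarrow> 'e" where
  "act' j \<equiv> act I (E j)"

lemma \<delta>_hom: "\<delta> j \<in> graded_hom (quot_ring I) (E j) (\<E> j) (E (Suc j)) (\<E> (Suc j))"
  using res by (simp add: graded_injective_resolution_def)

lemma \<delta>_closed [simp, intro]: "x \<in> carrier (E j) \<Longrightarrow> \<delta> j x \<in> carrier (E (Suc j))"
  using \<delta>_hom[of j] by (auto simp: graded_hom_def)

lemma \<delta>_add: "x \<in> carrier (E j) \<Longrightarrow> y \<in> carrier (E j) \<Longrightarrow> \<delta> j (x \<oplus>\<^bsub>E j\<^esub> y) = \<delta> j x \<oplus>\<^bsub>E (Suc j)\<^esub> \<delta> j y"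
  using \<delta>_hom[of j] by (auto simp: graded_hom_def)

lemma \<delta>_act: "x \<in> carrier (E j) \<Longrightarrow> \<delta> j (act' j f x) = act' (Suc j) f (\<delta> j x)"
  using \<delta>_hom[of j] quot_proj_simps(1)[OF ideal, of f] by (auto simp: graded_hom_def act_def)

lemma \<delta>_comp: "x \<in> \<E> j n \<Longrightarrow> \<delta> j x \<in> \<E> (Suc j) n"
  using \<delta>_hom[of j] unfolding graded_hom_def by blast

lemma \<delta>_zero [simp]: "\<delta> j \<zero>\<^bsub>E j\<^esub> = \<zero>\<^bsub>E (Suc j)\<^esub>"
  using \<delta>_act[of "\<zero>\<^bsub>E j\<^esub>" j 0] by simp

lemma \<delta>_diff:
  assumes "x \<in> carrier (E j)" "y \<in> carrier (E j)"
  shows "\<delta> j (x \<ominus>\<^bsub>E j\<^esub> y) = \<delta> j x \<ominus>\<^bsub>E (Suc j)\<^esub> \<delta> j y"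
proof -
  have "\<delta> j (\<ominus>\<^bsub>E j\<^esub> y) = \<ominus>\<^bsub>E (Suc j)\<^esub> \<delta> j y"
    using \<delta>_act[OF assms(2), of "- 1"] assms by (simp add: E.act_uminus)
  then show ?thesis
    using assms by (simp add: a_minus_def \<delta>_add)
qed

lemma \<delta>_exact: "\<delta> j ` carrier (E j) = {x \<in> carrier (E (Suc j)). \<delta> (Suc j) x = \<zero>\<^bsub>E (Suc (Suc j))\<^esub>}"
  using res by (simp add: graded_injective_resolution_def)

lemma \<delta>_\<delta> [simp]: "x \<in> carrier (E j) \<Longrightarrow> \<delta> (Suc j) (\<delta> j x) = \<zero>\<^bsub>E (Suc (Suc j))\<^esub>"
  using \<delta>_exact[of j] by blast

lemma \<delta>_cmp: "x \<in> carrier (E j) \<Longrightarrow>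
    graded_quot_module.cmp (E (Suc j)) (\<E> (Suc j)) (\<delta> j x) n = \<delta> j (graded_quot_module.cmp (E j) (\<E> j) x n)"
  using E.cmp_additive[OF E.graded_quot_module_axioms[of "Suc j"], of "\<delta> j" j 0 x n]
  by (auto simp: \<delta>_add \<delta>_comp)

text \<open>Replace a preimage by its component of degree \<open>n\<close>; taking components
  commutes with \<open>\<delta>\<close>.\<close>

lemma \<delta>_exact_hom:
  assumes x: "x \<in> \<E> (Suc j) n" "\<delta> (Suc j) x = \<zero>\<^bsub>E (Suc (Suc j))\<^esub>"
  shows "\<exists>y\<in>\<E> j n. \<delta> j y = x"
proof -
  have "x \<in> \<delta> j ` carrier (E j)" unfolding \<delta>_exact using x E.comp_carrier[OF x(1)] by blast
  then obtain y where y: "y \<in> carrier (E j)" "x = \<delta> j y" by blast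
  have "\<delta> j (graded_quot_module.cmp (E j) (\<E> j) y n) = x"
    using \<delta>_cmp[OF y(1), of n] E.cmp_homogeneous[OF x(1), of n] y(2) by simp
  then show ?thesis using E.cmp(1)[OF y(1)] by blast
qed

section \<open>The augmentation and the extension of maps from ideals\<close>

definition aug :: "('n, 'a) mpoly \<Rightarrow> 'e" where
  "aug f = \<epsilon> (quot_proj I f)"

lemma \<epsilon>_hom: "\<epsilon> \<in> graded_hom (quot_ring I) (regular_module (quot_ring I)) (quot_component dg I) (E 0) (\<E> 0)"
  using res by (simp add: graded_injective_resolution_def)

lemma regular_module_simps [simp]:
  "carrier (regular_module A) = carrier A" "x \<oplus>\<^bsub>regular_module A\<^esub> y = x \<oplus>\<^bsub>A\<^esub> y"
  "a \<odot>\<^bsub>regular_module A\<^esub> x = a \<otimes>\<^bsub>A\<^esub> x"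
  by (simp_all add: regular_module_def)

lemma aug_closed [simp, intro]: "aug f \<in> carrier (E 0)"
  using \<epsilon>_hom quot_proj_simps(1)[OF ideal, of f] by (auto simp: graded_hom_def aug_def)

lemma aug_add: "aug (f + g) = aug f \<oplus>\<^bsub>E 0\<^esub> aug g"
  using \<epsilon>_hom quot_proj_simps(1)[OF ideal] unfolding aug_def quot_proj_simps(2)[OF ideal]
  by (simp add: graded_hom_def)

lemma aug_act: "act' 0 f (aug g) = aug (f * g)"
  using \<epsilon>_hom quot_proj_simps(1)[OF ideal] unfolding aug_def act_def quot_proj_simps(3)[OF ideal]
  by (simp add: graded_hom_def)

lemma aug_comp: "f \<in> poly_component dg k \<Longrightarrow> aug f \<in> \<E> 0 k"
  using \<epsilon>_hom unfolding graded_hom_def aug_def quot_component_def by blast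

lemma aug_eq_iff: "aug f = aug g \<longleftrightarrow> f - g \<in> I"
proof -
  have "inj_on \<epsilon> (carrier (quot_ring I))"
    using res by (simp add: graded_injective_resolution_def)
  then have "aug f = aug g \<longleftrightarrow> quot_proj I f = quot_proj I g"
    unfolding aug_def using quot_proj_simps(1)[OF ideal] by (auto dest: inj_onD)
  then show ?thesis by (simp add: quot_proj_eq_iff[OF ideal])
qed

lemma aug_0 [simp]: "aug 0 = \<zero>\<^bsub>E 0\<^esub>"
  using aug_act[of 0 0] by simp

lemma aug_zero_iff: "aug f = \<zero>\<^bsub>E 0\<^esub> \<longleftrightarrow> f \<in> I"
  using aug_eq_iff[of f 0] by simp

lemma aug_diff: "aug (f - g) = aug f \<ominus>\<^bsub>E 0\<^esub> aug g"
  using aug_add[of f "- g"] aug_act[of "- 1" g] by (simp add: a_minus_def E.act_uminus)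

lemma aug_sum: "finite F \<Longrightarrow> aug (sum g F) = finsum (E 0) (\<lambda>k. aug (g k)) F"
proof (induction F rule: finite_induct)
  case (insert k F)
  then show ?case by (simp add: aug_add E.finsum_insert)
qed simp

lemma aug_cmp: "graded_quot_module.cmp (E 0) (\<E> 0) (aug f) n = aug (hom_comp dg n f)"
proof -
  let ?K = "insert n (hom_degrees dg f)"
  have "aug f = finsum (E 0) (\<lambda>k. aug (hom_comp dg k f)) ?K"
    by (subst sum_hom_comp[of ?K dg f]) (auto intro: aug_sum)
  then show ?thesis
    using E.cmp_sum[of ?K "\<lambda>k. aug (hom_comp dg k f)" 0 n] aug_comp[OF hom_comp_in[of dg _ f]] by simp
qed

lemma aug_image: "aug ` UNIV = {x \<in> carrier (E 0). \<delta> 0 x = \<zero>\<^bsub>E (Suc 0)\<^esub>}"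
proof -
  have "aug ` UNIV = \<epsilon> ` carrier (regular_module (quot_ring I))"
    by (auto simp: aug_def quot_ring_carrier)
  also have "\<dots> = {x \<in> carrier (E 0). \<delta> 0 x = \<zero>\<^bsub>E (Suc 0)\<^esub>}"
    using res by (simp add: graded_injective_resolution_def)
  finally show ?thesis .
qed

lemma aug_hom_image:
  assumes "x \<in> \<E> 0 n" "\<delta> 0 x = \<zero>\<^bsub>E (Suc 0)\<^esub>"
  shows "\<exists>f\<in>poly_component dg n. x = aug f"
proof -
  have "x \<in> aug ` UNIV" unfolding aug_image using assms E.comp_carrier by blast
  then obtain f where f: "x = aug f" by blast
  have "x = aug (hom_comp dg n f)"
    using aug_cmp[of f n] E.cmp_homogeneous[OF assms(1), of n] f by simp
  then show ?thesis using hom_comp_in by blast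
qed

text \<open>Graded injectivity is only tested on the homogeneous ideals of \<open>R\<close>, embedded into \<open>E 0\<close> by
  the augmentation, and on \<open>E 0\<close> itself; these modules live in the type \<open>'e\<close> whatever it is.\<close>

lemma extend_from_ideal:
  assumes J: "ideal_of UNIV J" and J_hom: "\<And>k f. f \<in> J \<Longrightarrow> hom_comp dg k f \<in> J"
    and \<phi>: "\<And>f g. f \<in> J \<Longrightarrow> g \<in> J \<Longrightarrow> \<phi> (f + g) = \<phi> f \<oplus>\<^bsub>E j\<^esub> \<phi> g"
      "\<And>f g. f \<in> J \<Longrightarrow> \<phi> (g * f) = act' j g (\<phi> f)"
      "\<And>f g. f \<in> J \<Longrightarrow> g \<in> J \<Longrightarrow> f - g \<in> I \<Longrightarrow> \<phi> f = \<phi> g"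
      "\<And>f k. f \<in> J \<Longrightarrow> f \<in> poly_component dg k \<Longrightarrow> \<phi> f \<in> \<E> j (k + s)"
      "\<And>f. f \<in> J \<Longrightarrow> \<phi> f \<in> carrier (E j)"
  shows "\<exists>y\<in>\<E> j s. \<forall>f\<in>J. act' j f y = \<phi> f"
proof -
  let ?H = "aug ` J"
  \<comment> \<open>Shifting by \<open>s\<close> turns \<phi>, which raises degrees by
    \<open>s\<close>, into a map of degree 0. Updating the carrier of \<open>E 0\<close> by itself
    makes \<open>?N\<close> an instance of the same shift construction.\<close>
  let ?M = "(E 0)\<lparr>carrier := ?H\<rparr>" and ?N = "(E 0)\<lparr>carrier := carrier (E 0)\<rparr>"
  have H: "submodule ?H (quot_ring I) (E 0)"
  proof (rule module.submoduleI[OF E.module])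
    show "\<zero>\<^bsub>E 0\<^esub> \<in> ?H" using ideal_ofD(2)[OF J] aug_0 by (metis image_eqI)
    show "\<ominus>\<^bsub>E 0\<^esub> x \<in> ?H" if "x \<in> ?H" for x
      using that ideal_uminus[OF J] aug_act[of "- 1"] by (auto simp: E.act_uminus)
    show "x \<oplus>\<^bsub>E 0\<^esub> y \<in> ?H" if "x \<in> ?H" "y \<in> ?H" for x y
      using that ideal_ofD(3)[OF J] by (auto simp flip: aug_add)
    show "a \<odot>\<^bsub>E 0\<^esub> x \<in> ?H" if a: "a \<in> carrier (quot_ring I)" and x: "x \<in> ?H" for a x
    proof -
      obtain g f where "a = quot_proj I g" "x = aug f" "f \<in> J"
        using a x by (auto simp: quot_ring_carrier)
      then show ?thesis
        using ideal_ofD(4)[OF J, of g f] aug_act[of g f] by (auto simp: act_def)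
    qed
  qed auto
  have M: "graded_module (quot_ring I) (quot_component dg I) ?M (\<lambda>n. \<E> 0 (n - s) \<inter> ?H)"
    by (rule E.graded_submodule_shift[OF H]) (use J_hom in \<open>auto simp: aug_cmp\<close>)
  have N: "graded_module (quot_ring I) (quot_component dg I) ?N (\<lambda>n. \<E> 0 (n - s) \<inter> carrier (E 0))"
    by (rule E.graded_submodule_shift[OF module.carrier_is_submodule[OF E.module]])
      (metis E.cmp(1) E.comp_carrier)
  \<comment> \<open>Choosing a representative is harmless: \<open>aug f = aug g\<close> means f - g
    \<in> I, and \<phi> then takes the same value at both.\<close>
  define \<psi> where "\<psi> v = \<phi> (SOME f. f \<in> J \<and> v = aug f)" for v
  have \<psi>: "\<psi> (aug f) = \<phi> f" if f: "f \<in> J" for f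
  proof -
    let ?g = "SOME g. g \<in> J \<and> aug f = aug g"
    have "?g \<in> J \<and> aug f = aug ?g" by (rule someI[of _ f]) (use f in simp)
    then show ?thesis
      unfolding \<psi>_def using \<phi>(3)[OF f, of ?g] by (simp add: aug_eq_iff)
  qed
  have incl: "(\<lambda>x. x) \<in> graded_hom (quot_ring I) ?M (\<lambda>n. \<E> 0 (n - s) \<inter> ?H) ?N (\<lambda>n. \<E> 0 (n - s) \<inter> carrier (E 0))"
    by (auto simp: graded_hom_def)
  have "\<psi> \<in> graded_hom (quot_ring I) ?M (\<lambda>n. \<E> 0 (n - s) \<inter> ?H) (E j) (\<E> j)"
    unfolding graded_hom_def
  proof (intro CollectI conjI ballI allI)
    show "\<psi> \<in> carrier ?M \<rightarrow> carrier (E j)" using \<phi>(5) by (auto simp: \<psi>)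
    show "\<psi> (x \<oplus>\<^bsub>?M\<^esub> y) = \<psi> x \<oplus>\<^bsub>E j\<^esub> \<psi> y" if "x \<in> carrier ?M" "y \<in> carrier ?M" for x y
      using that \<phi>(1) \<psi> ideal_ofD(3)[OF J] by (auto simp flip: aug_add)
    show "\<psi> (a \<odot>\<^bsub>?M\<^esub> x) = a \<odot>\<^bsub>E j\<^esub> \<psi> x" if a: "a \<in> carrier (quot_ring I)" and x: "x \<in> carrier ?M" for a x
    proof -
      obtain g f where "a = quot_proj I g" "x = aug f" "f \<in> J"
        using a x by (auto simp: quot_ring_carrier)
      then show ?thesis
        using ideal_ofD(4)[OF J, of g f] aug_act[of g f] \<psi> \<phi>(2) by (auto simp: act_def)
    qed
    show "\<psi> ` (\<E> 0 (n - s) \<inter> ?H) \<subseteq> \<E> j n" for n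
    proof clarify
      fix f assume f: "aug f \<in> \<E> 0 (n - s)" "f \<in> J"
      have "aug f = aug (hom_comp dg (n - s) f)"
        using aug_cmp[of f "n - s"] E.cmp_homogeneous[OF f(1), of "n - s"] by simp
      then show "\<psi> (aug f) \<in> \<E> j n"
        using \<psi>[OF J_hom[OF f(2), of "n - s"]] \<phi>(4)[OF J_hom[OF f(2), of "n - s"] hom_comp_in] by simp
    qed
  qed
  then have "\<exists>g\<in>graded_hom (quot_ring I) ?N (\<lambda>n. \<E> 0 (n - s) \<inter> carrier (E 0)) (E j) (\<E> j).
      \<forall>x\<in>carrier ?M. g x = \<psi> x"
    using graded_injectiveD[OF injective M N incl] by simp
  then obtain g where g: "g \<in> graded_hom (quot_ring I) ?N (\<lambda>n. \<E> 0 (n - s) \<inter> carrier (E 0)) (E j) (\<E> j)"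
    "\<And>f. f \<in> J \<Longrightarrow> g (aug f) = \<phi> f"
    using \<psi> by auto
  \<comment> \<open>A homomorphism on R is determined by its value at 1, which has degree
    \<open>s\<close> after the shift; this value is the element sought.\<close>
  have "aug 1 \<in> \<E> 0 (s - s) \<inter> carrier (E 0)" using aug_comp[OF one_component] by simp
  then have "g (aug 1) \<in> \<E> j s" using g(1) unfolding graded_hom_def by blast
  moreover have "act' j f (g (aug 1)) = \<phi> f" if "f \<in> J" for f
  proof -
    have "act' j f (g (aug 1)) = g (act' 0 f (aug 1))"
      using g(1) quot_proj_simps(1)[OF ideal, of f] by (simp add: graded_hom_def act_def)
    then show ?thesis using g(2)[OF that] by (simp add: aug_act)
  qed
  ultimately show ?thesis by blast
qed

section \<open>Torsion in the resolution\<close>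

text \<open>The degree \<open>n\<close> part of the torsion for the ideal generated by U_i with i in
  \<open>T\<close>, tested on these generators. For all indices, \<open>torsion_iff\<close>
  reconciles this with powers of the ideal.\<close>

definition tors :: "nat \<Rightarrow> 'n set \<Rightarrow> int \<Rightarrow> 'e set" where
  "tors j T n = {x \<in> \<E> j n. \<forall>i\<in>T. \<exists>m. act' j (indet i ^ m) x = \<zero>\<^bsub>E j\<^esub>}"

lemma tors_comp: "x \<in> tors j T n \<Longrightarrow> x \<in> \<E> j n"
  by (simp add: tors_def)

lemma tors_carrier [simp, intro]: "x \<in> tors j T n \<Longrightarrow> x \<in> carrier (E j)"
  by (auto simp: tors_def)

lemma tors_zero [simp]: "\<zero>\<^bsub>E j\<^esub> \<in> tors j T n"
  by (simp add: tors_def)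

lemma tors_empty [simp]: "tors j {} n = \<E> j n"
  by (simp add: tors_def)

lemma tors_mono: "T \<subseteq> T' \<Longrightarrow> tors j T' n \<subseteq> tors j T n"
  by (auto simp: tors_def)

lemma tors_insertI: "x \<in> tors j T n \<Longrightarrow> act' j (indet i ^ m) x = \<zero>\<^bsub>E j\<^esub> \<Longrightarrow> x \<in> tors j (insert i T) n"
  by (auto simp: tors_def)

lemma tors_add:
  assumes "x \<in> tors j T n" "y \<in> tors j T n"
  shows "x \<oplus>\<^bsub>E j\<^esub> y \<in> tors j T n"
proof -
  have "\<exists>m. act' j (indet i ^ m) (x \<oplus>\<^bsub>E j\<^esub> y) = \<zero>\<^bsub>E j\<^esub>" if i: "i \<in> T" for i
  proof -
    obtain k where k: "act' j (indet i ^ k) x = \<zero>\<^bsub>E j\<^esub>"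
      using assms(1) i unfolding tors_def by blast
    obtain l where l: "act' j (indet i ^ l) y = \<zero>\<^bsub>E j\<^esub>"
      using assms(2) i unfolding tors_def by blast
    have "act' j (indet i ^ max k l) x = \<zero>\<^bsub>E j\<^esub>"
      by (rule E.act_power_zero_mono[OF tors_carrier[OF assms(1)] k]) simp
    moreover have "act' j (indet i ^ max k l) y = \<zero>\<^bsub>E j\<^esub>"
      by (rule E.act_power_zero_mono[OF tors_carrier[OF assms(2)] l]) simp
    ultimately have "act' j (indet i ^ max k l) (x \<oplus>\<^bsub>E j\<^esub> y) = \<zero>\<^bsub>E j\<^esub>"
      using E.act_add[OF tors_carrier[OF assms(1)] tors_carrier[OF assms(2)]] by simp
    then show ?thesis by blast
  qed
  then show ?thesis
    using E.comp_add[OF tors_comp[OF assms(1)] tors_comp[OF assms(2)]] by (simp add: tors_def)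
qed

lemma tors_act:
  assumes "x \<in> tors j T n" "f \<in> poly_component dg k"
  shows "act' j f x \<in> tors j T (n + k)"
proof -
  have "\<exists>m. act' j (indet i ^ m) (act' j f x) = \<zero>\<^bsub>E j\<^esub>" if i: "i \<in> T" for i
  proof -
    obtain m where m: "act' j (indet i ^ m) x = \<zero>\<^bsub>E j\<^esub>"
      using assms(1) i unfolding tors_def by blast
    show ?thesis
      using m E.act_commute[OF tors_carrier[OF assms(1)], of "indet i ^ m" f] by (intro exI[of _ m]) simp
  qed
  then show ?thesis
    using E.comp_act[OF assms(2) tors_comp[OF assms(1)]] by (simp add: tors_def add.commute)
qed

lemma tors_diff:
  assumes "x \<in> tors j T n" "y \<in> tors j T n"
  shows "x \<ominus>\<^bsub>E j\<^esub> y \<in> tors j T n"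
proof -
  have "\<ominus>\<^bsub>E j\<^esub> y = act' j (- 1) y" using assms by (simp add: E.act_uminus)
  then have "\<ominus>\<^bsub>E j\<^esub> y \<in> tors j T n"
    using tors_act[OF assms(2) poly_component_uminus[OF one_component]] by simp
  then show ?thesis
    using tors_add[OF assms(1)] by (simp add: a_minus_def)
qed

lemma tors_\<delta>:
  assumes "x \<in> tors j T n"
  shows "\<delta> j x \<in> tors (Suc j) T n"
proof -
  have "act' (Suc j) f (\<delta> j x) = \<zero>\<^bsub>E (Suc j)\<^esub>" if "act' j f x = \<zero>\<^bsub>E j\<^esub>" for f
    using that \<delta>_act[of x j f] assms by simp
  then show ?thesis using assms unfolding tors_def by (auto simp: \<delta>_comp) blast
qed

lemma tors_power:
  assumes "x \<in> tors j T n"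
  shows "\<exists>m. \<forall>i\<in>T. act' j (indet i ^ m) x = \<zero>\<^bsub>E j\<^esub>"
proof -
  obtain m where m: "\<And>i. i \<in> T \<Longrightarrow> act' j (indet i ^ m i) x = \<zero>\<^bsub>E j\<^esub>"
    using assms unfolding tors_def by (auto simp: bchoice_iff)
  have "act' j (indet i ^ Max (m ` T)) x = \<zero>\<^bsub>E j\<^esub>" if "i \<in> T" for i
    using that assms by (intro E.act_power_zero_mono[OF _ m[OF that]]) (auto intro!: Max_ge)
  then show ?thesis by blast
qed

text \<open>Division by \<open>U\<^sub>i\<close> up to \<open>U\<^sub>i\<close>-torsion, inside the \<open>T\<close>-torsion: with \<open>\<bb> = (U\<^sub>j\<^sup>m : j \<in> T)\<close>
  annihilating \<open>x\<close> and \<open>(\<bb> : U\<^sub>i\<^bsup>a+t\<^esup>) = (\<bb> : U\<^sub>i\<^sup>a)\<close>, the assignment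
  \<open>r U\<^sub>i\<^bsup>a+t\<^esup> + c \<mapsto> r U\<^sub>i\<^sup>a x\<close> is well defined on the ideal \<open>(U\<^sub>i\<^bsup>a+t\<^esup>) + \<bb>\<close>.\<close>

lemma divide:
  assumes x: "x \<in> tors j T n"
  obtains a y where "y \<in> tors j T (n - int t * int (dg i))"
    "act' j (indet i ^ (a + t)) y = act' j (indet i ^ a) x"
proof -
  obtain m where m: "\<And>l. l \<in> T \<Longrightarrow> act' j (indet l ^ m) x = \<zero>\<^bsub>E j\<^esub>" using tors_power[OF x] by blast
  let ?b = "power_ideal T (\<lambda>_. m) I" and ?u = "indet i :: ('n, 'a) mpoly"
  note b = ideal_power_ideal[OF ideal, of T "\<lambda>_. m"]
  note xc = tors_carrier[OF x]
  obtain a where a: "\<And>r. ?u ^ (a + t) * r \<in> ?b \<Longrightarrow> ?u ^ a * r \<in> ?b"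
    using power_ideal_stable[OF acc ideal] by metis
  have kill: "act' j f x = \<zero>\<^bsub>E j\<^esub>" if f: "f \<in> ?b" for f
  proof -
    have ann: "ideal_of UNIV {f. act' j f x = \<zero>\<^bsub>E j\<^esub>}" by (rule E.ideal_annihilator[OF xc])
    obtain c q where q: "q \<in> I" "f = (\<Sum>i\<in>T. c i * indet i ^ m) + q"
      using f unfolding power_ideal_def by blast
    have "(\<Sum>i\<in>T. c i * indet i ^ m) \<in> {f. act' j f x = \<zero>\<^bsub>E j\<^esub>}"
      by (rule ideal_sum[OF ann]) (use ideal_ofD(4)[OF ann UNIV_I] m in blast)
    then show ?thesis
      using ideal_ofD(3)[OF ann, of _ q] E.act_ideal[OF q(1) xc] q(2) by blast
  qed
  define J where "J = {f. \<exists>r. f - ?u ^ (a + t) * r \<in> ?b}"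
  define \<phi> where "\<phi> f = act' j (?u ^ a * (SOME r. f - ?u ^ (a + t) * r \<in> ?b)) x" for f
  \<comment> \<open>Two choices of \<open>r\<close> differ by an element whose product with
    U_i^(a+t) is in \<open>?b\<close>. By the choice of \<open>a\<close> its product with U_i^a is
    in \<open>?b\<close> as well, and \<open>?b\<close> kills \<open>x\<close>.\<close>
  have \<phi>: "\<phi> f = act' j (?u ^ a * r) x" if r: "f - ?u ^ (a + t) * r \<in> ?b" for f r
  proof -
    let ?r = "SOME r. f - ?u ^ (a + t) * r \<in> ?b"
    have "f - ?u ^ (a + t) * ?r \<in> ?b" by (rule someI[of _ r]) (rule r)
    then have "?u ^ (a + t) * (r - ?r) \<in> ?b"
      using ideal_diff[OF b _ r] by (fastforce simp: algebra_simps)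
    then have "act' j (?u ^ a * (r - ?r)) x = \<zero>\<^bsub>E j\<^esub>" using a kill by blast
    then show ?thesis
      using xc by (simp add: \<phi>_def right_diff_distrib E.act_diff_left E.diff_eq_zero_iff)
  qed
  have J: "ideal_of UNIV J"
    unfolding ideal_of_def
  proof (intro conjI ballI)
    show "0 \<in> J" unfolding J_def mem_Collect_eq
      by (rule exI[of _ 0]) (simp add: ideal_ofD(2)[OF b])
    fix f assume "f \<in> J"
    then obtain r where r: "f - ?u ^ (a + t) * r \<in> ?b" by (auto simp: J_def)
    show "f + g \<in> J" if g: "g \<in> J" for g
    proof -
      obtain r' where "g - ?u ^ (a + t) * r' \<in> ?b" using g by (auto simp: J_def)
      then have "f + g - ?u ^ (a + t) * (r + r') \<in> ?b"
        using ideal_ofD(3)[OF b r] by (fastforce simp: algebra_simps)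
      then show ?thesis unfolding J_def by blast
    qed
    show "g * f \<in> J" for g
    proof -
      have "g * f - ?u ^ (a + t) * (g * r) \<in> ?b"
        using ideal_ofD(4)[OF b UNIV_I r, of g] by (simp add: algebra_simps)
      then show ?thesis unfolding J_def by blast
    qed
  qed simp
  \<comment> \<open>A homogeneous \<open>f\<close> admits a homogeneous \<open>r\<close>, which puts
    \<open>\<phi> f\<close> into the right degree.\<close>
  have hom: "hom_comp dg k f - ?u ^ (a + t) * hom_comp dg (k - int (a + t) * int (dg i)) r \<in> ?b"
    if "f - ?u ^ (a + t) * r \<in> ?b" for f k r
  proof -
    have "hom_comp dg k f = hom_comp dg k (f - r * ?u ^ (a + t)) + hom_comp dg k (r * ?u ^ (a + t))"
      by (simp flip: hom_comp_add)
    also have "hom_comp dg k (r * ?u ^ (a + t)) = hom_comp dg (k - int (a + t) * int (dg i)) r * ?u ^ (a + t)"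
      by (rule hom_comp_mult[OF indet_power_component])
    finally show ?thesis
      using power_ideal_hom_comp[of I dg "f - r * ?u ^ (a + t)", OF hom_ideal] that
      by (simp add: mult.commute)
  qed
  have "\<exists>y\<in>\<E> j (n - int t * int (dg i)). \<forall>f\<in>J. act' j f y = \<phi> f"
  proof (rule extend_from_ideal[OF J])
    show "hom_comp dg k f \<in> J" if "f \<in> J" for k f
      using that hom unfolding J_def by blast
    show "\<phi> (f + g) = \<phi> f \<oplus>\<^bsub>E j\<^esub> \<phi> g" if fg: "f \<in> J" "g \<in> J" for f g
    proof -
      obtain r r' where r: "f - ?u ^ (a + t) * r \<in> ?b" "g - ?u ^ (a + t) * r' \<in> ?b"
        using fg by (auto simp: J_def)
      have "f + g - ?u ^ (a + t) * (r + r') \<in> ?b"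
        using ideal_ofD(3)[OF b r] by (simp add: algebra_simps)
      then have "\<phi> (f + g) = act' j (?u ^ a * (r + r')) x" by (rule \<phi>)
      then show ?thesis
        using \<phi>[OF r(1)] \<phi>[OF r(2)] xc by (simp add: distrib_left E.act_add_left)
    qed
    show "\<phi> (g * f) = act' j g (\<phi> f)" if f: "f \<in> J" for f g
    proof -
      obtain r where r: "f - ?u ^ (a + t) * r \<in> ?b" using f by (auto simp: J_def)
      have "g * f - ?u ^ (a + t) * (g * r) \<in> ?b"
        using ideal_ofD(4)[OF b UNIV_I r, of g] by (simp add: algebra_simps)
      then have "\<phi> (g * f) = act' j (?u ^ a * (g * r)) x" by (rule \<phi>)
      then have "\<phi> (g * f) = act' j (g * (?u ^ a * r)) x" by (simp add: mult.left_commute)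
      then show ?thesis using xc r by (simp add: \<phi> E.act_mult)
    qed
    show "\<phi> f = \<phi> g" if fg: "f \<in> J" "g \<in> J" "f - g \<in> I" for f g
    proof -
      obtain r where r: "g - ?u ^ (a + t) * r \<in> ?b" using fg by (auto simp: J_def)
      have "f - ?u ^ (a + t) * r \<in> ?b"
        using ideal_ofD(3)[OF b power_ideal_base[OF fg(3)] r] by (simp add: algebra_simps)
      then show ?thesis using r by (simp add: \<phi>)
    qed
    show "\<phi> f \<in> \<E> j (k + (n - int t * int (dg i)))" if f: "f \<in> J" "f \<in> poly_component dg k" for f k
    proof -
      obtain r where r: "f - ?u ^ (a + t) * r \<in> ?b" using f by (auto simp: J_def)
      let ?r = "hom_comp dg (k - int (a + t) * int (dg i)) r"
      have "f - ?u ^ (a + t) * ?r \<in> ?b" using hom[OF r, of k] hom_comp_component[OF f(2), of k] by simp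
      then have "\<phi> f = act' j (?u ^ a * ?r) x" by (rule \<phi>)
      moreover have "?u ^ a * ?r \<in> poly_component dg (int a * int (dg i) + (k - int (a + t) * int (dg i)))"
        by (intro poly_component_mult indet_power_component hom_comp_in)
      ultimately show ?thesis
        using E.comp_act[OF _ tors_comp[OF x]] by (fastforce simp: algebra_simps)
    qed
    show "\<phi> f \<in> carrier (E j)" for f unfolding \<phi>_def using xc by blast
  qed
  then obtain y where y: "y \<in> \<E> j (n - int t * int (dg i))" "\<And>f. f \<in> J \<Longrightarrow> act' j f y = \<phi> f"
    by blast
  have u: "?u ^ (a + t) - ?u ^ (a + t) * 1 \<in> ?b" using ideal_ofD(2)[OF b] by simp
  then have "?u ^ (a + t) \<in> J" unfolding J_def by blast
  then have "act' j (?u ^ (a + t)) y = act' j (?u ^ a) x"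
    using y(2) \<phi>[OF u] by simp
  \<comment> \<open>\<phi> vanishes on \<open>?b\<close> (take r = 0), so \<open>y\<close> is killed
    by the same powers as \<open>x\<close> and stays in the \<open>T\<close>-torsion.\<close>
  moreover have "act' j (indet l ^ m) y = \<zero>\<^bsub>E j\<^esub>" if l: "l \<in> T" for l
  proof -
    have "1 * indet l ^ m \<in> ?b"
      by (rule indet_power_in_power_ideal[OF ideal]) (use l in auto)
    then have l: "indet l ^ m - ?u ^ (a + t) * 0 \<in> ?b" by simp
    then have "indet l ^ m \<in> J" unfolding J_def by blast
    then show ?thesis using y(2) \<phi>[OF l] xc by simp
  qed
  ultimately show ?thesis
    using y(1) by (intro that[of y a]) (auto simp: tors_def)
qed

end

section \<open>Top local cohomology by fractions\<close>

context graded_resolution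
begin

lemma act_pow: "x \<in> carrier (E j) \<Longrightarrow> act' j (u ^ k) (act' j (u ^ l) x) = act' j (u ^ (k + l)) x"
  by (simp add: power_add E.act_mult)

lemma divide_ex:
  assumes "x \<in> tors j T (n + int t * int (dg i))"
  shows "\<exists>a. \<exists>y\<in>tors j T n. act' j (indet i ^ (a + t)) y = act' j (indet i ^ a) x"
  using divide[OF assms, of t i] by (metis add_diff_cancel_right')

text \<open>Brings two equations between fractions to a common clearing exponent.\<close>

lemma act_pow_raise:
  assumes "act' j (u ^ (a + t)) y = act' j (u ^ a) z" "y \<in> carrier (E j)" "z \<in> carrier (E j)" "a \<le> b"
  shows "act' j (u ^ (b + t)) y = act' j (u ^ b) z"
proof -
  have "act' j (u ^ (b + t)) y = act' j (u ^ (b - a)) (act' j (u ^ (a + t)) y)"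
    using assms(2,4) by (simp add: act_pow)
  also have "\<dots> = act' j (u ^ b) z"
    unfolding assms(1) using assms(3,4) by (simp add: act_pow)
  finally show ?thesis .
qed

text \<open>For \<open>is = [i\<^sub>1, \<dots>, i\<^sub>k]\<close> and \<open>T = set is\<close>, \<open>rep is t n r z\<close> says that the cocycle \<open>z\<close> of degree \<open>n\<close>
  represents the fraction \<open>r / \<Prod>\<^sub>i U\<^sub>i\<^bsup>t i\<^esup>\<close> in the \<open>k\<close>-th cohomology of the \<open>T\<close>-torsion of \<open>E\<close>.
  It is the image under the connecting map
  \<open>H\<^sup>k(\<Gamma>\<^sub>T(E))\<^bsub>U\<^sub>i\<^esub> \<rightarrow> H\<^bsup>k+1\<^esup>(\<Gamma>\<^bsub>T \<union> {i}\<^esub>(E))\<close> of the sequence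
  \<open>0 \<rightarrow> \<Gamma>\<^bsub>T \<union> {i}\<^esub>(E) \<rightarrow> \<Gamma>\<^sub>T(E) \<rightarrow> \<Gamma>\<^sub>T(E)\<^bsub>U\<^sub>i\<^esub> \<rightarrow> 0\<close>: lift \<open>z / U\<^sub>i\<^bsup>t i\<^esup>\<close> to \<open>y\<close> and apply \<open>\<delta>\<close>.\<close>

primrec rep :: "'n list \<Rightarrow> ('n \<Rightarrow> nat) \<Rightarrow> int \<Rightarrow> ('n, 'a) mpoly \<Rightarrow> 'e \<Rightarrow> bool" where
  "rep [] t n r z \<longleftrightarrow> r \<in> poly_component dg n \<and> z = aug r"
| "rep (i # is) t n r w \<longleftrightarrow> (\<exists>z y a. rep is t (n + int (t i) * int (dg i)) r z \<and>
     y \<in> tors (length is) (set is) n \<and>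
     act' (length is) (indet i ^ (a + t i)) y = act' (length is) (indet i ^ a) z \<and>
     w = \<delta> (length is) y)"

text \<open>The degree of the denominator: numerators of fractions of degree \<open>n\<close> have
  degree \<open>n + wsum is t\<close>.\<close>

definition wsum :: "'n list \<Rightarrow> ('n \<Rightarrow> nat) \<Rightarrow> int" where
  "wsum is t = (\<Sum>i\<leftarrow>is. int (t i) * int (dg i))"

lemma wsum_simps [simp]: "wsum [] t = 0" "wsum (i # is) t = int (t i) * int (dg i) + wsum is t"
  by (simp_all add: wsum_def)

text \<open>U_i^(a + t i) turns the lift \<open>y\<close> into a multiple of the cocycle below it,
  hence kills \<open>\<delta> y\<close>.\<close>

lemma rep_cocycle:
  assumes "rep is t n r z"
  shows "z \<in> tors (length is) (set is) n \<and> \<delta> (length is) z = \<zero>\<^bsub>E (Suc (length is))\<^esub>"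
  using assms
proof (induction "is" arbitrary: n z)
  case Nil
  then have "z \<in> aug ` UNIV" by simp
  then show ?case using Nil unfolding aug_image by (auto simp: aug_comp)
next
  case (Cons i "is")
  let ?k = "length is"
  obtain z' y a where *: "rep is t (n + int (t i) * int (dg i)) r z'" "y \<in> tors ?k (set is) n"
    "act' ?k (indet i ^ (a + t i)) y = act' ?k (indet i ^ a) z'" "z = \<delta> ?k y"
    using Cons.prems by auto
  have z': "z' \<in> carrier (E ?k)" "\<delta> ?k z' = \<zero>\<^bsub>E (Suc ?k)\<^esub>" using Cons.IH[OF *(1)] by auto
  have y: "y \<in> carrier (E ?k)" using *(2) by (rule tors_carrier)
  have "act' (Suc ?k) (indet i ^ (a + t i)) z = \<delta> ?k (act' ?k (indet i ^ (a + t i)) y)"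
    unfolding *(4) by (rule \<delta>_act[OF y, symmetric])
  also have "\<dots> = \<zero>\<^bsub>E (Suc ?k)\<^esub>" unfolding *(3) \<delta>_act[OF z'(1)] z'(2) by simp
  finally have "z \<in> tors (Suc ?k) (set (i # is)) n"
    using tors_insertI[OF tors_\<delta>[OF *(2)]] *(4) by simp
  then show ?case using y *(4) by simp
qed

lemma rep_carrier: "rep is t n r z \<Longrightarrow> z \<in> carrier (E (length is))"
  using rep_cocycle tors_carrier by blast

lemma rep_component: "rep is t n r z \<Longrightarrow> r \<in> poly_component dg (n + wsum is t)"
proof (induction "is" arbitrary: n z)
  case (Cons i "is")
  then obtain v where "rep is t (n + int (t i) * int (dg i)) r v" by auto
  from Cons.IH[OF this] show ?case by (simp add: add.assoc)
qed simp

lemma rep_total: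
  assumes "r \<in> poly_component dg (n + wsum is t)"
  shows "\<exists>z. rep is t n r z"
  using assms
proof (induction "is" arbitrary: n)
  case (Cons i "is")
  obtain z where z: "rep is t (n + int (t i) * int (dg i)) r z"
    using Cons.IH[of "n + int (t i) * int (dg i)"] Cons.prems by (auto simp: add.assoc)
  then have "z \<in> tors (length is) (set is) (n + int (t i) * int (dg i))" using rep_cocycle by blast
  then obtain a y where "y \<in> tors (length is) (set is) n"
    "act' (length is) (indet i ^ (a + t i)) y = act' (length is) (indet i ^ a) z"
    using divide_ex by blast
  then show ?case using z by auto
next
  case Nil
  then show ?case by (intro exI[of _ "aug r"]) simp
qed

lemma rep_diff:
  assumes "rep is t n r z" "rep is t n r' z'"
  shows "rep is t n (r - r') (z \<ominus>\<^bsub>E (length is)\<^esub> z')"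
  using assms
proof (induction "is" arbitrary: n z z')
  case Nil
  then show ?case by (simp add: poly_component_diff aug_diff)
next
  case (Cons i "is")
  let ?k = "length is" and ?N = "n + int (t i) * int (dg i)"
  obtain v y a where *: "rep is t ?N r v" "y \<in> tors ?k (set is) n"
    "act' ?k (indet i ^ (a + t i)) y = act' ?k (indet i ^ a) v" "z = \<delta> ?k y"
    using Cons.prems by auto
  obtain v' y' a' where **: "rep is t ?N r' v'" "y' \<in> tors ?k (set is) n"
    "act' ?k (indet i ^ (a' + t i)) y' = act' ?k (indet i ^ a') v'" "z' = \<delta> ?k y'"
    using Cons.prems by auto
  note car = rep_carrier[OF *(1)] rep_carrier[OF **(1)] tors_carrier[OF *(2)] tors_carrier[OF **(2)]
  have "act' ?k (indet i ^ (max a a' + t i)) (y \<ominus>\<^bsub>E ?k\<^esub> y') = act' ?k (indet i ^ max a a') (v \<ominus>\<^bsub>E ?k\<^esub> v')"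
    using act_pow_raise[OF *(3) car(3,1), of "max a a'"] act_pow_raise[OF **(3) car(4,2), of "max a a'"] car
    by (simp add: E.act_diff)
  moreover have "z \<ominus>\<^bsub>E (Suc ?k)\<^esub> z' = \<delta> ?k (y \<ominus>\<^bsub>E ?k\<^esub> y')"
    using *(4) **(4) car by (simp add: \<delta>_diff)
  ultimately show ?case
    using Cons.IH[OF *(1) **(1)] tors_diff[OF *(2) **(2)] by (auto intro!: exI)
qed

lemma rep_act:
  assumes "rep is t n r z" "f \<in> poly_component dg d"
  shows "rep is t (n + d) (f * r) (act' (length is) f z)"
  using assms(1)
proof (induction "is" arbitrary: n z)
  case Nil
  then show ?case using poly_component_mult[OF assms(2), of r n] by (simp add: aug_act add.commute)
next
  case (Cons i "is")
  let ?k = "length is" and ?N = "n + int (t i) * int (dg i)"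
  obtain v y a where *: "rep is t ?N r v" "y \<in> tors ?k (set is) n"
    "act' ?k (indet i ^ (a + t i)) y = act' ?k (indet i ^ a) v" "z = \<delta> ?k y"
    using Cons.prems by auto
  note car = rep_carrier[OF *(1)] tors_carrier[OF *(2)]
  have "act' ?k (indet i ^ (a + t i)) (act' ?k f y) = act' ?k f (act' ?k (indet i ^ (a + t i)) y)"
    by (rule E.act_commute[OF car(2)])
  also have "\<dots> = act' ?k (indet i ^ a) (act' ?k f v)" unfolding *(3) by (rule E.act_commute[OF car(1)])
  finally have "act' ?k (indet i ^ (a + t i)) (act' ?k f y) = act' ?k (indet i ^ a) (act' ?k f v)" .
  moreover have "act' (Suc ?k) f z = \<delta> ?k (act' ?k f y)" using *(4) car by (simp add: \<delta>_act)
  moreover have "rep is t (n + d + int (t i) * int (dg i)) (f * r) (act' ?k f v)"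
    using Cons.IH[OF *(1)] by (simp add: algebra_simps)
  ultimately show ?case
    using tors_act[OF *(2) assms(2)] by (auto intro!: exI)
qed

lemma rep_cong: "(\<And>i. i \<in> set is \<Longrightarrow> t i = t' i) \<Longrightarrow> rep is t n r z \<longleftrightarrow> rep is t' n r z"
  by (induction "is" arbitrary: n z) auto

text \<open>Expanding a fraction does not change the cocycle: a lift of z / U_i^(t i) is also a lift
  of U_i^(q i) z / U_i^(t i + q i).\<close>

lemma rep_shift:
  assumes "rep is t n r z"
  shows "rep is (\<lambda>i. t i + q i) n ((\<Prod>i\<leftarrow>is. indet i ^ q i) * r) z"
  using assms
proof (induction "is" arbitrary: n z)
  case Nil
  then show ?case by simp
next
  case (Cons i "is")
  let ?k = "length is" and ?N = "n + int (t i) * int (dg i)"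
  let ?\<Pi> = "(\<Prod>i\<leftarrow>is. indet i ^ q i) :: ('n, 'a) mpoly"
  obtain v y a where *: "rep is t ?N r v" "y \<in> tors ?k (set is) n"
    "act' ?k (indet i ^ (a + t i)) y = act' ?k (indet i ^ a) v" "z = \<delta> ?k y"
    using Cons.prems by auto
  note car = rep_carrier[OF *(1)] tors_carrier[OF *(2)]
  have "rep is (\<lambda>i. t i + q i) (?N + int (q i) * int (dg i)) (indet i ^ q i * (?\<Pi> * r)) (act' ?k (indet i ^ q i) v)"
    by (rule rep_act[OF Cons.IH[OF *(1)] indet_power_component])
  then have "rep is (\<lambda>i. t i + q i) (n + int (t i + q i) * int (dg i)) (indet i ^ q i * ?\<Pi> * r)
      (act' ?k (indet i ^ q i) v)"
    by (simp add: algebra_simps)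
  moreover have "act' ?k (indet i ^ (a + (t i + q i))) y = act' ?k (indet i ^ a) (act' ?k (indet i ^ q i) v)"
  proof -
    have "act' ?k (indet i ^ (a + q i + t i)) y = act' ?k (indet i ^ (a + q i)) v"
      by (rule act_pow_raise[OF *(3) car(2,1)]) simp
    then show ?thesis using car by (simp add: act_pow ac_simps)
  qed
  ultimately show ?case using *(2,4) by auto
qed

text \<open>Induction gives a cochain \<open>y\<close> bounded by \<open>w\<close> that is torsion
  for the shorter list. If U_i^a kills \<open>w\<close>, then U_i^a y is a cocycle, hence \<delta>
  c; dividing \<open>c\<close> by U_i^a gives \<open>c'\<close>, and y - \<delta> c' is also
  U_i-torsion.\<close>

lemma vanishing:
  assumes "length is < Suc j" "w \<in> tors (Suc j) (set is) n" "\<delta> (Suc j) w = \<zero>\<^bsub>E (Suc (Suc j))\<^esub>"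
  shows "\<exists>y\<in>tors j (set is) n. \<delta> j y = w"
  using assms
proof (induction "is" arbitrary: j w n)
  case Nil
  then show ?case using \<delta>_exact_hom by simp
next
  case (Cons i "is")
  let ?u = "indet i :: ('n, 'a) mpoly"
  obtain l where j: "j = Suc l" "length is < Suc l" using Cons.prems(1) by (cases j) auto
  have w: "w \<in> tors (Suc j) (set is) n" using Cons.prems(2) tors_mono[of "set is" "set (i # is)"] by auto
  obtain y where y: "y \<in> tors j (set is) n" "\<delta> j y = w"
    using Cons.IH[OF _ w Cons.prems(3)] j by auto
  note yc = tors_carrier[OF y(1)]
  obtain a where a: "act' (Suc j) (?u ^ a) w = \<zero>\<^bsub>E (Suc j)\<^esub>"
    using Cons.prems(2) by (auto simp: tors_def)
  have "\<delta> j (act' j (?u ^ a) y) = \<zero>\<^bsub>E (Suc j)\<^esub>" using a y(2) \<delta>_act[OF yc] by simp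
  then obtain c where c: "c \<in> tors l (set is) (n + int a * int (dg i))" "\<delta> l c = act' j (?u ^ a) y"
    using Cons.IH[OF j(2), of "act' j (?u ^ a) y"] tors_act[OF y(1) indet_power_component[of i a dg]] j by auto
  obtain e c' where c': "c' \<in> tors l (set is) n" "act' l (?u ^ (e + a)) c' = act' l (?u ^ e) c"
    using divide_ex[OF c(1)] by blast
  have "act' j (?u ^ (e + a)) (\<delta> l c') = act' j (?u ^ (e + a)) y"
  proof -
    have "act' j (?u ^ (e + a)) (\<delta> l c') = \<delta> l (act' l (?u ^ (e + a)) c')"
      using \<delta>_act[OF tors_carrier[OF c'(1)]] j(1) by simp
    also have "\<dots> = act' j (?u ^ e) (\<delta> l c)"
      unfolding c'(2) using \<delta>_act[OF tors_carrier[OF c(1)]] j(1) by simp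
    finally show ?thesis using c(2) yc by (simp add: act_pow)
  qed
  moreover have d: "\<delta> l c' \<in> tors j (set is) n" using tors_\<delta>[OF c'(1)] j(1) by simp
  ultimately have "act' j (?u ^ (e + a)) (y \<ominus>\<^bsub>E j\<^esub> \<delta> l c') = \<zero>\<^bsub>E j\<^esub>"
    using yc tors_carrier[OF d] by (simp add: E.act_diff E.diff_eq_zero_iff)
  then have "y \<ominus>\<^bsub>E j\<^esub> \<delta> l c' \<in> tors j (set (i # is)) n"
    using tors_insertI[OF tors_diff[OF y(1) d]] by simp
  moreover have "\<delta> j (y \<ominus>\<^bsub>E j\<^esub> \<delta> l c') = w"
    using y(2) yc tors_carrier[OF d] \<delta>_\<delta>[of c' l] tors_carrier[OF c'(1)] tors_carrier[OF w] j(1)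
    by (simp add: \<delta>_diff) (simp add: a_minus_def)
  ultimately show ?case by blast
qed

text \<open>By \<open>vanishing\<close>, w = \<delta> y for some \<open>y\<close> that is torsion
  for the shorter list. If U_i^a kills \<open>w\<close>, then U_i^a y is a cocycle, so a fraction by
  induction, and \<open>w\<close> is the image of (U_i^a y) / U_i^a.\<close>

lemma rep_surj:
  assumes "distinct is" "w \<in> tors (length is) (set is) n" "\<delta> (length is) w = \<zero>\<^bsub>E (Suc (length is))\<^esub>"
  shows "\<exists>t r. rep is t n r w"
  using assms
proof (induction "is" arbitrary: w n)
  case Nil
  then show ?case using aug_hom_image[of w n] by auto
next
  case (Cons i "is")
  let ?k = "length is" and ?u = "indet i :: ('n, 'a) mpoly"
  have w: "w \<in> tors (Suc ?k) (set is) n" using Cons.prems(2) tors_mono[of "set is" "set (i # is)"] by auto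
  obtain y where y: "y \<in> tors ?k (set is) n" "\<delta> ?k y = w"
    using vanishing[of "is" ?k w n] w Cons.prems(3) by auto
  obtain a where a: "act' (Suc ?k) (?u ^ a) w = \<zero>\<^bsub>E (Suc ?k)\<^esub>"
    using Cons.prems(2) by (auto simp: tors_def)
  have "\<delta> ?k (act' ?k (?u ^ a) y) = \<zero>\<^bsub>E (Suc ?k)\<^esub>"
    using a y(2) \<delta>_act[OF tors_carrier[OF y(1)]] by simp
  then obtain t r where "rep is t (n + int a * int (dg i)) r (act' ?k (?u ^ a) y)"
    using Cons.IH[OF _ tors_act[OF y(1) indet_power_component[of i a dg]]] Cons.prems(1)
    unfolding distinct.simps by blast
  then have "rep is (t(i := a)) (n + int a * int (dg i)) r (act' ?k (?u ^ a) y)"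
    using Cons.prems(1) by (subst rep_cong[of _ _ t]) auto
  \<comment> \<open>\<open>y\<close> lifts this fraction exactly, so the clearing exponent is
    0.\<close>
  moreover have "act' ?k (?u ^ (0 + a)) y = act' ?k (?u ^ 0) (act' ?k (?u ^ a) y)"
    using tors_carrier[OF y(1)] by simp
  ultimately have "rep (i # is) (t(i := a)) n r w"
    unfolding rep.simps using y by (intro exI[of _ "act' ?k (?u ^ a) y"] exI[of _ y] exI[of _ 0]) simp
  then show ?case by blast
qed

section \<open>Fractions that represent coboundaries\<close>

definition bound :: "'n list \<Rightarrow> int \<Rightarrow> 'e set" where
  "bound is n = (case is of [] \<Rightarrow> {\<zero>\<^bsub>E 0\<^esub>} | i # js \<Rightarrow> \<delta> (length js) ` tors (length js) (set is) n)"

lemma bound_tors: "z \<in> bound is n \<Longrightarrow> z \<in> tors (length is) (set is) n"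
  by (cases "is") (auto simp: bound_def intro: tors_\<delta>)

lemma bound_cocycle: "z \<in> bound is n \<Longrightarrow> \<delta> (length is) z = \<zero>\<^bsub>E (Suc (length is))\<^esub>"
  by (cases "is") (auto simp: bound_def)

lemma bound_zero: "\<zero>\<^bsub>E (length is)\<^esub> \<in> bound is n"
proof (cases "is")
  case (Cons i js)
  then show ?thesis
    using image_eqI[of "\<zero>\<^bsub>E (length is)\<^esub>" "\<delta> (length js)" "\<zero>\<^bsub>E (length js)\<^esub>" "tors (length js) (set is) n"]
    by (simp add: bound_def)
qed (simp add: bound_def)

text \<open>Divide a preimage under \<open>\<delta>\<close>, so that the quotient is a coboundary
  again.\<close>

lemma bound_divide:
  assumes "z \<in> bound is n"
  shows "\<exists>e y. y \<in> bound is (n - int q * int (dg i)) \<and>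
     act' (length is) (indet i ^ (e + q)) y = act' (length is) (indet i ^ e) z"
proof (cases "is")
  case Nil
  then show ?thesis using assms by (auto simp: bound_def)
next
  case (Cons l js)
  let ?k = "length js" and ?u = "indet i :: ('n, 'a) mpoly"
  obtain c where c: "c \<in> tors ?k (set is) n" "z = \<delta> ?k c" using assms Cons by (auto simp: bound_def)
  obtain e c' where c': "c' \<in> tors ?k (set is) (n - int q * int (dg i))"
    "act' ?k (?u ^ (e + q)) c' = act' ?k (?u ^ e) c" using divide[OF c(1), of q i] by blast
  have "act' (Suc ?k) (?u ^ (e + q)) (\<delta> ?k c') = act' (Suc ?k) (?u ^ e) z"
    using \<delta>_act[OF tors_carrier[OF c(1)], of "?u ^ e"] \<delta>_act[OF tors_carrier[OF c'(1)], of "?u ^ (e + q)"] c'(2) c(2)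
    by simp
  then show ?thesis using c'(1) Cons by (intro exI[of _ e] exI[of _ "\<delta> ?k c'"]) (simp add: bound_def)
qed

lemma prod_list_distinct: "distinct is \<Longrightarrow> (\<Prod>i\<leftarrow>is. g i) = (\<Prod>i\<in>set is. g i)"
  by (simp add: prod.distinct_set_conv_list)

text \<open>The condition on \<open>r\<close> below says that it vanishes in the direct limit of the modules
  \<open>R / (U\<^sub>i\<^bsup>t i + p\<^esup> : i \<in> T)\<close> for \<open>p \<rightarrow> \<infinity>\<close>, with multiplication by \<open>\<Prod>\<^sub>i U\<^sub>i\<close> as transition maps.\<close>

lemma rep_bound_if:
  assumes "distinct is" "rep is t n r z" "(\<Prod>i\<in>set is. indet i) ^ p * r \<in> power_ideal (set is) (\<lambda>i. t i + p) I"
  shows "z \<in> bound is n"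
  using assms
proof (induction "is" arbitrary: t n r z p)
  case Nil
  then have "r \<in> I" by (simp add: power_ideal_def)
  then show ?case using Nil by (simp add: bound_def aug_zero_iff)
next
  case (Cons i "is")
  let ?k = "length is" and ?u = "indet i :: ('n, 'a) mpoly" and ?U = "(\<Prod>i\<in>set is. indet i) :: ('n, 'a) mpoly"
  let ?d = "int (dg i)" and ?T = "set is"
  let ?N = "n + int (t i) * ?d" and ?\<tau> = "\<lambda>i. t i + p"
  let ?P = "power_ideal ?T ?\<tau> I"
  have i: "i \<notin> ?T" "distinct is" using Cons.prems(1) by auto
  obtain v y a where *: "rep is t ?N r v" "y \<in> tors ?k ?T n"
    "act' ?k (?u ^ (a + t i)) y = act' ?k (?u ^ a) v" "z = \<delta> ?k y"
    using Cons.prems(2) by auto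
  note vc = rep_carrier[OF *(1)] and yc = tors_carrier[OF *(2)]
  have Up: "(\<Prod>i\<leftarrow>is. indet i ^ p) = ?U ^ p"
    using i by (simp add: prod_list_distinct prod_power_distrib)
  \<comment> \<open>Up to powers of the remaining indeterminates, the expanded numerator is a
    multiple of U_i^(t i + p), so the denominator at \<open>i\<close> cancels and leaves
    \<open>s\<close>.\<close>
  obtain s where s: "?u ^ p * (?U ^ p * r) - s * ?u ^ (t i + p) \<in> ?P"
    using Cons.prems(3) i power_ideal_insert[of ?T i "?u ^ p * (?U ^ p * r)" ?\<tau> I]
    by (auto simp: power_mult_distrib mult.assoc)
  have repv: "rep is ?\<tau> (?N + int p * ?d) (?u ^ p * (?U ^ p * r)) (act' ?k (?u ^ p) v)"
    using rep_act[OF rep_shift[OF *(1), of "\<lambda>_. p"] indet_power_component[of i p dg]] by (simp add: Up)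
  define K where "K = ?N + int p * ?d + wsum is ?\<tau>"
  \<comment> \<open>Only homogeneous numerators represent cocycles, so \<open>s\<close> is cut down
    to the degree of the other side.\<close>
  define s' where "s' = hom_comp dg (K - int (t i + p) * ?d) s"
  have "hom_comp dg K (?u ^ p * (?U ^ p * r) - s * ?u ^ (t i + p)) = ?u ^ p * (?U ^ p * r) - s' * ?u ^ (t i + p)"
  proof -
    have "hom_comp dg K (?u ^ p * (?U ^ p * r) - s * ?u ^ (t i + p)) + hom_comp dg K (s * ?u ^ (t i + p))
        = hom_comp dg K (?u ^ p * (?U ^ p * r))"
      by (simp flip: hom_comp_add)
    moreover have "hom_comp dg K (s * ?u ^ (t i + p)) = s' * ?u ^ (t i + p)"
      unfolding s'_def by (rule hom_comp_mult[OF indet_power_component])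
    moreover have "hom_comp dg K (?u ^ p * (?U ^ p * r)) = ?u ^ p * (?U ^ p * r)"
      using hom_comp_component[OF rep_component[OF repv], of K] by (simp add: K_def)
    ultimately show ?thesis by (simp add: algebra_simps)
  qed
  then have s'_mem: "?u ^ p * (?U ^ p * r) - ?u ^ (t i + p) * s' \<in> ?P"
    using power_ideal_hom_comp[of I dg _ ?T ?\<tau> K, OF hom_ideal s] by (simp add: mult.commute)
  have "s' \<in> poly_component dg (n + wsum is ?\<tau>)"
    using hom_comp_in[of dg "K - int (t i + p) * ?d" s] by (simp add: s'_def K_def algebra_simps)
  then obtain z' where z': "rep is ?\<tau> n s' z'" using rep_total by blast
  note z'c = rep_carrier[OF z']
  have "rep is ?\<tau> (n + int (t i + p) * ?d) (?u ^ (t i + p) * s') (act' ?k (?u ^ (t i + p)) z')"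
    by (rule rep_act[OF z' indet_power_component])
  then have "rep is ?\<tau> (?N + int p * ?d) (?u ^ p * (?U ^ p * r) - ?u ^ (t i + p) * s')
      (act' ?k (?u ^ p) v \<ominus>\<^bsub>E ?k\<^esub> act' ?k (?u ^ (t i + p)) z')"
    by (intro rep_diff[OF repv]) (simp add: algebra_simps)
  then have "act' ?k (?u ^ p) v \<ominus>\<^bsub>E ?k\<^esub> act' ?k (?u ^ (t i + p)) z' \<in> bound is (?N + int p * ?d)"
    using Cons.IH[OF i(2), of ?\<tau> "?N + int p * ?d" _ _ 0] s'_mem by simp
  then obtain \<beta> where \<beta>: "\<beta> = act' ?k (?u ^ p) v \<ominus>\<^bsub>E ?k\<^esub> act' ?k (?u ^ (t i + p)) z'"
    "\<beta> \<in> bound is (?N + int p * ?d)" by blast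
  note \<beta>c = tors_carrier[OF bound_tors[OF \<beta>(2)]]
  obtain e \<gamma> where \<gamma>: "\<gamma> \<in> bound is n" "act' ?k (?u ^ (e + (t i + p))) \<gamma> = act' ?k (?u ^ e) \<beta>"
    using bound_divide[OF \<beta>(2), of "t i + p" i] by (auto simp: algebra_simps)
  note \<gamma>t = bound_tors[OF \<gamma>(1)]
  note \<gamma>c = tors_carrier[OF \<gamma>t]
  \<comment> \<open>\<open>z'\<close> and \<gamma> are cocycles, so \<open>?b\<close> has the same
    image under \<open>\<delta>\<close> as \<open>y\<close>; subtracting both makes it
    U_i-torsion.\<close>
  let ?b = "y \<ominus>\<^bsub>E ?k\<^esub> (z' \<oplus>\<^bsub>E ?k\<^esub> \<gamma>)"
  have z't: "z' \<in> tors ?k ?T n" "\<delta> ?k z' = \<zero>\<^bsub>E (Suc ?k)\<^esub>" using rep_cocycle[OF z'] by auto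
  have "act' ?k (?u ^ (e + a + p + t i)) y = act' ?k (?u ^ (e + a + p)) v"
    by (rule act_pow_raise[OF *(3) yc vc]) simp
  also have "\<dots> = act' ?k (?u ^ (e + a)) (act' ?k (?u ^ p) v)" using vc by (simp add: act_pow)
  also have "act' ?k (?u ^ p) v = act' ?k (?u ^ (t i + p)) z' \<oplus>\<^bsub>E ?k\<^esub> \<beta>"
    unfolding \<beta>(1) using vc z'c by (simp add: a_minus_def E.a_ac E.r_neg E.r_neg1 E.r_neg2)
  also have "act' ?k (?u ^ (e + a)) \<dots> = act' ?k (?u ^ (e + a + p + t i)) z' \<oplus>\<^bsub>E ?k\<^esub> act' ?k (?u ^ a) (act' ?k (?u ^ e) \<beta>)"
    using z'c \<beta>c by (simp add: E.act_add act_pow ac_simps)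
  also have "act' ?k (?u ^ a) (act' ?k (?u ^ e) \<beta>) = act' ?k (?u ^ (e + a + p + t i)) \<gamma>"
    unfolding \<gamma>(2)[symmetric] using \<gamma>c by (simp add: act_pow ac_simps)
  finally have "act' ?k (?u ^ (e + a + p + t i)) ?b = \<zero>\<^bsub>E ?k\<^esub>"
    using yc z'c \<gamma>c by (simp add: E.act_diff E.act_add E.diff_eq_zero_iff)
  then have "?b \<in> tors ?k (set (i # is)) n"
    using tors_insertI[OF tors_diff[OF *(2) tors_add[OF z't(1) \<gamma>t]]] by simp
  moreover have "\<delta> ?k ?b = z"
    using yc z'c \<gamma>c z't(2) bound_cocycle[OF \<gamma>(1)] *(4)
    by (simp add: \<delta>_diff \<delta>_add) (simp add: a_minus_def)
  ultimately show ?case by (auto simp: bound_def)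
qed

text \<open>If \<delta> y = \<delta> b and \<open>b\<close> is also U_i-torsion, then y - b is a
  cocycle, hence a fraction by \<open>rep_surj\<close>. After multiplication by a power of U_i it
  agrees with the cocycle that \<open>y\<close> lifts, so the difference of the two numerators
  represents 0 and falls under the induction hypothesis.\<close>

lemma rep_bound_only_if:
  assumes "distinct is" "rep is t n r z" "z \<in> bound is n"
  shows "\<exists>p. (\<Prod>i\<in>set is. indet i) ^ p * r \<in> power_ideal (set is) (\<lambda>i. t i + p) I"
  using assms
proof (induction "is" arbitrary: t n r z)
  case Nil
  then show ?case by (simp add: bound_def aug_zero_iff power_ideal_def)
next
  case (Cons i "is")
  let ?k = "length is" and ?u = "indet i :: ('n, 'a) mpoly" and ?U = "(\<Prod>i\<in>set is. indet i) :: ('n, 'a) mpoly"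
  let ?d = "int (dg i)" and ?T = "set is"
  let ?N = "n + int (t i) * ?d"
  have i: "i \<notin> ?T" "distinct is" using Cons.prems(1) by auto
  obtain v y a where *: "rep is t ?N r v" "y \<in> tors ?k ?T n"
    "act' ?k (?u ^ (a + t i)) y = act' ?k (?u ^ a) v" "z = \<delta> ?k y"
    using Cons.prems(2) by auto
  note vc = rep_carrier[OF *(1)] and yc = tors_carrier[OF *(2)]
  obtain b where b: "b \<in> tors ?k (set (i # is)) n" "\<delta> ?k b = \<delta> ?k y"
    using Cons.prems(3) *(4) by (auto simp: bound_def)
  have bt: "b \<in> tors ?k ?T n" using b(1) tors_mono[of ?T "set (i # is)"] by auto
  note bc = tors_carrier[OF bt]
  obtain e where e: "act' ?k (?u ^ e) b = \<zero>\<^bsub>E ?k\<^esub>" using b(1) by (auto simp: tors_def)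
  let ?z = "y \<ominus>\<^bsub>E ?k\<^esub> b"
  have "\<delta> ?k ?z = \<zero>\<^bsub>E (Suc ?k)\<^esub>" using yc bc b(2) by (simp add: \<delta>_diff E.diff_eq_zero_iff)
  then obtain t' s where s: "rep is t' n s ?z" using rep_surj[OF i(2) tors_diff[OF *(2) bt]] by blast
  \<comment> \<open>The sum bounds every \<open>t' l\<close>, so the subtraction in \<open>q\<close>
    is not truncated and both fractions can be expanded to the exponents
    \<open>?\<tau>\<close>.\<close>
  define p where "p = (\<Sum>l\<in>?T. t' l)"
  define q where "q l = t l + p - t' l" for l
  let ?\<tau> = "\<lambda>l. t l + p"
  have q: "t' l + q l = ?\<tau> l" if "l \<in> ?T" for l
    using member_le_sum[OF that, of t'] by (simp add: q_def p_def)
  define s' where "s' = (\<Prod>l\<leftarrow>is. indet l ^ q l) * s"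
  have "rep is (\<lambda>l. t' l + q l) n s' ?z" unfolding s'_def by (rule rep_shift[OF s])
  then have s': "rep is ?\<tau> n s' ?z" using rep_cong[of "is" "\<lambda>l. t' l + q l" ?\<tau>] q by simp
  have r': "rep is ?\<tau> ?N (?U ^ p * r) v"
    using rep_shift[OF *(1), of "\<lambda>_. p"] i by (simp add: prod_list_distinct prod_power_distrib)
  \<comment> \<open>\<open>a\<close> clears the lift \<open>y\<close>, and \<open>e\<close> kills
    \<open>b\<close>.\<close>
  let ?c = "a + e"
  have "act' ?k (?u ^ (?c + t i)) ?z = act' ?k (?u ^ ?c) v"
  proof -
    have "act' ?k (?u ^ (?c + t i)) b = act' ?k (?u ^ (a + t i)) (act' ?k (?u ^ e) b)"
      using bc by (simp add: act_pow ac_simps)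
    then have "act' ?k (?u ^ (?c + t i)) b = \<zero>\<^bsub>E ?k\<^esub>" using e by simp
    then show ?thesis
      using act_pow_raise[OF *(3) yc vc, of ?c] yc bc vc by (simp add: E.act_diff) (simp add: a_minus_def)
  qed
  moreover have "rep is ?\<tau> (n + int (?c + t i) * ?d) (?u ^ (?c + t i) * s') (act' ?k (?u ^ (?c + t i)) ?z)"
    by (rule rep_act[OF s' indet_power_component])
  moreover have "rep is ?\<tau> (?N + int ?c * ?d) (?u ^ ?c * (?U ^ p * r)) (act' ?k (?u ^ ?c) v)"
    by (rule rep_act[OF r' indet_power_component])
  then have "rep is ?\<tau> (n + int (?c + t i) * ?d) (?u ^ ?c * (?U ^ p * r)) (act' ?k (?u ^ ?c) v)"
    by (simp add: algebra_simps)
  ultimately have "rep is ?\<tau> (n + int (?c + t i) * ?d) (?u ^ ?c * (?U ^ p * r) - ?u ^ (?c + t i) * s')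
      (act' ?k (?u ^ ?c) v \<ominus>\<^bsub>E ?k\<^esub> act' ?k (?u ^ ?c) v)"
    by (intro rep_diff) simp_all
  then have "rep is ?\<tau> (n + int (?c + t i) * ?d) (?u ^ ?c * (?U ^ p * r) - ?u ^ (?c + t i) * s') \<zero>\<^bsub>E ?k\<^esub>"
    using vc E.diff_eq_zero_iff[of "act' ?k (?u ^ ?c) v" ?k "act' ?k (?u ^ ?c) v"] by simp
  then obtain p' where p': "?U ^ p' * (?u ^ ?c * (?U ^ p * r) - ?u ^ (?c + t i) * s')
      \<in> power_ideal ?T (\<lambda>l. t l + p + p') I"
    using Cons.IH[OF i(2) _ bound_zero] by blast
  \<comment> \<open>In front of \<open>r\<close> the other indeterminates have exponent p + p' and
    U_i has exponent \<open>?c\<close>; multiplying each by what it misses gives the common exponent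
    \<open>M\<close>. The term with \<open>s'\<close> becomes a multiple of U_i^(t i + M).\<close>
  define M where "M = ?c + p + p'"
  have "?u ^ (p + p') * (?U ^ ?c * (?U ^ p' * (?u ^ ?c * (?U ^ p * r) - ?u ^ (?c + t i) * s')))
      \<in> power_ideal ?T (\<lambda>l. t l + p + p' + ?c) I"
    by (intro ideal_ofD(4)[OF ideal_power_ideal[OF ideal]] power_ideal_times_prod[OF ideal _ p']) auto
  moreover have "?u ^ (p + p') * (?U ^ ?c * (?U ^ p' * (?u ^ ?c * (?U ^ p * r) - ?u ^ (?c + t i) * s')))
      = (?u * ?U) ^ M * r - ?U ^ (?c + p') * s' * ?u ^ (t i + M)"
    by (simp add: M_def power_add power_mult_distrib algebra_simps)
  moreover have "(\<lambda>l. t l + p + p' + ?c) = (\<lambda>l. t l + M)" by (simp add: M_def fun_eq_iff)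
  ultimately have "(?u * ?U) ^ M * r - ?U ^ (?c + p') * s' * ?u ^ (t i + M) \<in> power_ideal ?T (\<lambda>l. t l + M) I"
    by simp
  then have "(?u * ?U) ^ M * r \<in> power_ideal (insert i ?T) (\<lambda>l. t l + M) I"
    using power_ideal_insert[of ?T i _ "\<lambda>l. t l + M" I] i(1) by blast
  then show ?case using i(1) by auto
qed

end

section \<open>Contents and the top component\<close>

lemma Idl_class:
  "ideal_of UNIV (Idl\<^bsub>cring_class_ops\<^esub> S)" "S \<subseteq> Idl\<^bsub>cring_class_ops\<^esub> S"
  "ideal_of UNIV J \<Longrightarrow> S \<subseteq> J \<Longrightarrow> Idl\<^bsub>cring_class_ops\<^esub> S \<subseteq> J"
proof -
  have r: "ring (cring_class_ops :: 'a ring)" using cring_class by (rule cring.axioms)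
  show "ideal_of UNIV (Idl\<^bsub>cring_class_ops\<^esub> S)"
    unfolding ideal_of_UNIV_iff by (rule ring.genideal_ideal[OF r]) (auto simp: carrier_class)
  show "S \<subseteq> Idl\<^bsub>cring_class_ops\<^esub> S" "ideal_of UNIV J \<Longrightarrow> S \<subseteq> J \<Longrightarrow> Idl\<^bsub>cring_class_ops\<^esub> S \<subseteq> J"
    unfolding ideal_of_UNIV_iff genideal_def by blast+
qed

lemma coefficient_in_content:
  assumes "f \<in> J"
  shows "Poly_Mapping.lookup f m \<in> content_ideal J"
proof -
  have "Poly_Mapping.lookup f m \<in> content_poly f"
    unfolding content_poly_def using Idl_class(2)[of "Set.range (Poly_Mapping.lookup f)"] by blast
  then show ?thesis
    unfolding content_ideal_def using assms Idl_class(2)[of "\<Union>f\<in>J. content_poly f"] by blast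
qed

lemma content_ideal_le:
  assumes J: "ideal_of UNIV J" and c: "\<And>f m. f \<in> I \<Longrightarrow> Poly_Mapping.lookup f m \<in> J"
  shows "content_ideal I \<subseteq> J"
proof -
  have "content_poly f \<subseteq> J" if "f \<in> I" for f
    unfolding content_poly_def using c[OF that] by (intro Idl_class(3)[OF J]) auto
  then show ?thesis
    unfolding content_ideal_def by (intro Idl_class(3)[OF J]) auto
qed

text \<open>Each term of (a + b)^(N + M) contains a^N or b^M. This passes nilpotency from single
  coefficients to the content they generate.\<close>

lemma ideal_radical:
  assumes J: "ideal_of UNIV J"
  shows "ideal_of UNIV {a. \<exists>N. a ^ N \<in> J}"
  unfolding ideal_of_def
proof (intro conjI ballI)
  show "0 \<in> {a. \<exists>N. a ^ N \<in> J}"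
    using ideal_ofD(2)[OF J] by (auto intro: exI[of _ 1])
  fix a assume "a \<in> {a. \<exists>N. a ^ N \<in> J}"
  then obtain N where N: "a ^ N \<in> J" by blast
  show "b * a \<in> {a. \<exists>N. a ^ N \<in> J}" for b
    using ideal_ofD(4)[OF J UNIV_I N, of "b ^ N"] by (auto simp: power_mult_distrib)
  fix b assume "b \<in> {a. \<exists>N. a ^ N \<in> J}"
  then obtain M where M: "b ^ M \<in> J" by blast
  have "of_nat ((N + M) choose k) * a ^ k * b ^ (N + M - k) \<in> J" for k
  proof (cases "N \<le> k")
    case True
    then have "a ^ k = a ^ (k - N) * a ^ N" by (simp flip: power_add)
    then have "of_nat ((N + M) choose k) * a ^ k * b ^ (N + M - k)
        = (of_nat ((N + M) choose k) * a ^ (k - N) * b ^ (N + M - k)) * a ^ N" by (simp add: ac_simps)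
    then show ?thesis using ideal_ofD(4)[OF J UNIV_I N] by simp
  next
    case False
    then have "b ^ (N + M - k) = b ^ (N - k) * b ^ M" by (simp flip: power_add)
    then have "of_nat ((N + M) choose k) * a ^ k * b ^ (N + M - k)
        = (of_nat ((N + M) choose k) * a ^ k * b ^ (N - k)) * b ^ M" by (simp add: ac_simps)
    then show ?thesis using ideal_ofD(4)[OF J UNIV_I M] by simp
  qed
  then have "(a + b) ^ (N + M) \<in> J"
    unfolding binomial_ring by (intro ideal_sum[OF J])
  then show "a + b \<in> {a. \<exists>N. a ^ N \<in> J}" by blast
qed simp

text \<open>The elements all of whose components lie in the ideal form an ideal that contains the
  generators.\<close>

lemma hom_comp_Idl:
  assumes homog: "\<And>f. f \<in> F \<Longrightarrow> homogeneous_poly dg f" and f: "f \<in> Idl\<^bsub>cring_class_ops\<^esub> F"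
  shows "hom_comp dg k f \<in> Idl\<^bsub>cring_class_ops\<^esub> F"
proof -
  let ?I = "Idl\<^bsub>cring_class_ops\<^esub> F" and ?J = "{f. \<forall>k. hom_comp dg k f \<in> Idl\<^bsub>cring_class_ops\<^esub> F}"
  note I = Idl_class(1)[of F]
  have "ideal_of UNIV ?J"
    unfolding ideal_of_def
  proof (intro conjI ballI)
    fix b f assume f: "f \<in> ?J"
    have "hom_comp dg k (b * f) \<in> ?I" for k
    proof -
      have "b * f = (\<Sum>l\<in>hom_degrees dg b. f * hom_comp dg l b)"
        by (subst sum_hom_comp[of "hom_degrees dg b" dg b]) (auto simp: sum_distrib_left mult.commute)
      then have "hom_comp dg k (b * f) = (\<Sum>l\<in>hom_degrees dg b. hom_comp dg l b * hom_comp dg (k - l) f)"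
        by (simp add: hom_comp_sum hom_comp_mult[OF hom_comp_in] mult.commute)
      then show ?thesis
        using f by (auto intro!: ideal_sum[OF I] ideal_ofD(4)[OF I UNIV_I])
    qed
    then show "b * f \<in> ?J" by blast
  qed (auto simp: hom_comp_add intro: ideal_ofD[OF I])
  moreover have "F \<subseteq> ?J"
  proof clarify
    fix f k assume f: "f \<in> F"
    then obtain l where "f \<in> poly_component dg l" using homog by (auto simp: homogeneous_poly_def)
    then show "hom_comp dg k f \<in> ?I"
      using hom_comp_component[of f dg l k] f Idl_class(2)[of F] ideal_ofD(2)[OF I] by auto
  qed
  ultimately have "?I \<subseteq> ?J" by (rule Idl_class(3))
  then show ?thesis using f by blast
qed

section \<open>Powers of the irrelevant ideal\<close>

lemma ideal_power_simps:
  "\<one>\<^bsub>ideals_set A\<^esub> = carrier A"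
  "\<aa> \<otimes>\<^bsub>ideals_set A\<^esub> \<bb> = ideal_prod A \<aa> \<bb>"
  by (simp_all add: ideals_set_def)

context graded_resolution
begin

lemma irrelevant_ideal: "Ideal.ideal (irrelevant_ideal I) (quot_ring I)"
  "quot_proj I (indet i) \<in> irrelevant_ideal I"
proof -
  interpret cring "quot_ring I" by (rule cring_quot_ring[OF ideal])
  have sub: "Set.range (\<lambda>i. quot_proj I (indet i)) \<subseteq> carrier (quot_ring I)"
    using quot_proj_simps(1)[OF ideal] by auto
  show "Ideal.ideal (irrelevant_ideal I) (quot_ring I)" "quot_proj I (indet i) \<in> irrelevant_ideal I"
    unfolding irrelevant_ideal_def using genideal_ideal[OF sub] genideal_self[OF sub] by auto
qed

lemma irrelevant_power:
  "Ideal.ideal (irrelevant_ideal I [^]\<^bsub>ideals_set (quot_ring I)\<^esub> (n::nat)) (quot_ring I)"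
proof -
  interpret cring "quot_ring I" by (rule cring_quot_ring[OF ideal])
  show ?thesis
    by (induction n) (auto simp: ideal_power_simps oneideal intro: ideal_prod_is_ideal irrelevant_ideal(1))
qed

lemma irrelevant_power_indet:
  "quot_proj I (indet i ^ n) \<in> irrelevant_ideal I [^]\<^bsub>ideals_set (quot_ring I)\<^esub> n"
proof (induction n)
  case 0
  show ?case using quot_proj_simps(1)[OF ideal] by (simp add: ideal_power_simps)
next
  case (Suc n)
  then show ?case
    using ideal_prod.prod[OF Suc irrelevant_ideal(2)[of i], of "quot_ring I"]
    by (simp add: ideal_power_simps quot_proj_simps(3)[OF ideal, symmetric] mult.commute)
qed

text \<open>Pigeonhole on exponents, as an induction on \<open>N\<close>: passing from
  \<open>x\<close> to U_i x lowers \<open>m i\<close> by one. The ring elements that send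
  \<open>x\<close> to something killed by the N-th power form an ideal \<open>A\<close>, and it
  contains the generators.\<close>

lemma irrelevant_power_kills:
  assumes "x \<in> carrier (E j)" "\<And>i. act' j (indet i ^ m i) x = \<zero>\<^bsub>E j\<^esub>" "(\<Sum>i\<in>UNIV. m i) \<le> N"
    and "b \<in> irrelevant_ideal I [^]\<^bsub>ideals_set (quot_ring I)\<^esub> N"
  shows "b \<odot>\<^bsub>E j\<^esub> x = \<zero>\<^bsub>E j\<^esub>"
  using assms
proof (induction N arbitrary: x m b)
  case 0
  \<comment> \<open>The index type has an element, and its exponent 0 says that 1 kills
    \<open>x\<close>.\<close>
  then have "m undefined = 0" by simp
  then have "x = \<zero>\<^bsub>E j\<^esub>" using 0(1) 0(2)[of undefined] by simp
  moreover obtain f where "b = quot_proj I f"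
    using 0(4) by (auto simp: ideal_power_simps quot_ring_carrier)
  ultimately show ?case using E.act_zero[of j f] by (simp add: act_def)
next
  case (Suc N)
  let ?p = "irrelevant_ideal I [^]\<^bsub>ideals_set (quot_ring I)\<^esub> N"
  note x = Suc.prems(1)
  interpret Q: cring "quot_ring I" by (rule cring_quot_ring[OF ideal])
  define A where "A = {a \<in> carrier (quot_ring I). \<forall>b\<in>?p. b \<odot>\<^bsub>E j\<^esub> (a \<odot>\<^bsub>E j\<^esub> x) = \<zero>\<^bsub>E j\<^esub>}"
  have p_carrier: "b \<in> carrier (quot_ring I)" if "b \<in> ?p" for b
    using that ideal.Icarr[OF irrelevant_power] by blast
  note mod = E.module[of j]
  note s = module.smult_closed[OF mod] module.smult_l_distr[OF mod] module.smult_r_distr[OF mod]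
    module.smult_l_minus[OF mod] module.smult_r_minus[OF mod] module.smult_r_null[OF mod] module.smult_l_null[OF mod]
  have "Ideal.ideal A (quot_ring I)"
  proof (rule idealI[OF Q.ring_axioms])
    show "subgroup A (add_monoid (quot_ring I))"
    proof (rule group.subgroupI)
      show "A \<noteq> {}" using x p_carrier s by (auto simp: A_def intro!: exI[of _ "\<zero>\<^bsub>quot_ring I\<^esub>"])
      show "inv\<^bsub>add_monoid (quot_ring I)\<^esub> a \<in> A" if "a \<in> A" for a
      proof -
        have "\<ominus>\<^bsub>quot_ring I\<^esub> a \<in> A" using that x p_carrier s by (auto simp: A_def)
        then show ?thesis by (simp only: a_inv_def)
      qed
    qed (use x p_carrier s Q.add.group_axioms in \<open>auto simp: A_def\<close>)
    fix a c assume a: "a \<in> A" and c: "c \<in> carrier (quot_ring I)"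
    have "b \<odot>\<^bsub>E j\<^esub> ((c \<otimes>\<^bsub>quot_ring I\<^esub> a) \<odot>\<^bsub>E j\<^esub> x) = \<zero>\<^bsub>E j\<^esub>" if b: "b \<in> ?p" for b
    proof -
      have car: "a \<in> carrier (quot_ring I)" "b \<in> carrier (quot_ring I)" using a b p_carrier by (auto simp: A_def)
      have "b \<odot>\<^bsub>E j\<^esub> ((c \<otimes>\<^bsub>quot_ring I\<^esub> a) \<odot>\<^bsub>E j\<^esub> x) = (b \<otimes>\<^bsub>quot_ring I\<^esub> (c \<otimes>\<^bsub>quot_ring I\<^esub> a)) \<odot>\<^bsub>E j\<^esub> x"
        using car c x by (simp add: module.smult_assoc1[OF mod])
      also have "\<dots> = (c \<otimes>\<^bsub>quot_ring I\<^esub> (b \<otimes>\<^bsub>quot_ring I\<^esub> a)) \<odot>\<^bsub>E j\<^esub> x"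
        using car c by (simp add: Q.m_lcomm)
      also have "\<dots> = c \<odot>\<^bsub>E j\<^esub> (b \<odot>\<^bsub>E j\<^esub> (a \<odot>\<^bsub>E j\<^esub> x))"
        using car c x s(1) by (simp add: module.smult_assoc1[OF mod])
      also have "\<dots> = \<zero>\<^bsub>E j\<^esub>" using a b c s(6) by (simp add: A_def)
      finally show ?thesis .
    qed
    then show "c \<otimes>\<^bsub>quot_ring I\<^esub> a \<in> A" using a c by (simp add: A_def)
    then show "a \<otimes>\<^bsub>quot_ring I\<^esub> c \<in> A" using a c by (simp add: A_def Q.m_comm)
  qed
  moreover have "quot_proj I (indet i) \<in> A" for i
  proof -
    have "b \<odot>\<^bsub>E j\<^esub> (act' j (indet i) x) = \<zero>\<^bsub>E j\<^esub>" if b: "b \<in> ?p" for b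
    proof (cases "m i")
      case 0
      then have "x = \<zero>\<^bsub>E j\<^esub>" using x Suc.prems(2)[of i] by simp
      then show ?thesis using p_carrier[OF b] s(6) by simp
    next
      case (Suc k)
      show ?thesis
      proof (rule Suc.IH[of _ "m(i := k)", OF _ _ _ b])
        show "act' j (indet l ^ (m(i := k)) l) (act' j (indet i) x) = \<zero>\<^bsub>E j\<^esub>" for l
        proof (cases "l = i")
          case True
          then show ?thesis
            using Suc.prems(2)[of i] x Suc E.act_mult[OF x, of "indet i ^ k" "indet i"]
            by (simp add: mult.commute)
        next
          case False
          then show ?thesis
            using Suc.prems(2)[of l] E.act_commute[OF x, of "indet l ^ m l" "indet i"] by simp
        qed
        have "(\<Sum>l\<in>UNIV. m l) = Suc k + (\<Sum>l\<in>UNIV - {i}. m l)" using Suc by (subst sum.remove[of _ i]) auto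
        moreover have "(\<Sum>l\<in>UNIV. (m(i := k)) l) = k + (\<Sum>l\<in>UNIV - {i}. m l)"
          by (subst sum.remove[of _ i]) (auto intro: sum.cong)
        ultimately show "(\<Sum>l\<in>UNIV. (m(i := k)) l) \<le> N" using Suc.prems(3) by simp
      qed (use x in auto)
    qed
    then show ?thesis using quot_proj_simps(1)[OF ideal] by (simp add: A_def act_def)
  qed
  ultimately have "irrelevant_ideal I \<subseteq> A"
    unfolding irrelevant_ideal_def by (intro Q.genideal_minimal) auto
  moreover have "b \<in> ideal_prod (quot_ring I) ?p (irrelevant_ideal I)"
    using Suc.prems(4) by (simp add: ideal_power_simps)
  then have "b \<in> carrier (quot_ring I) \<and> b \<odot>\<^bsub>E j\<^esub> x = \<zero>\<^bsub>E j\<^esub>"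
  proof induction
    case (prod b a)
    then have "a \<in> A" "b \<in> carrier (quot_ring I)" using calculation p_carrier by auto
    then show ?case
      using prod x by (auto simp: A_def module.smult_assoc1[OF mod])
  next
    case (sum b c)
    then show ?case using x s by simp
  qed
  then show ?case by blast
qed

section \<open>The torsion complex and its coboundaries\<close>

abbreviation \<Gamma> :: "nat \<Rightarrow> (('n, 'a) mpoly set, 'e) module" where
  "\<Gamma> j \<equiv> torsion_submodule (quot_ring I) (irrelevant_ideal I) (E j)"

lemma torsion_iff:
  "x \<in> carrier (\<Gamma> j) \<longleftrightarrow> x \<in> carrier (E j) \<and> (\<forall>i. \<exists>m. act' j (indet i ^ m) x = \<zero>\<^bsub>E j\<^esub>)"
proof
  assume "x \<in> carrier (\<Gamma> j)"
  then obtain n :: nat where "x \<in> carrier (E j)"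
    "\<And>a. a \<in> irrelevant_ideal I [^]\<^bsub>ideals_set (quot_ring I)\<^esub> n \<Longrightarrow> a \<odot>\<^bsub>E j\<^esub> x = \<zero>\<^bsub>E j\<^esub>"
    by (auto simp: torsion_submodule_def)
  then show "x \<in> carrier (E j) \<and> (\<forall>i. \<exists>m. act' j (indet i ^ m) x = \<zero>\<^bsub>E j\<^esub>)"
    using irrelevant_power_indet[of _ n] unfolding act_def by blast
next
  assume x: "x \<in> carrier (E j) \<and> (\<forall>i. \<exists>m. act' j (indet i ^ m) x = \<zero>\<^bsub>E j\<^esub>)"
  then obtain m where "\<And>i. act' j (indet i ^ m i) x = \<zero>\<^bsub>E j\<^esub>" by metis
  then show "x \<in> carrier (\<Gamma> j)"
    using x irrelevant_power_kills[of x j m "\<Sum>i\<in>UNIV. m i"] by (auto simp: torsion_submodule_def)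
qed

lemma torsion_component: "carrier (\<Gamma> j) \<inter> \<E> j n = tors j UNIV n"
  by (auto simp: torsion_iff tors_def)

lemma torsion_simps [simp]:
  "\<zero>\<^bsub>\<Gamma> j\<^esub> = \<zero>\<^bsub>E j\<^esub>" "x \<oplus>\<^bsub>\<Gamma> j\<^esub> y = x \<oplus>\<^bsub>E j\<^esub> y" "a \<odot>\<^bsub>\<Gamma> j\<^esub> x = a \<odot>\<^bsub>E j\<^esub> x"
  by (simp_all add: torsion_submodule_def)

lemma torsion_closed:
  assumes "x \<in> carrier (\<Gamma> j)"
  shows "x \<in> carrier (E j)" "y \<in> carrier (\<Gamma> j) \<Longrightarrow> x \<oplus>\<^bsub>E j\<^esub> y \<in> carrier (\<Gamma> j)" "act' j f x \<in> carrier (\<Gamma> j)"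
proof -
  show x: "x \<in> carrier (E j)" using assms by (simp add: torsion_iff)
  have "\<exists>m. act' j (indet i ^ m) (act' j f x) = \<zero>\<^bsub>E j\<^esub>" for i
    using assms E.act_commute[OF x, of _ f] unfolding torsion_iff by (metis E.act_zero)
  then show "act' j f x \<in> carrier (\<Gamma> j)" using x by (auto simp: torsion_iff)
  assume y: "y \<in> carrier (\<Gamma> j)"
  then have y': "y \<in> carrier (E j)" by (simp add: torsion_iff)
  have "\<exists>m. act' j (indet i ^ m) (x \<oplus>\<^bsub>E j\<^esub> y) = \<zero>\<^bsub>E j\<^esub>" for i
  proof -
    obtain k where k: "act' j (indet i ^ k) x = \<zero>\<^bsub>E j\<^esub>" using assms by (auto simp: torsion_iff)
    obtain l where l: "act' j (indet i ^ l) y = \<zero>\<^bsub>E j\<^esub>" using y by (auto simp: torsion_iff)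
    have "act' j (indet i ^ max k l) x = \<zero>\<^bsub>E j\<^esub>" by (rule E.act_power_zero_mono[OF x k]) simp
    moreover have "act' j (indet i ^ max k l) y = \<zero>\<^bsub>E j\<^esub>" by (rule E.act_power_zero_mono[OF y' l]) simp
    ultimately have "act' j (indet i ^ max k l) (x \<oplus>\<^bsub>E j\<^esub> y) = \<zero>\<^bsub>E j\<^esub>" using E.act_add[OF x y'] by simp
    then show ?thesis by blast
  qed
  then show "x \<oplus>\<^bsub>E j\<^esub> y \<in> carrier (\<Gamma> j)" using x y' by (auto simp: torsion_iff)
qed

abbreviation B :: "nat \<Rightarrow> 'e set" where
  "B j \<equiv> coboundaries \<Gamma> \<delta> j"

lemma B_zero: "\<zero>\<^bsub>E j\<^esub> \<in> B j"
proof (cases j)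
  case (Suc k)
  have "\<zero>\<^bsub>E k\<^esub> \<in> carrier (\<Gamma> k)" by (simp add: torsion_iff)
  from imageI[OF this, of "\<delta> k"] show ?thesis using Suc by (simp add: coboundaries_def)
qed (simp add: coboundaries_def)

lemma B_carrier: "x \<in> B j \<Longrightarrow> x \<in> carrier (E j)"
  by (cases j) (auto simp: coboundaries_def torsion_iff)

lemma B_act: "x \<in> B j \<Longrightarrow> act' j f x \<in> B j"
proof (cases j)
  case (Suc k)
  assume "x \<in> B j"
  then obtain y where y: "y \<in> carrier (\<Gamma> k)" "x = \<delta> k y" using Suc by (auto simp: coboundaries_def)
  have "act' j f x = \<delta> k (act' k f y)" using y Suc torsion_closed(1) by (simp add: \<delta>_act)
  then show ?thesis using torsion_closed(3)[OF y(1), of f] Suc by (simp add: coboundaries_def)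
qed (simp add: coboundaries_def)

lemma B_add: "x \<in> B j \<Longrightarrow> y \<in> B j \<Longrightarrow> x \<oplus>\<^bsub>E j\<^esub> y \<in> B j"
proof (cases j)
  case (Suc k)
  assume "x \<in> B j" "y \<in> B j"
  then obtain v w where v: "v \<in> carrier (\<Gamma> k)" "x = \<delta> k v" "w \<in> carrier (\<Gamma> k)" "y = \<delta> k w"
    using Suc by (auto simp: coboundaries_def)
  have "x \<oplus>\<^bsub>E j\<^esub> y = \<delta> k (v \<oplus>\<^bsub>E k\<^esub> w)" using v Suc torsion_closed(1) by (simp add: \<delta>_add)
  then show ?thesis using torsion_closed(2)[OF v(1,3)] Suc by (simp add: coboundaries_def)
qed (simp add: coboundaries_def)

text \<open>A homogeneous coboundary comes from a homogeneous torsion element: take the component of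
  degree \<open>n\<close> of a preimage. It is still torsion, because components commute with the
  action of U_i^m up to the shift of degree.\<close>

lemma B_bound:
  assumes "set is = UNIV"
  shows "B (length is) \<inter> \<E> (length is) n = bound is n"
proof (cases "is")
  case Nil
  then show ?thesis using assms by simp
next
  case (Cons i js)
  let ?k = "length js"
  have bound: "bound is n = \<delta> ?k ` tors ?k UNIV n" using assms Cons by (simp add: bound_def)
  have "\<delta> ?k y \<in> bound is n" if y: "y \<in> carrier (\<Gamma> ?k)" "\<delta> ?k y \<in> \<E> (Suc ?k) n" for y
  proof -
    have yc: "y \<in> carrier (E ?k)" using torsion_closed(1)[OF y(1)] .
    let ?y = "graded_quot_module.cmp (E ?k) (\<E> ?k) y n"
    have "\<exists>m. act' ?k (indet i ^ m) ?y = \<zero>\<^bsub>E ?k\<^esub>" for i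
    proof -
      obtain m where "act' ?k (indet i ^ m) y = \<zero>\<^bsub>E ?k\<^esub>" using y(1) by (auto simp: torsion_iff)
      then have "act' ?k (indet i ^ m) ?y = \<zero>\<^bsub>E ?k\<^esub>"
        using E.cmp_act[OF indet_power_component[of i m dg] yc, of n]
          E.cmp_homogeneous[OF E.comp_zero] by simp
      then show ?thesis by blast
    qed
    then have "?y \<in> tors ?k UNIV n" using E.cmp(1)[OF yc] by (simp add: tors_def)
    moreover have "\<delta> ?k ?y = \<delta> ?k y"
      using \<delta>_cmp[OF yc, of n] E.cmp_homogeneous[OF y(2), of n] by simp
    ultimately show ?thesis
      unfolding bound by (metis image_eqI)
  qed
  moreover have "bound is n \<subseteq> B (length is) \<inter> \<E> (length is) n"
    using assms Cons bound_tors[of _ "is" n] tors_comp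
    by (auto simp: bound_def coboundaries_def torsion_component[symmetric])
  ultimately show ?thesis using Cons by (auto simp: coboundaries_def)
qed

section \<open>Nilpotency of the content, and the inverse monomial\<close>

lemma distinct_enumeration:
  obtains vs :: "'n list" where "distinct vs" "set vs = UNIV" "length vs = CARD('n)"
  using finite_distinct_list[of "UNIV :: 'n set"] distinct_card by force

text \<open>Representing \<open>x\<close> by a fraction with denominator \<open>(U\<^sub>1 \<cdots> U\<^sub>s)\<^sup>T\<close> for large \<open>T\<close> reduces the claim to
  the nilpotency of the coefficients modulo \<open>(U\<^sub>1\<^sup>T, \<dots>, U\<^sub>s\<^sup>T) + I\<close>.\<close>

lemma coefficient_nilpotent:
  assumes pos: "\<And>i. dg i > 0"
    and x: "x \<in> tors CARD('n) UNIV n" "\<delta> CARD('n) x = \<zero>\<^bsub>E (Suc CARD('n))\<^esub>" and f: "f \<in> I"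
  shows "\<exists>N. act' CARD('n) (const_poly (Poly_Mapping.lookup f m ^ N)) x \<in> B CARD('n)"
proof -
  obtain vs :: "'n list" where vs: "distinct vs" "set vs = UNIV" "length vs = CARD('n)"
    by (rule distinct_enumeration)
  obtain t r where r: "rep vs t n r x" using rep_surj[OF vs(1), of x n] x vs by auto
  define k where "k = int (wdegree dg m)"
  \<comment> \<open>\<open>f\<close> itself may be inhomogeneous; its component through
    \<open>m\<close> lies in \<open>I\<close> and has the same coefficient at
    \<open>m\<close>.\<close>
  let ?f = "hom_comp dg k f"
  \<comment> \<open>The sum bounds every \<open>t i\<close> and so gives a common denominator
    exponent. The other entry exceeds k - n, which bounds the degree in the hypothesis of
    \<open>coefficient_acts_nilpotently\<close>.\<close>
  define T where "T = max (\<Sum>i\<in>UNIV. t i) (Suc (nat (k - n)))"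
  have tT: "t i + (T - t i) = T" for i
    using member_le_sum[of i UNIV t] by (simp add: T_def)
  define g where "g = (\<Prod>i\<leftarrow>vs. indet i ^ (T - t i)) * r"
  have "rep vs (\<lambda>i. t i + (T - t i)) n g x" unfolding g_def by (rule rep_shift[OF r])
  then have g: "rep vs (\<lambda>_. T) n g x" unfolding tT .
  let ?D = "n + wsum vs (\<lambda>_. T)" and ?W = "power_ideal UNIV (\<lambda>_. T) I"
  have W: "ideal_of UNIV ?W" by (rule ideal_power_ideal[OF ideal])
  have "wsum vs (\<lambda>_. T) = (\<Sum>i\<in>UNIV. int T * int (dg i))"
    unfolding wsum_def using sum_list_distinct_conv_sum_set[OF vs(1)] vs(2) by simp
  then have "(\<Sum>i\<in>UNIV. (int T - 1) * int (dg i)) - ?D + k = k - n - (\<Sum>i\<in>UNIV. int (dg i))"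
    by (simp add: left_diff_distrib sum_subtractf)
  also have "\<dots> \<le> k - n" by (simp add: sum_nonneg)
  also have "\<dots> < int T"
  proof -
    have "Suc (nat (k - n)) \<le> T" by (simp add: T_def)
    then show ?thesis by linarith
  qed
  finally have "acts_nilpotently (poly_component dg ?D) ?W (const_poly (Poly_Mapping.lookup ?f m))"
    using indet_power_in_power_ideal[OF ideal, of UNIV _ "\<lambda>_. T" T 1] power_ideal_base[OF hom_ideal[OF f]]
    by (intro coefficient_acts_nilpotently[OF pos hom_comp_in W]) auto
  then obtain N where N: "const_poly (Poly_Mapping.lookup ?f m) ^ N * g \<in> ?W"
    using rep_component[OF g] unfolding acts_nilpotently_def by blast
  have lk: "Poly_Mapping.lookup ?f m = Poly_Mapping.lookup f m" by (simp add: lookup_hom_comp k_def)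
  have "rep vs (\<lambda>_. T) (n + 0) (const_poly (Poly_Mapping.lookup f m ^ N) * g)
      (act' (length vs) (const_poly (Poly_Mapping.lookup f m ^ N)) x)"
    by (rule rep_act[OF g const_poly_component])
  then have "act' (length vs) (const_poly (Poly_Mapping.lookup f m ^ N)) x \<in> bound vs n"
    using N vs(2) by (intro rep_bound_if[OF vs(1), where p = 0]) (simp_all add: lk const_poly_power)
  then show ?thesis using B_bound[OF vs(2)] vs(3) by auto
qed

lemma annihilator_ideal:
  assumes "x \<in> carrier (E j)"
  shows "ideal_of UNIV {a. act' j (const_poly a) x \<in> B j}"
proof -
  have c: "const_poly 0 = (0 :: ('n, 'a) mpoly)"
    "const_poly (a + b) = (const_poly a + const_poly b :: ('n, 'a) mpoly)"
    "const_poly (a * b) = (const_poly a * const_poly b :: ('n, 'a) mpoly)" for a b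
    by (simp_all add: const_poly_def single_add mult_single)
  show ?thesis
    unfolding ideal_of_def
    using assms B_zero B_add B_act by (auto simp: c E.act_add_left E.act_mult)
qed

text \<open>The scalars with a power that carries \<open>x\<close> to a coboundary form an ideal,
  the radical of an annihilator, and it contains all coefficients.\<close>

lemma content_nilpotent:
  assumes pos: "\<And>i. dg i > 0"
    and x: "x \<in> tors CARD('n) UNIV n" "\<delta> CARD('n) x = \<zero>\<^bsub>E (Suc CARD('n))\<^esub>" and a: "a \<in> content_ideal I"
  shows "\<exists>N. act' CARD('n) (const_poly (a ^ N)) x \<in> B CARD('n)"
proof -
  have "content_ideal I \<subseteq> {a. \<exists>N. a ^ N \<in> {a. act' CARD('n) (const_poly a) x \<in> B CARD('n)}}"
    using coefficient_nilpotent[OF pos x]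
    by (intro content_ideal_le ideal_radical annihilator_ideal tors_carrier[OF x(1)]) blast
  then show ?thesis using a by blast
qed

text \<open>Take the fraction with numerator 1 and denominator of degree \<open>d\<close>. If it is
  a coboundary, some power (U_1 ... U_s)^p lies in (U_i^(t i + p)) + I. As every \<open>t i\<close>
  is positive, that monomial does not occur in multiples of U_i^(t i + p), so its coefficient 1
  comes from an element of \<open>I\<close>.\<close>

lemma content_UNIV_if_vanishing:
  assumes d: "d \<in> top_degrees dg"
    and zero: "\<And>x. x \<in> tors CARD('n) UNIV (- d) \<Longrightarrow> \<delta> CARD('n) x = \<zero>\<^bsub>E (Suc CARD('n))\<^esub> \<Longrightarrow> x \<in> B CARD('n)"
  shows "content_ideal I = UNIV"
proof -
  obtain vs :: "'n list" where vs: "distinct vs" "set vs = UNIV" "length vs = CARD('n)"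
    by (rule distinct_enumeration)
  obtain l where l: "d = (\<Sum>i\<in>UNIV. l i * int (dg i))" "\<And>i. l i \<ge> 1"
    using d by (auto simp: top_degrees_def)
  define t where "t i = nat (l i)" for i
  have t: "int (t i) = l i" "t i > 0" for i using l(2)[of i] by (simp_all add: t_def)
  have "wsum vs t = d"
    unfolding wsum_def l(1) using sum_list_distinct_conv_sum_set[OF vs(1)] vs(2) t by simp
  then obtain z where z: "rep vs t (- d) 1 z"
    using rep_total[of 1 "- d" vs t] one_component by auto
  have "z \<in> tors CARD('n) UNIV (- d)" "\<delta> CARD('n) z = \<zero>\<^bsub>E (Suc CARD('n))\<^esub>"
    using rep_cocycle[OF z] vs by auto
  then have "z \<in> bound vs (- d)"
    using zero[of z] tors_comp[of z] B_bound[OF vs(2), of "- d"] vs(3) by auto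
  then obtain p where "(\<Prod>i\<in>UNIV. indet i) ^ p * 1 \<in> power_ideal UNIV (\<lambda>i. t i + p) I"
    using rep_bound_only_if[OF vs(1) z] vs(2) by auto
  then obtain c q where q: "q \<in> I" "(\<Prod>i\<in>UNIV. indet i) ^ p = (\<Sum>i\<in>UNIV. c i * indet i ^ (t i + p)) + q"
    by (auto simp: power_ideal_def)
  define m :: "'n \<Rightarrow>\<^sub>0 nat" where "m = (\<Sum>i\<in>UNIV. Poly_Mapping.single i p)"
  have m: "Poly_Mapping.lookup m i = p" for i
  proof -
    have "Poly_Mapping.lookup m i = (\<Sum>j\<in>UNIV. if j = i then p else 0)"
      unfolding m_def lookup_sum by (intro sum.cong) (auto simp: lookup_single when_def)
    then show ?thesis by simp
  qed
  have single_sum: "(\<Prod>i\<in>F. Poly_Mapping.single (Poly_Mapping.single i p) 1)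
      = (Poly_Mapping.single (\<Sum>i\<in>F. Poly_Mapping.single i p) 1 :: ('n, 'a) mpoly)" if "finite F" for F
    using that by induction (simp_all add: mult_single)
  have "((\<Prod>i\<in>UNIV. indet i) ^ p :: ('n, 'a) mpoly) = Poly_Mapping.single m 1"
    unfolding prod_power_distrib indet_power m_def by (rule single_sum) simp
  moreover have "Poly_Mapping.lookup (c i * indet i ^ (t i + p)) m = 0" for i
  proof (rule ccontr)
    assume "\<not> ?thesis"
    then have "m \<in> Poly_Mapping.keys (c i * indet i ^ (t i + p))" by (simp add: in_keys_iff)
    then obtain a b where "m = a + b" "b \<in> Poly_Mapping.keys (indet i ^ (t i + p) :: ('n, 'a) mpoly)"
      using keys_mult[of "c i" "indet i ^ (t i + p)"] by auto
    then have "m = a + Poly_Mapping.single i (t i + p)" by (auto simp: indet_power split: if_splits)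
    then have "p = Poly_Mapping.lookup a i + (t i + p)"
      using m[of i] by (simp add: lookup_add)
    then show False using t(2)[of i] by simp
  qed
  ultimately have "Poly_Mapping.lookup q m = 1"
    using arg_cong[OF q(2), of "\<lambda>f. Poly_Mapping.lookup f m"] by (simp add: lookup_add lookup_sum)
  then have one: "1 \<in> content_ideal I" using coefficient_in_content[OF q(1), of m] by simp
  have "ideal_of UNIV (content_ideal I)" unfolding content_ideal_def by (rule Idl_class(1))
  from ideal_ofD(4)[OF this UNIV_I one] show ?thesis by auto
qed

section \<open>The component as a module over R_0\<close>

lemma B_coset_eq_iff:
  assumes x: "x \<in> carrier (E j)"
  shows "B j +>\<^bsub>E j\<^esub> x = B j \<longleftrightarrow> x \<in> B j"
proof
  assume "B j +>\<^bsub>E j\<^esub> x = B j"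
  moreover have "\<zero>\<^bsub>E j\<^esub> \<oplus>\<^bsub>E j\<^esub> x \<in> B j +>\<^bsub>E j\<^esub> x" using B_zero by (auto simp: a_r_coset_def')
  ultimately show "x \<in> B j" using x by simp
next
  assume xB: "x \<in> B j"
  have "b \<in> B j +>\<^bsub>E j\<^esub> x" if b: "b \<in> B j" for b
  proof -
    have "b \<ominus>\<^bsub>E j\<^esub> x \<in> B j"
      using B_add[OF b B_act[OF xB, of "- 1"]] x by (simp add: a_minus_def E.act_uminus)
    moreover have "b = (b \<ominus>\<^bsub>E j\<^esub> x) \<oplus>\<^bsub>E j\<^esub> x"
      using x B_carrier[OF b] by (simp add: a_minus_def E.a_assoc E.l_neg)
    ultimately show ?thesis unfolding a_r_coset_def' by blast
  qed
  then show "B j +>\<^bsub>E j\<^esub> x = B j" using B_add[OF _ xB] by (auto simp: a_r_coset_def')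
qed

text \<open>Collapses the union of cosets in the scalar multiplication of
  \<open>quotient_module\<close> to a single coset.\<close>

lemma coset_shift:
  assumes "b \<in> B j" "x \<in> carrier (E j)"
  shows "B j +>\<^bsub>E j\<^esub> (b \<oplus>\<^bsub>E j\<^esub> x) = B j +>\<^bsub>E j\<^esub> x"
proof -
  have b: "b \<in> carrier (E j)" using assms(1) by (rule B_carrier)
  have assoc: "h \<oplus>\<^bsub>E j\<^esub> (b \<oplus>\<^bsub>E j\<^esub> x) = (h \<oplus>\<^bsub>E j\<^esub> b) \<oplus>\<^bsub>E j\<^esub> x" if "h \<in> B j" for h
    using that b assms(2) B_carrier by (simp add: E.a_assoc)
  have ex: "\<exists>h'\<in>B j. h = h' \<oplus>\<^bsub>E j\<^esub> b" if h: "h \<in> B j" for h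
  proof -
    have "h \<ominus>\<^bsub>E j\<^esub> b \<in> B j"
      using B_add[OF h B_act[OF assms(1), of "- 1"]] b by (simp add: a_minus_def E.act_uminus)
    moreover have "h = (h \<ominus>\<^bsub>E j\<^esub> b) \<oplus>\<^bsub>E j\<^esub> b"
      using b B_carrier[OF h] by (simp add: a_minus_def E.a_assoc E.l_neg)
    ultimately show ?thesis by blast
  qed
  show ?thesis
  proof (intro equalityI subsetI)
    fix z assume "z \<in> B j +>\<^bsub>E j\<^esub> (b \<oplus>\<^bsub>E j\<^esub> x)"
    then obtain h where h: "h \<in> B j" "z = h \<oplus>\<^bsub>E j\<^esub> (b \<oplus>\<^bsub>E j\<^esub> x)" unfolding a_r_coset_def' by blast
    then show "z \<in> B j +>\<^bsub>E j\<^esub> x"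
      unfolding a_r_coset_def' using assoc[OF h(1)] B_add[OF h(1) assms(1)] by blast
  next
    fix z assume "z \<in> B j +>\<^bsub>E j\<^esub> x"
    then obtain h where h: "h \<in> B j" "z = h \<oplus>\<^bsub>E j\<^esub> x" unfolding a_r_coset_def' by blast
    then obtain h' where "h' \<in> B j" "h = h' \<oplus>\<^bsub>E j\<^esub> b" using ex by blast
    then show "z \<in> B j +>\<^bsub>E j\<^esub> (b \<oplus>\<^bsub>E j\<^esub> x)"
      unfolding a_r_coset_def' using h(2) assoc[of h'] by blast
  qed
qed

lemma lc_component_simps:
  fixes j :: nat and n :: int
  defines "H \<equiv> lc_component_module I E \<E> \<delta> j n"
  shows "carrier H = (\<lambda>x. B j +>\<^bsub>E j\<^esub> x) ` {x \<in> tors j UNIV n. \<delta> j x = \<zero>\<^bsub>E (Suc j)\<^esub>}"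
    and "\<zero>\<^bsub>H\<^esub> = B j"
    and "x \<in> carrier (E j) \<Longrightarrow> a \<odot>\<^bsub>H\<^esub> (B j +>\<^bsub>E j\<^esub> x) = B j +>\<^bsub>E j\<^esub> act' j (const_poly a) x"
proof -
  have coset: "A +>\<^bsub>\<Gamma> j\<^esub> x = A +>\<^bsub>E j\<^esub> x" "A +>\<^bsub>(\<Gamma> j)\<lparr>carrier := Z\<rparr>\<^esub> x = A +>\<^bsub>E j\<^esub> x" for A x Z
    by (simp_all add: a_r_coset_def')
  have "cocycles \<Gamma> \<delta> j \<inter> \<E> j n = {x \<in> tors j UNIV n. \<delta> j x = \<zero>\<^bsub>E (Suc j)\<^esub>}"
    unfolding torsion_component[symmetric] by (auto simp: cocycles_def)
  then show "carrier H = (\<lambda>x. B j +>\<^bsub>E j\<^esub> x) ` {x \<in> tors j UNIV n. \<delta> j x = \<zero>\<^bsub>E (Suc j)\<^esub>}"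
    by (simp add: H_def lc_component_module_def Let_def local_cohomology_component_def
        cohomology_component_def coset)
  show "\<zero>\<^bsub>H\<^esub> = B j"
    by (simp add: H_def lc_component_module_def Let_def local_cohomology_def cohomology_def quotient_module_def)
  assume x: "x \<in> carrier (E j)"
  have "a \<odot>\<^bsub>H\<^esub> (B j +>\<^bsub>E j\<^esub> x) = (\<Union>y\<in>B j +>\<^bsub>E j\<^esub> x. B j +>\<^bsub>E j\<^esub> act' j (const_poly a) y)"
    by (simp add: H_def lc_component_module_def Let_def local_cohomology_def cohomology_def
        quotient_module_def coset act_def)
  also have "\<dots> = (\<Union>y\<in>B j +>\<^bsub>E j\<^esub> x. B j +>\<^bsub>E j\<^esub> act' j (const_poly a) x)"
  proof (rule SUP_cong[OF refl])
    fix y assume "y \<in> B j +>\<^bsub>E j\<^esub> x"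
    then obtain b where b: "b \<in> B j" "y = b \<oplus>\<^bsub>E j\<^esub> x" by (auto simp: a_r_coset_def')
    then have "act' j (const_poly a) y = act' j (const_poly a) b \<oplus>\<^bsub>E j\<^esub> act' j (const_poly a) x"
      using x B_carrier by (simp add: E.act_add)
    then show "B j +>\<^bsub>E j\<^esub> act' j (const_poly a) y = B j +>\<^bsub>E j\<^esub> act' j (const_poly a) x"
      using coset_shift[OF B_act[OF b(1)]] x by simp
  qed
  also have "\<dots> = B j +>\<^bsub>E j\<^esub> act' j (const_poly a) x"
    using B_zero[of j] by (auto simp: a_r_coset_def')
  finally show "a \<odot>\<^bsub>H\<^esub> (B j +>\<^bsub>E j\<^esub> x) = B j +>\<^bsub>E j\<^esub> act' j (const_poly a) x" .
qed

text \<open>\<open>P\<close> is the annihilator of the class of a cocycle, so it contains a power of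
  each element of the content, and it is prime.\<close>

lemma content_in_associated_primes:
  assumes pos: "\<And>i. dg i > 0"
    and P: "P \<in> associated_primes cring_class_ops (lc_component_module I E \<E> \<delta> CARD('n) n)"
  shows "content_ideal I \<subseteq> P"
proof
  let ?s = "CARD('n)"
  obtain x where x: "x \<in> tors ?s UNIV n" "\<delta> ?s x = \<zero>\<^bsub>E (Suc ?s)\<^esub>" and prime: "primeideal P cring_class_ops"
    and Pm: "\<And>a. a \<in> P \<longleftrightarrow> act' ?s (const_poly a) x \<in> B ?s"
  proof -
    obtain x where x: "x \<in> tors ?s UNIV n" "\<delta> ?s x = \<zero>\<^bsub>E (Suc ?s)\<^esub>"
      "P = {a. B ?s +>\<^bsub>E ?s\<^esub> act' ?s (const_poly a) x = B ?s}"
    proof -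
      let ?H = "lc_component_module I E \<E> \<delta> ?s n"
      obtain X where X: "X \<in> carrier ?H" "P = {a. a \<odot>\<^bsub>?H\<^esub> X = \<zero>\<^bsub>?H\<^esub>}"
        using P by (auto simp: associated_primes_def carrier_class)
      then obtain x where x: "x \<in> tors ?s UNIV n" "\<delta> ?s x = \<zero>\<^bsub>E (Suc ?s)\<^esub>" "X = B ?s +>\<^bsub>E ?s\<^esub> x"
        by (auto simp: lc_component_simps(1))
      have "P = {a. B ?s +>\<^bsub>E ?s\<^esub> act' ?s (const_poly a) x = B ?s}"
        unfolding X(2) x(3) lc_component_simps(2) lc_component_simps(3)[OF tors_carrier[OF x(1)]] ..
      then show thesis using that x by blast
    qed
    then show ?thesis
      using that[of x] P B_coset_eq_iff[OF E.act_closed[OF tors_carrier[OF x(1)]]]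
      by (auto simp: associated_primes_def)
  qed
  fix a assume "a \<in> content_ideal I"
  then obtain N where N: "a ^ N \<in> P" using content_nilpotent[OF pos x] Pm by blast
  \<comment> \<open>Excludes the exponent 0 in the descent from a ^ N to a.\<close>
  have one: "1 \<notin> P"
  proof
    assume "1 \<in> P"
    then have "P = UNIV"
      using ideal_ofD(4)[of UNIV P _ 1] prime unfolding primeideal_def ideal_of_UNIV_iff by auto
    then show False using primeideal.I_notcarr[OF prime] by (auto simp: carrier_class)
  qed
  show "a \<in> P"
    using N
  proof (induction N)
    case 0
    then show ?case using one by simp
  next
    case (Suc N)
    then show ?case
      using primeideal.I_prime[OF prime, of a "a ^ N"] by (auto simp: carrier_class times_class)
  qed
qed

lemma lc_component_zero_iff:
  assumes pos: "\<And>i. dg i > 0" and d: "d \<in> top_degrees dg"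
  defines "H \<equiv> lc_component_module I E \<E> \<delta> CARD('n) (- d)"
  shows "carrier H = {\<zero>\<^bsub>H\<^esub>} \<longleftrightarrow> content_ideal I = UNIV"
proof
  let ?s = "CARD('n)"
  assume H: "carrier H = {\<zero>\<^bsub>H\<^esub>}"
  have "x \<in> B ?s" if x: "x \<in> tors ?s UNIV (- d)" "\<delta> ?s x = \<zero>\<^bsub>E (Suc ?s)\<^esub>" for x
  proof -
    have "B ?s +>\<^bsub>E ?s\<^esub> x \<in> carrier H" using x by (auto simp: H_def lc_component_simps(1))
    then show ?thesis
      using H B_coset_eq_iff[OF tors_carrier[OF x(1)]] by (simp add: H_def lc_component_simps(2))
  qed
  then show "content_ideal I = UNIV" by (rule content_UNIV_if_vanishing[OF d])
next
  let ?s = "CARD('n)"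
  assume c: "content_ideal I = UNIV"
  have "B ?s +>\<^bsub>E ?s\<^esub> x = B ?s" if x: "x \<in> tors ?s UNIV (- d)" "\<delta> ?s x = \<zero>\<^bsub>E (Suc ?s)\<^esub>" for x
  proof -
    \<comment> \<open>Nilpotency of 1 on the class of \<open>x\<close> means that the class is
      zero.\<close>
    obtain N where "act' ?s (const_poly (1 ^ N)) x \<in> B ?s" using content_nilpotent[OF pos x, of 1] c by auto
    moreover have "const_poly 1 = (1 :: ('n, 'a) mpoly)" by (simp add: const_poly_def)
    ultimately show ?thesis using B_coset_eq_iff tors_carrier[OF x(1)] by simp
  qed
  moreover have "\<zero>\<^bsub>E ?s\<^esub> \<in> {x \<in> tors ?s UNIV (- d). \<delta> ?s x = \<zero>\<^bsub>E (Suc ?s)\<^esub>}" by simp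
  ultimately show "carrier H = {\<zero>\<^bsub>H\<^esub>}"
    unfolding H_def lc_component_simps(1,2) by blast
qed

end

theorem theorem2p6:
  fixes dg :: "'n::finite \<Rightarrow> nat"
    and fs :: "('n, 'a::idom) mpoly list"
    and I :: "('n, 'a) mpoly set"
    and E :: "nat \<Rightarrow> (('n, 'a) mpoly set, 'e) module"
    and \<E> :: "nat \<Rightarrow> int \<Rightarrow> 'e set"
    and \<epsilon> :: "('n, 'a) mpoly set \<Rightarrow> 'e"
    and \<delta> :: "nat \<Rightarrow> 'e \<Rightarrow> 'e"
    and d :: int
  assumes noeth: "noetherian_ring (cring_class_ops :: 'a ring)"
    and deg_pos: "\<And>i. dg i > 0"
    and homog: "\<And>f. f \<in> set fs \<Longrightarrow> homogeneous_poly dg f"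
    and I: "I = Idl\<^bsub>cring_class_ops\<^esub> (set fs)"
    and resolution: "graded_injective_resolution (quot_ring I) (quot_component dg I)
          (regular_module (quot_ring I)) (quot_component dg I) E \<E> \<epsilon> \<delta>"
    and d: "d \<in> top_degrees dg"
  shows "let H = lc_component_module I E \<E> \<delta> CARD('n) (- d) in
           (\<forall>P \<in> associated_primes cring_class_ops H. content_ideal I \<subseteq> P) \<and>
           (carrier H = {\<zero>\<^bsub>H\<^esub>} \<longleftrightarrow> content_ideal I = UNIV)"
proof -
  interpret graded_resolution dg I E \<E> \<epsilon> \<delta>
  proof
    show "acc_ideals (UNIV :: ('n, 'a) mpoly set)" by (rule acc_ideals_mpoly[OF noeth])
    show "ideal_of UNIV I" unfolding I by (rule Idl_class(1))
    show "hom_comp dg k f \<in> I" if "f \<in> I" for k f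
      using hom_comp_Idl[OF homog] that unfolding I by blast
  qed (rule resolution)
  show ?thesis
    unfolding Let_def using content_in_associated_primes[OF deg_pos] lc_component_zero_iff[OF deg_pos d] by blast
qed

end
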